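(* Fix integers $0\le k<m$, $n\ge1$, $r\ge1$. Let $\tau\subset TI^m$ be a smooth hyperplane field and $\sigma:I^m\to J^r(\mathbb R^m,\mathbb R^n)$ a smooth section such that $\sigma=0$ on an open neighborhood of $\partial I^m$ and $\sigma^\perp=0$ on all of $I^m$ with respect to $\tau$. Then for every $\varepsilon>0$ there exist an isotopy $F_t:I^m\to I^m$ and a holonomic section $\hat\sigma:I^m\to J^r(\mathbb R^m,\mathbb R^n)$ such that: $\mathrm{dist}_{C^0}(\hat\sigma,\sigma)<\varepsilon$ on an open neighborhood of $F_1(I^k)$; $\|\hat\sigma^\perp\|_{C^0}<\varepsilon$ on all of $I^m$; $\mathrm{dist}_{C^0}(F_t,\mathrm{id})<\varepsilon$; and $F_t=\mathrm{id}_{I^m}$ and $\hat\sigma=0$ on an open neighborhood of $\partial I^m$.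
   Context: $I=[-1,1]$, $I^k=I^k\times\{0\}^{m-k}\subset I^m$. $J^r(\mathbb R^m,\mathbb R^n)\cong\mathbb R^m\times(\mathcal P_r)^n$ via Taylor polynomials of degree $\le r$, with linear structure from $\mathbb R^n$; $0$ is the jet of the zero map. For a hyperplane field $\tau$, the $\perp$-component $\sigma^\perp(x)$ of an $r$-jet $\sigma(x)=j^r(h)(x)$ records the $(r-1)$-jet of $h$ at $x$ together with the derivatives $\partial_\nu\partial_\alpha h(x)$ for $|\alpha|=r-1$ and $\nu\in\tau_x$ (equivalently, the restriction of $d(j^{r-1}h)$ to $\tau_x$); $\sigma^\perp=0$ means all these vanish. Norms: $\|j^\perp(h)(x)\|=\sup|\partial_\nu\partial_\alpha h(x)|$ over $|\alpha|<r$ and unit $\nu\in\tau_x$, together with the $(r-1)$-jet entries. A section is holonomic if it equals $j^r(h)$. *)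

theory Defs
  imports "HOL-Analysis.Analysis" "HOL-Library.Multiset"
begin

fun pdl :: "'a::real_normed_vector list \<Rightarrow> ('a \<Rightarrow> 'b::real_normed_vector) \<Rightarrow> 'a \<Rightarrow> 'b" where
  "pdl [] f = f"
| "pdl (v # vs) f = (\<lambda>x. frechet_derivative (pdl vs f) (at x) v)"

definition smooth_on :: "'a::real_normed_vector set \<Rightarrow> ('a \<Rightarrow> 'b::real_normed_vector) \<Rightarrow> bool" where
  "smooth_on U f \<longleftrightarrow> open U \<and> (\<forall>vs. \<forall>x\<in>U. pdl vs f differentiable (at x))"

definition smooth_on_set :: "'a::real_normed_vector set \<Rightarrow> ('a \<Rightarrow> 'b::real_normed_vector) \<Rightarrow> bool" where
  "smooth_on_set S f \<longleftrightarrow> (\<exists>U g. open U \<and> S \<subseteq> U \<and> smooth_on U g \<and> (\<forall>x\<in>S. g x = f x))"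

definition cube :: "(real^'m) set" where
  "cube = {x. \<forall>i. \<bar>x $ i\<bar> \<le> 1}"

text \<open>I^k = I^k x 0^(m-k): coordinates are numbered 0..m-1 via the enumeration e.\<close>
definition cube_k :: "('m \<Rightarrow> nat) \<Rightarrow> nat \<Rightarrow> (real^'m) set" where
  "cube_k e k = {x \<in> cube. \<forall>i. k \<le> e i \<longrightarrow> x $ i = 0}"

text \<open>An r-jet section is given by its Taylor coefficients: sigma x alpha is the
  alpha-th partial derivative entry (alpha a multi-index = multiset of coordinates,
  only size alpha <= r is relevant).\<close>
type_synonym ('m, 'n) jet_section = "real^'m \<Rightarrow> 'm multiset \<Rightarrow> real^'n"

definition pd_ms :: "'m multiset \<Rightarrow> (real^'m \<Rightarrow> real^'n) \<Rightarrow> real^'m \<Rightarrow> real^'n" where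
  "pd_ms \<alpha> h = pdl (map (\<lambda>i. axis i 1) (SOME l. mset l = \<alpha>)) h"

definition smooth_jet_section :: "nat \<Rightarrow> ('m::finite, 'n::finite) jet_section \<Rightarrow> bool" where
  "smooth_jet_section r \<sigma> \<longleftrightarrow> (\<forall>\<alpha>. size \<alpha> \<le> r \<longrightarrow> smooth_on_set cube (\<lambda>x. \<sigma> x \<alpha>))"

definition holonomic :: "nat \<Rightarrow> ('m::finite, 'n::finite) jet_section \<Rightarrow> bool" where
  "holonomic r \<sigma> \<longleftrightarrow> (\<exists>U h. open U \<and> cube \<subseteq> U \<and> smooth_on U h \<and>
      (\<forall>x\<in>cube. \<forall>\<alpha>. size \<alpha> \<le> r \<longrightarrow> \<sigma> x \<alpha> = pd_ms \<alpha> h x))"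

text \<open>The derivative entry d_nu d_alpha of the jet, for |alpha| = r-1 (resp. any |alpha| < r).\<close>
definition jet_dir :: "('m::finite, 'n::finite) jet_section \<Rightarrow> real^'m \<Rightarrow> real^'m \<Rightarrow> 'm multiset \<Rightarrow> real^'n" where
  "jet_dir \<sigma> x \<nu> \<alpha> = (\<Sum>i\<in>UNIV. (\<nu> $ i) *\<^sub>R \<sigma> x (add_mset i \<alpha>))"

definition perp_zero_at :: "nat \<Rightarrow> (real^'m \<Rightarrow> (real^'m) set) \<Rightarrow> ('m::finite, 'n::finite) jet_section \<Rightarrow> real^'m \<Rightarrow> bool" where
  "perp_zero_at r \<tau> \<sigma> x \<longleftrightarrow>
     (\<forall>\<alpha>. size \<alpha> < r \<longrightarrow> \<sigma> x \<alpha> = 0) \<and>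
     (\<forall>\<alpha>. size \<alpha> = r - 1 \<longrightarrow> (\<forall>\<nu>\<in>\<tau> x. jet_dir \<sigma> x \<nu> \<alpha> = 0))"

definition perp_bound_at :: "nat \<Rightarrow> (real^'m \<Rightarrow> (real^'m) set) \<Rightarrow> ('m::finite, 'n::finite) jet_section \<Rightarrow> real^'m \<Rightarrow> real \<Rightarrow> bool" where
  "perp_bound_at r \<tau> \<sigma> x d \<longleftrightarrow>
     (\<forall>\<alpha>. size \<alpha> < r \<longrightarrow> norm (\<sigma> x \<alpha>) \<le> d) \<and>
     (\<forall>\<alpha>. size \<alpha> < r \<longrightarrow> (\<forall>\<nu>\<in>\<tau> x. norm \<nu> = 1 \<longrightarrow> norm (jet_dir \<sigma> x \<nu> \<alpha>) \<le> d))"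

definition smooth_hyperplane_field :: "(real^'m::finite \<Rightarrow> (real^'m) set) \<Rightarrow> bool" where
  "smooth_hyperplane_field \<tau> \<longleftrightarrow>
     (\<forall>x\<in>cube. \<exists>V N. open V \<and> x \<in> V \<and> smooth_on V N \<and>
        (\<forall>y\<in>V. N y \<noteq> 0) \<and> (\<forall>y\<in>V \<inter> cube. \<tau> y = {v. N y \<bullet> v = 0}))"

definition isotopy :: "(real \<Rightarrow> real^'m::finite \<Rightarrow> real^'m) \<Rightarrow> bool" where
  "isotopy F \<longleftrightarrow> smooth_on_set ({0..1} \<times> cube) (\<lambda>(t, x). F t x) \<and>
     (\<forall>x\<in>cube. F 0 x = x) \<and>
     (\<forall>t\<in>{0..1}. bij_betw (F t) cube cube \<and> smooth_on_set cube (inv_into cube (F t)))"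

end

(*
The condition on the perp component says that sigma is a multiple c(x) n(x)^r of the r-th power of the conormal
n of tau, with no lower order terms. Near a point, c n^r is therefore close to the r-jet of P^r c U(theta/P),
where d theta is close to n and the r-th derivative of U is one; for small P the lower order jet is small, and so is
every r-th derivative with one direction in tau. A bounded U has r-th derivative one only on part of the line, so
two such functions, shifted by half a period, are placed at two different heights over the hyperplane
containing I^k, and the hyperplane is corrugated: it moves from one height to the other exactly where both functions
are good. Pieces of a partition of unity are treated one after the other, each corrugation being much finer than
the previous ones. All corrugations are graphs over the hyperplane in one direction v, and v must be in tau for the
phases to be constant along v; such a v exists wherever tau is not parallel to the hyperplane, and it is straightened
to a coordinate direction by a diffeomorphism. Where tau is nearly parallel to the hyperplane, the height itself is
a phase and no corrugation is needed.
*)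

theory Submission
  imports Defs
begin

section \<open>Smooth functions\<close>

text \<open>A corrugation must be fine, hence steep, and stacked corrugations get ever steeper. This
  does no harm because the isotopy is a shear along one coordinate and the graph function does not
  depend on that coordinate: inverting the shear involves only the supremum of the graph function
  and the slope of a cutoff. Hence the common direction for all pieces, and the straightening that
  provides it. Each new height is fixed before its period. It stays in the zone where all earlier
  functions are good, so they remain good; and the cutoff between the two heights does not depend on
  the period, so its derivatives are swallowed by positive powers of the period. Far from the
  hypersurface the r-th derivatives of the profiles are merely bounded. There the jet need not
  resemble \<open>\<sigma>\<close>, yet in directions of the field it is small, being a sum of
  bounded multiples of powers that all nearly vanish there. Transverse directions can be averaged
  because lying almost in a hyperplane, at prescribed vertical component, is a convex
  condition.\<close>

definition ck :: "nat \<Rightarrow> ('a::real_normed_vector \<Rightarrow> 'b::real_normed_vector) \<Rightarrow> bool" where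
  "ck n f \<longleftrightarrow> (\<forall>vs x. length vs \<le> n \<longrightarrow> pdl vs f differentiable (at x))"

abbreviation smooth :: "('a::real_normed_vector \<Rightarrow> 'b::real_normed_vector) \<Rightarrow> bool" where
  "smooth f \<equiv> smooth_on UNIV f"

lemma smooth_iff_ck: "smooth f \<longleftrightarrow> (\<forall>n. ck n f)"
  unfolding smooth_on_def ck_def by auto

lemma smooth_ck: "smooth f \<Longrightarrow> ck n f"
  by (simp add: smooth_iff_ck)

text \<open>The head of the list is the derivative taken last. Appending at the end exposes the one
  taken first, which is what an induction that replaces \<open>f\<close> by its derivative
  needs.\<close>

lemma pdl_snoc: "pdl (vs @ [v]) f = pdl vs (\<lambda>x. frechet_derivative f (at x) v)"
  by (induction vs) auto

lemma ck_0: "ck 0 f \<longleftrightarrow> (\<forall>x. f differentiable (at x))"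
  by (simp add: ck_def)

text \<open>\<open>ck n\<close> asks for differentiability even of the derivatives of order
  \<open>n\<close>, so level 0 is already differentiability. With this recursion every closure rule
  below becomes an induction on \<open>n\<close> whose step needs only a formula for one
  derivative.\<close>

lemma ck_Suc:
  "ck (Suc n) f \<longleftrightarrow> (\<forall>x. f differentiable (at x)) \<and> (\<forall>v. ck n (\<lambda>x. frechet_derivative f (at x) v))"
proof
  assume *: "ck (Suc n) f"
  have "pdl vs (\<lambda>x. frechet_derivative f (at x) v) differentiable at x" if "length vs \<le> n" for vs x v
    using *[unfolded ck_def, rule_format, of "vs @ [v]" x] that by (simp add: pdl_snoc)
  moreover have "f differentiable at x" for x
    using *[unfolded ck_def, rule_format, of "[]" x] by simp
  ultimately show "(\<forall>x. f differentiable (at x)) \<and> (\<forall>v. ck n (\<lambda>x. frechet_derivative f (at x) v))"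
    by (auto simp: ck_def)
next
  assume *: "(\<forall>x. f differentiable (at x)) \<and> (\<forall>v. ck n (\<lambda>x. frechet_derivative f (at x) v))"
  show "ck (Suc n) f"
    unfolding ck_def
  proof (intro allI impI)
    fix vs :: "'a list" and x
    assume "length vs \<le> Suc n"
    then show "pdl vs f differentiable at x"
      using * by (cases vs rule: rev_cases) (auto simp: pdl_snoc ck_def)
  qed
qed

lemma ck_Suc_lower: "ck (Suc n) f \<Longrightarrow> ck n f"
  by (auto simp: ck_def)

lemma ck_differentiable: "ck n f \<Longrightarrow> f differentiable (at x)"
  by (auto simp: ck_def dest: spec[of _ "[]"])

lemma ck_has_derivative: "ck n f \<Longrightarrow> (f has_derivative frechet_derivative f (at x)) (at x)"
  using ck_differentiable frechet_derivative_works by blast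

lemma ck_SucI:
  assumes "\<And>x. (f has_derivative f' x) (at x)" "\<And>v. ck n (\<lambda>x. f' x v)"
  shows "ck (Suc n) f"
proof -
  have "frechet_derivative f (at x) = f' x" for x
    using assms(1) frechet_derivative_at by metis
  then show ?thesis
    using assms by (auto simp: ck_Suc differentiable_def)
qed

lemma ck_const: "ck n (\<lambda>x. c)"
proof (induction n arbitrary: c)
  case 0 show ?case by (simp add: ck_0)
next
  case (Suc n) show ?case
    by (rule ck_SucI[where f' = "\<lambda>x v. 0"]) (use Suc in auto)
qed

lemma ck_bounded_linear: assumes "bounded_linear f" shows "ck n f"
proof (cases n)
  case 0 then show ?thesis
    using assms by (auto simp: ck_0 intro: bounded_linear_imp_differentiable)
next
  case (Suc k) show ?thesis
    unfolding Suc
    by (rule ck_SucI[where f' = "\<lambda>x. f"])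
      (use assms in \<open>auto intro: bounded_linear_imp_has_derivative ck_const\<close>)
qed

lemma ck_add:
  assumes "ck n f" "ck n g" shows "ck n (\<lambda>x. f x + g x)"
  using assms
proof (induction n arbitrary: f g)
  case 0 then show ?case by (auto simp: ck_0 intro: differentiable_add)
next
  case (Suc n)
  show ?case
  proof (rule ck_SucI)
    show "((\<lambda>x. f x + g x) has_derivative
        (\<lambda>v. frechet_derivative f (at x) v + frechet_derivative g (at x) v)) (at x)" for x
      by (intro has_derivative_add ck_has_derivative[OF Suc.prems(1)] ck_has_derivative[OF Suc.prems(2)])
    show "ck n (\<lambda>x. frechet_derivative f (at x) v + frechet_derivative g (at x) v)" for v
      using Suc by (auto simp: ck_Suc)
  qed
qed

lemma (in bounded_bilinear) ck_bilinear:
  assumes "ck n f" "ck n g" shows "ck n (\<lambda>x. prod (f x) (g x))"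
  using assms
proof (induction n arbitrary: f g)
  case 0 then show ?case
    unfolding ck_0 differentiable_def by (blast intro: FDERIV)
next
  case (Suc n)
  note low = Suc.prems[THEN ck_Suc_lower]
  have d: "ck n (\<lambda>x. frechet_derivative f (at x) v)" "ck n (\<lambda>x. frechet_derivative g (at x) v)" for v
    using Suc.prems by (auto simp: ck_Suc)
  show ?case
  proof (rule ck_SucI)
    show "((\<lambda>x. prod (f x) (g x)) has_derivative
        (\<lambda>v. prod (f x) (frechet_derivative g (at x) v) + prod (frechet_derivative f (at x) v) (g x))) (at x)" for x
      by (intro FDERIV ck_has_derivative[OF Suc.prems(1)] ck_has_derivative[OF Suc.prems(2)])
    show "ck n (\<lambda>x. prod (f x) (frechet_derivative g (at x) v) + prod (frechet_derivative f (at x) v) (g x))" for v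
      by (intro ck_add Suc.IH low d)
  qed
qed

text \<open>The induction hypothesis covers derivatives in fixed directions, but the chain rule
  evaluates the derivative of \<open>f\<close> in a direction that moves with \<open>x\<close>.
  Expanding that direction in \<open>Basis\<close> leaves products of \<open>ck n\<close> functions;
  hence the Euclidean middle space.\<close>

lemma ck_compose:
  fixes g :: "'a::real_normed_vector \<Rightarrow> 'b::euclidean_space"
    and f :: "'b \<Rightarrow> 'c::real_normed_vector"
  assumes "ck n f" "ck n g" shows "ck n (\<lambda>x. f (g x))"
  using assms
proof (induction n arbitrary: f g)
  case 0 then show ?case
    unfolding ck_0 differentiable_def by (blast intro: has_derivative_compose)
next
  case (Suc n)
  have exp: "frechet_derivative f (at y) w = (\<Sum>b\<in>Basis. (w \<bullet> b) *\<^sub>R frechet_derivative f (at y) b)" for y w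
  proof -
    have l: "linear (frechet_derivative f (at y))"
      using Suc.prems(1) ck_differentiable linear_frechet_derivative by blast
    have "frechet_derivative f (at y) w = frechet_derivative f (at y) (\<Sum>b\<in>Basis. (w \<bullet> b) *\<^sub>R b)"
      by (simp add: euclidean_representation)
    also have "\<dots> = (\<Sum>b\<in>Basis. (w \<bullet> b) *\<^sub>R frechet_derivative f (at y) b)"
      using l by (simp add: linear_sum linear_cmul)
    finally show ?thesis .
  qed
  have ck_sum': "ck n (\<lambda>x. \<Sum>b\<in>B. F b x)" if "\<And>b. b \<in> B \<Longrightarrow> ck n (F b)" for B and F :: "'b \<Rightarrow> 'a \<Rightarrow> 'c"
    using that by (induction B rule: infinite_finite_induct) (auto intro: ck_const ck_add)
  have c: "ck n (\<lambda>x. frechet_derivative f (at (g x)) (frechet_derivative g (at x) v))" for v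
    unfolding exp[of _ "frechet_derivative g _ v"]
  proof (rule ck_sum')
    fix b :: 'b
    have "ck n (\<lambda>x. frechet_derivative f (at (g x)) b)"
      using Suc.prems(1) by (intro Suc.IH[of "\<lambda>y. frechet_derivative f (at y) b" g] ck_Suc_lower[OF Suc.prems(2)]) (simp add: ck_Suc)
    moreover have "ck n (\<lambda>x. frechet_derivative g (at x) v \<bullet> b)"
      using Suc.prems(2) by (intro bounded_bilinear.ck_bilinear[OF bounded_bilinear_inner _ ck_const]) (simp add: ck_Suc)
    ultimately show "ck n (\<lambda>x. (frechet_derivative g (at x) v \<bullet> b) *\<^sub>R frechet_derivative f (at (g x)) b)"
      by (intro bounded_bilinear.ck_bilinear[OF bounded_bilinear_scaleR])
  qed
  show ?case
  proof (rule ck_SucI)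
    show "((\<lambda>x. f (g x)) has_derivative
        (\<lambda>v. frechet_derivative f (at (g x)) (frechet_derivative g (at x) v))) (at x)" for x
      by (rule has_derivative_compose[OF ck_has_derivative[OF Suc.prems(2)] ck_has_derivative[OF Suc.prems(1)]])
  qed (rule c)
qed

lemma ck_inverse:
  fixes f :: "'a::real_normed_vector \<Rightarrow> real"
  assumes "ck n f" "\<And>x. f x \<noteq> 0" shows "ck n (\<lambda>x. inverse (f x))"
  using assms
proof (induction n)
  case 0
  have "((\<lambda>x. inverse (f x)) has_derivative
      (\<lambda>v. - (inverse (f x) * frechet_derivative f (at x) v * inverse (f x)))) (at x)" for x
    by (rule Deriv.has_derivative_inverse[OF 0(2) ck_has_derivative[OF 0(1)]])
  then show ?case unfolding ck_0 differentiable_def by blast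
next
  case (Suc n)
  have d: "ck n (\<lambda>x. frechet_derivative f (at x) v)" for v
    using Suc.prems by (auto simp: ck_Suc)
  have i: "ck n (\<lambda>x. inverse (f x))"
    using Suc.IH[OF ck_Suc_lower[OF Suc.prems(1)]] Suc.prems(2) .
  have "ck n (\<lambda>x. (- 1) * (inverse (f x) * frechet_derivative f (at x) v * inverse (f x)))" for v
    by (intro bounded_bilinear.ck_bilinear[OF bounded_bilinear_mult] ck_const i d)
  then have c: "ck n (\<lambda>x. - (inverse (f x) * frechet_derivative f (at x) v * inverse (f x)))" for v
    by simp
  show ?case
  proof (rule ck_SucI)
    show "((\<lambda>x. inverse (f x)) has_derivative
        (\<lambda>v. - (inverse (f x) * frechet_derivative f (at x) v * inverse (f x)))) (at x)" for x
      by (rule Deriv.has_derivative_inverse[OF Suc.prems(2) ck_has_derivative[OF Suc.prems(1)]])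
  qed (rule c)
qed

lemma smooth_has_derivative: "smooth f \<Longrightarrow> (f has_derivative frechet_derivative f (at x)) (at x)"
  using smooth_ck ck_has_derivative by blast

lemma smooth_continuous: "smooth f \<Longrightarrow> continuous_on S f"
  by (meson smooth_has_derivative continuous_at_imp_continuous_on has_derivative_continuous)

lemma smooth_derivative: "smooth f \<Longrightarrow> smooth (\<lambda>x. frechet_derivative f (at x) v)"
  unfolding smooth_iff_ck
proof
  fix n assume "\<forall>n. ck n f"
  then have "ck (Suc n) f" by blast
  then show "ck n (\<lambda>x. frechet_derivative f (at x) v)" by (simp add: ck_Suc)
qed

lemma smooth_pdl: "smooth f \<Longrightarrow> smooth (pdl vs f)"
  by (induction vs) (auto intro: smooth_derivative)

lemma smooth_const: "smooth (\<lambda>x. c)"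
  by (simp add: smooth_iff_ck ck_const)

lemma smooth_bounded_linear: "bounded_linear f \<Longrightarrow> smooth f"
  by (simp add: smooth_iff_ck ck_bounded_linear)

lemma smooth_id: "smooth (\<lambda>x. x)"
  by (simp add: smooth_bounded_linear)

lemma smooth_add: "smooth f \<Longrightarrow> smooth g \<Longrightarrow> smooth (\<lambda>x. f x + g x)"
  by (simp add: smooth_iff_ck ck_add)

lemma smooth_scaleR: "smooth f \<Longrightarrow> smooth g \<Longrightarrow> smooth (\<lambda>x. f x *\<^sub>R g x)"
  by (simp add: smooth_iff_ck bounded_bilinear.ck_bilinear[OF bounded_bilinear_scaleR])

lemma smooth_mult:
  "smooth f \<Longrightarrow> smooth g \<Longrightarrow> smooth (\<lambda>x. f x * (g x :: 'a :: real_normed_algebra))"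
  by (simp add: smooth_iff_ck bounded_bilinear.ck_bilinear[OF bounded_bilinear_mult])

lemma smooth_inner: "smooth f \<Longrightarrow> smooth g \<Longrightarrow> smooth (\<lambda>x. f x \<bullet> g x)"
  by (simp add: smooth_iff_ck bounded_bilinear.ck_bilinear[OF bounded_bilinear_inner])

lemma smooth_minus: "smooth f \<Longrightarrow> smooth (\<lambda>x. - f x)"
  using smooth_scaleR[OF smooth_const[of "-1"]] by fastforce

lemma smooth_diff: "smooth f \<Longrightarrow> smooth g \<Longrightarrow> smooth (\<lambda>x. f x - g x)"
  using smooth_add[OF _ smooth_minus] by fastforce

lemma smooth_compose:
  fixes g :: "'a::real_normed_vector \<Rightarrow> 'b::euclidean_space"
  shows "smooth f \<Longrightarrow> smooth g \<Longrightarrow> smooth (\<lambda>x. f (g x))"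
  by (simp add: smooth_iff_ck ck_compose)

lemma smooth_divide:
  fixes f g :: "'a::real_normed_vector \<Rightarrow> real"
  shows "smooth f \<Longrightarrow> smooth g \<Longrightarrow> (\<And>x. g x \<noteq> 0) \<Longrightarrow> smooth (\<lambda>x. f x / g x)"
  unfolding divide_inverse
  by (intro smooth_mult) (auto simp: smooth_iff_ck ck_inverse)

lemma smooth_sum: "(\<And>i. i \<in> I \<Longrightarrow> smooth (f i)) \<Longrightarrow> smooth (\<lambda>x. \<Sum>i\<in>I. f i x)"
  by (induction I rule: infinite_finite_induct) (auto intro: smooth_const smooth_add)

lemma smooth_prod:
  fixes f :: "'i \<Rightarrow> 'a::real_normed_vector \<Rightarrow> real"
  shows "(\<And>i. i \<in> I \<Longrightarrow> smooth (f i)) \<Longrightarrow> smooth (\<lambda>x. \<Prod>i\<in>I. f i x)"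
  by (induction I rule: infinite_finite_induct) (auto intro: smooth_const smooth_mult)

lemma smooth_power:
  fixes f :: "'a::real_normed_vector \<Rightarrow> real"
  shows "smooth f \<Longrightarrow> smooth (\<lambda>x. f x ^ n)"
  by (induction n) (auto intro: smooth_const smooth_mult)

lemma smooth_component:
  fixes f :: "'a::real_normed_vector \<Rightarrow> real^'i"
  shows "smooth f \<Longrightarrow> smooth (\<lambda>x. f x $ i)"
  using smooth_compose[OF smooth_bounded_linear[OF bounded_linear_vec_nth[of i]], of f] by simp

lemma smooth_vec_lambda:
  fixes f :: "'i::finite \<Rightarrow> 'a::real_normed_vector \<Rightarrow> real"
  assumes "\<And>i. smooth (f i)" shows "smooth (\<lambda>x. \<chi> i. f i x)"
proof -
  have "(\<lambda>x. \<chi> i. f i x) = (\<lambda>x. \<Sum>i\<in>UNIV. f i x *\<^sub>R axis i 1)"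
    by (auto simp: vec_eq_iff axis_def if_distrib cong: if_cong)
  then show ?thesis
    by (auto intro!: smooth_sum smooth_scaleR smooth_const assms)
qed

section \<open>Bump functions and partitions of unity\<close>

text \<open>The powers of \<open>1/x\<close> are included because the family is then closed under
  differentiation, up to linear combinations. Smoothness follows by one induction for all
  \<open>n\<close> together.\<close>

definition flat_exp :: "nat \<Rightarrow> real \<Rightarrow> real" where
  "flat_exp n x = (if x \<le> 0 then 0 else exp (- (1/x)) * (1/x) ^ n)"

lemma flat_exp_lim: "((\<lambda>x. exp (- (1/x)) * (1/x) ^ n) \<longlongrightarrow> (0::real)) (at_right 0)"
proof -
  have "((\<lambda>y::real. y ^ n / exp y) \<longlongrightarrow> 0) at_top"
    by (rule tendsto_power_div_exp_0)
  then have "((\<lambda>x::real. (inverse x) ^ n / exp (inverse x)) \<longlongrightarrow> 0) (at_right 0)"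
    by (rule filterlim_compose[OF _ filterlim_inverse_at_top_right])
  then show ?thesis
    by (simp add: exp_minus divide_simps field_simps)
qed

lemma flat_exp_has_derivative:
  "(flat_exp n has_real_derivative flat_exp (n + 2) x - real n * flat_exp (n + 1) x) (at x)"
proof -
  consider "x < 0" | "x > 0" | "x = 0" by linarith
  then show ?thesis
  proof cases
    case 1
    have "((\<lambda>x. 0) has_real_derivative 0) (at x)" by simp
    then have "(flat_exp n has_real_derivative 0) (at x)"
      by (rule has_field_derivative_transform_within_open[of _ _ _ "{..<0}"])
         (use 1 in \<open>auto simp: flat_exp_def\<close>)
    then show ?thesis using 1 by (simp add: flat_exp_def)
  next
    case 2
    have "((\<lambda>x. exp (- (1/x)) * (1/x) ^ n) has_real_derivative
        (exp (- (1/x)) * (1/x)^2 * (1/x)^n + exp (- (1/x)) * (real n * (1/x)^(n - 1) * (- ((1/x)^2))))) (at x)"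
      using 2 by (auto intro!: derivative_eq_intros simp: power2_eq_square)
    moreover have "exp (- (1/x)) * (1/x)^2 * (1/x)^n + exp (- (1/x)) * (real n * (1/x)^(n - 1) * (- ((1/x)^2)))
        = flat_exp (n + 2) x - real n * flat_exp (n + 1) x"
      using 2 by (cases n) (simp_all add: flat_exp_def power2_eq_square algebra_simps add_divide_distrib)
    ultimately have "((\<lambda>x. exp (- (1/x)) * (1/x) ^ n) has_real_derivative
        flat_exp (n + 2) x - real n * flat_exp (n + 1) x) (at x)"
      by (simp only:)
    then show ?thesis
      by (rule has_field_derivative_transform_within_open[of _ _ _ "{0<..}"])
         (use 2 in \<open>auto simp: flat_exp_def\<close>)
  next
    case 3
    have l: "((\<lambda>h. flat_exp n h / h) \<longlongrightarrow> 0) (at_left 0)"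
      by (rule tendsto_eventually) (auto simp: flat_exp_def eventually_at_filter)
    have r: "((\<lambda>h. flat_exp n h / h) \<longlongrightarrow> 0) (at_right 0)"
      by (rule Lim_transform_eventually[OF flat_exp_lim[of "Suc n"]])
         (auto simp: flat_exp_def eventually_at_filter)
    have "((\<lambda>h. flat_exp n h / h) \<longlongrightarrow> 0) (at 0)"
      using l r filterlim_at_split by blast
    then show ?thesis
      using 3 by (simp add: DERIV_def flat_exp_def)
  qed
qed

lemma ck_flat_exp: "ck k (flat_exp n)"
proof (induction k arbitrary: n)
  case 0 show ?case
    using flat_exp_has_derivative by (auto simp: ck_0 real_differentiable_def)
next
  case (Suc k)
  show ?case
  proof (rule ck_SucI)
    show "(flat_exp n has_derivative (\<lambda>v. (flat_exp (n + 2) x + (- real n) * flat_exp (n + 1) x) * v)) (at x)" for x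
      using flat_exp_has_derivative[of n x] by (simp add: has_field_derivative_def)
    show "ck k (\<lambda>x. (flat_exp (n + 2) x + (- real n) * flat_exp (n + 1) x) * v)" for v
      by (intro bounded_bilinear.ck_bilinear[OF bounded_bilinear_mult] ck_const ck_add Suc)
  qed
qed

definition smooth_step :: "real \<Rightarrow> real" where
  "smooth_step x = flat_exp 0 x / (flat_exp 0 x + flat_exp 0 (1 - x))"

lemma flat_exp_0_simps: "x \<le> 0 \<Longrightarrow> flat_exp 0 x = 0" "flat_exp 0 x \<ge> 0" "x > 0 \<Longrightarrow> flat_exp 0 x > 0"
  by (auto simp: flat_exp_def)

lemma smooth_step_denom: "flat_exp 0 x + flat_exp 0 (1 - x) > 0"
  using flat_exp_0_simps(2,3)[of x] flat_exp_0_simps(2,3)[of "1 - x"]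
  by (cases "x > 0") linarith+

lemma smooth_smooth_step: "smooth smooth_step"
proof -
  have f: "smooth (flat_exp 0)" by (simp add: smooth_iff_ck ck_flat_exp)
  show ?thesis
    unfolding smooth_step_def[abs_def]
    by (intro smooth_divide smooth_add f smooth_compose[OF f] smooth_diff smooth_const smooth_id)
      (use smooth_step_denom in \<open>simp add: less_imp_neq[symmetric]\<close>)
qed

lemma smooth_step_simps [simp]:
  "x \<le> 0 \<Longrightarrow> smooth_step x = 0" "x \<ge> 1 \<Longrightarrow> smooth_step x = 1"
  "0 \<le> smooth_step x" "smooth_step x \<le> 1"
  using smooth_step_denom[of x] flat_exp_0_simps(2)[of x] flat_exp_0_simps(2)[of "1-x"]
    less_imp_neq[OF flat_exp_0_simps(3)[OF less_le_trans[OF zero_less_one]], of x]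
  by (auto simp: smooth_step_def flat_exp_0_simps)

text \<open>Using the squared distance, which is quadratic in \<open>x\<close>, avoids the
  singularity of the norm at the centre.\<close>

definition bump :: "real \<Rightarrow> real \<Rightarrow> 'a::real_inner \<Rightarrow> 'a \<Rightarrow> real" where
  "bump a b p x = smooth_step ((b\<^sup>2 - (x - p) \<bullet> (x - p)) / (b\<^sup>2 - a\<^sup>2))"

lemma smooth_bump: "smooth (bump a b p)"
  unfolding bump_def[abs_def] divide_inverse
  by (intro smooth_compose[OF smooth_smooth_step] smooth_mult smooth_diff smooth_inner smooth_const smooth_id)

lemma bump_simps:
  assumes "0 \<le> a" "a < b"
  shows "norm (x - p) \<le> a \<Longrightarrow> bump a b p x = 1" "norm (x - p) \<ge> b \<Longrightarrow> bump a b p x = 0"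
    "0 \<le> bump a b p x" "bump a b p x \<le> 1"
proof -
  have ab: "a\<^sup>2 < b\<^sup>2" using assms by (simp add: power_strict_mono)
  show "bump a b p x = 1" if "norm (x - p) \<le> a"
  proof -
    have "(x - p) \<bullet> (x - p) \<le> a\<^sup>2"
      using that by (simp add: dot_square_norm power_mono)
    then show ?thesis unfolding bump_def using ab by (intro smooth_step_simps) (simp add: divide_simps)
  qed
  show "bump a b p x = 0" if "norm (x - p) \<ge> b"
  proof -
    have "(x - p) \<bullet> (x - p) \<ge> b\<^sup>2"
      using that assms by (simp add: dot_square_norm power_mono)
    then show ?thesis unfolding bump_def using ab by (intro smooth_step_simps) (simp add: divide_simps)
  qed
qed (auto simp: bump_def)

lemma telescoping_partition:
  fixes f :: "nat \<Rightarrow> real"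
  shows "(\<Sum>j<n. f j * (\<Prod>i<j. 1 - f i)) = 1 - (\<Prod>i<n. 1 - f i)"
  by (induction n) (auto simp: algebra_simps)

text \<open>With bumps \<open>f\<^sub>j\<close> the products \<open>f\<^sub>j * (\<Prod>i<j. 1 - f\<^sub>i)\<close> form a partition of unity without any
  division.\<close>

lemma compact_partition_of_unity:
  fixes D :: "'a::euclidean_space set"
  assumes "compact D" and \<rho>: "\<And>p. p \<in> D \<Longrightarrow> \<rho> p > 0"
  obtains P :: "'a set" and \<phi> :: "'a \<Rightarrow> 'a \<Rightarrow> real" and O' where
    "finite P" "P \<subseteq> D" "\<forall>p\<in>P. smooth (\<phi> p)"
    "\<forall>p\<in>P. \<forall>x. 0 \<le> \<phi> p x"
    "\<forall>p\<in>P. \<forall>x. dist p x \<ge> \<rho> p \<longrightarrow> \<phi> p x = 0"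
    "\<forall>x. (\<Sum>p\<in>P. \<phi> p x) \<le> 1"
    "open O'" "D \<subseteq> O'" "\<forall>x\<in>O'. (\<Sum>p\<in>P. \<phi> p x) = 1"
proof -
  have "D \<subseteq> (\<Union>p\<in>D. ball p (\<rho> p / 2))" using \<rho> by force
  then obtain P where P: "P \<subseteq> D" "finite P" "D \<subseteq> (\<Union>p\<in>P. ball p (\<rho> p / 2))"
    using compactE_image[OF \<open>compact D\<close>, of D "\<lambda>p. ball p (\<rho> p / 2)"] by auto
  \<comment> \<open>The weights below multiply over all earlier centres, so the finite set of
    centres must be enumerated.\<close>
  obtain g where g: "bij_betw g {..<card P} P"
    using ex_bij_betw_nat_finite[OF P(2)] by (auto simp: atLeast0LessThan)
  define q where "q = inv_into {..<card P} g"
  have q: "q p < card P" "g (q p) = p" if "p \<in> P" for p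
    using that inv_into_into[of p g "{..<card P}"] f_inv_into_f[of p g "{..<card P}"] bij_betw_imp_surj_on[OF g]
    unfolding q_def by auto
  have qg: "q (g i) = i" if "i < card P" for i
    using that g unfolding q_def by (simp add: bij_betw_def)
  have gP: "g i \<in> P" if "i < card P" for i using g that by (auto simp: bij_betw_def)
  define f where "f p = bump (\<rho> p / 2) (\<rho> p) p" for p :: 'a
  have \<rho>P: "0 \<le> \<rho> p / 2" "\<rho> p / 2 < \<rho> p" if "p \<in> P" for p using \<rho> that P(1) by force+
  have f01: "0 \<le> f p x" "f p x \<le> 1" if "p \<in> P" for p x
    unfolding f_def using bump_simps(3,4)[OF \<rho>P[OF that]] by auto
  define \<phi> where "\<phi> p x = f p x * (\<Prod>i<q p. 1 - f (g i) x)" for p x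
  have sum: "(\<Sum>p\<in>P. \<phi> p x) = 1 - (\<Prod>i<card P. 1 - f (g i) x)" for x
  proof -
    have "(\<Sum>p\<in>P. \<phi> p x) = (\<Sum>j<card P. \<phi> (g j) x)"
      using sum.reindex_bij_betw[OF g, of "\<lambda>p. \<phi> p x"] by simp
    also have "\<dots> = (\<Sum>j<card P. f (g j) x * (\<Prod>i<j. 1 - f (g i) x))"
      by (auto simp: \<phi>_def qg)
    finally show ?thesis by (simp add: telescoping_partition)
  qed
  show thesis
  proof (rule that[of P \<phi> "\<Union>p\<in>P. ball p (\<rho> p / 2)"]; (intro ballI allI impI)?)
    show "smooth (\<phi> p)" if "p \<in> P" for p
      unfolding \<phi>_def[abs_def] f_def
      by (intro smooth_mult smooth_prod smooth_diff smooth_const smooth_bump)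
    show "0 \<le> \<phi> p x" if "p \<in> P" for p x
    proof -
      have "0 \<le> 1 - f (g i) x" if "i < q p" for i
        using f01(2)[OF gP, of i x] that q(1)[OF \<open>p \<in> P\<close>] by simp
      then show ?thesis
        unfolding \<phi>_def using f01(1)[OF that] by (intro mult_nonneg_nonneg prod_nonneg) auto
    qed
    show "\<phi> p x = 0" if "p \<in> P" "dist p x \<ge> \<rho> p" for p x
      using bump_simps(2)[OF \<rho>P[OF that(1)], of x p] that(2) by (simp add: \<phi>_def f_def dist_norm norm_minus_commute)
    show "(\<Sum>p\<in>P. \<phi> p x) \<le> 1" for x
      unfolding sum using f01(2)[OF gP] by (auto intro!: prod_nonneg)
    show "(\<Sum>p\<in>P. \<phi> p x) = 1" if x: "x \<in> (\<Union>p\<in>P. ball p (\<rho> p / 2))" for x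
    proof -
      obtain p where p: "p \<in> P" "dist p x < \<rho> p / 2" using x by (auto simp: mem_ball)
      have "f p x = 1"
        unfolding f_def using p by (intro bump_simps(1)[OF \<rho>P]) (auto simp: dist_norm norm_minus_commute)
      then have "(\<Prod>i<card P. 1 - f (g i) x) = 0"
        using q[OF p(1)] by (intro prod_zero bexI[of _ "q p"]) auto
      then show ?thesis by (simp add: sum)
    qed
  qed (use P in auto)
qed

section \<open>Periodic profiles\<close>

lemma frechet_derivative_real:
  fixes U :: "real \<Rightarrow> real"
  assumes "smooth U" shows "(U has_real_derivative deriv U s) (at s)"
    and "frechet_derivative U (at s) v = v * deriv U s"
proof -
  have "U differentiable (at s)" using assms by (auto simp: smooth_iff_ck ck_differentiable)
  then show *: "(U has_real_derivative deriv U s) (at s)"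
    using real_differentiable_def DERIV_imp_deriv by metis
  show "frechet_derivative U (at s) v = v * deriv U s"
    using frechet_derivative_at[OF *[unfolded has_field_derivative_def]] by (metis mult.commute)
qed

lemma smooth_deriv:
  fixes U :: "real \<Rightarrow> real"
  shows "smooth U \<Longrightarrow> smooth (deriv U)"
  using smooth_derivative[of U 1] frechet_derivative_real(2)[of U _ 1] by simp

lemma smooth_deriv_iterate:
  fixes U :: "real \<Rightarrow> real"
  shows "smooth U \<Longrightarrow> smooth ((deriv ^^ q) U)"
  by (induction q) (auto intro: smooth_deriv)

text \<open>Beyond \<open>a\<close> the function is locally zero. An endpoint has the support on one
  side, and there continuity of the derivative gives the value. Keeping the closed condition lets
  the lemma be iterated with the same \<open>a\<close>.\<close>

lemma deriv_vanishes_outside: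
  fixes u :: "real \<Rightarrow> real"
  assumes "smooth u" "\<And>s. \<bar>s\<bar> \<ge> a \<Longrightarrow> u s = 0" "\<bar>s\<bar> \<ge> a"
  shows "deriv u s = 0"
proof -
  have "deriv u s = 0" if "\<bar>s\<bar> > a" for s
  proof -
    have o: "open {s::real. \<bar>s\<bar> > a}" by (intro open_Collect_less continuous_intros)
    have "((\<lambda>s. 0) has_real_derivative 0) (at s)" by simp
    then have "(u has_real_derivative 0) (at s)"
      by (rule has_field_derivative_transform_within_open[OF _ o]) (use that assms(2) in \<open>auto simp: less_imp_le\<close>)
    then show ?thesis by (rule DERIV_imp_deriv)
  qed
  moreover have "closed {s. deriv u s = 0}"
    using smooth_continuous[OF smooth_deriv[OF assms(1)], of UNIV]
    by (intro closed_Collect_eq continuous_intros) auto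
  moreover have "s \<in> closure {s. \<bar>s\<bar> > a}"
  proof (cases "\<bar>s\<bar> > a")
    case True then show ?thesis by (intro subsetD[OF closure_subset]) simp
  next
    case False
    then have s: "\<bar>s\<bar> = a" using assms(3) by simp
    show ?thesis
      unfolding closure_approachable
    proof (intro allI impI)
      fix e :: real assume e: "e > 0"
      define y where "y = (if s \<ge> 0 then s + e/2 else s - e/2)"
      have "\<bar>y\<bar> > \<bar>s\<bar>" "\<bar>y - s\<bar> < e"
        using e by (auto simp: y_def)
      then show "\<exists>y\<in>{s. \<bar>s\<bar> > a}. dist y s < e"
        using s unfolding dist_real_def by blast
    qed
  qed
  ultimately show ?thesis
    using closure_minimal[of "{s. \<bar>s\<bar> > a}" "{s. deriv u s = 0}"] by auto
qed

definition periodize :: "(real \<Rightarrow> real) \<Rightarrow> real \<Rightarrow> real" where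
  "periodize u s = u (s - of_int (round s))"

text \<open>Two neighbouring translates of the support are separated, so a single translate
  describes the periodic function up to distance \<open>1 - a\<close>. This exceeds 1/2, so every
  point, also one where \<open>round\<close> jumps, is interior to such an interval.\<close>

lemma periodize_local:
  assumes "\<And>s. \<bar>s\<bar> \<ge> a \<Longrightarrow> u s = 0" "a < 1/2" "\<bar>t - of_int k\<bar> < 1 - a"
  shows "periodize u t = u (t - of_int k)"
proof (cases "round t = k")
  case True then show ?thesis by (simp add: periodize_def)
next
  case False
  have r: "\<bar>of_int (round t) - t\<bar> \<le> 1/2" by (rule of_int_round_abs_le)
  have "\<bar>t - of_int k\<bar> \<ge> 1/2"
    using round_unique'[of t k] False by fastforce
  moreover have "\<bar>real_of_int (round t) - of_int k\<bar> \<ge> 1"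
    using False by linarith
  then have "\<bar>t - of_int (round t)\<bar> \<ge> a" using assms(3) by linarith
  ultimately show ?thesis using assms(1,2) by (simp add: periodize_def)
qed

lemma periodize_has_derivative:
  assumes "smooth u" "\<And>s. \<bar>s\<bar> \<ge> a \<Longrightarrow> u s = 0" "a < 1/2"
  shows "(periodize u has_real_derivative periodize (deriv u) s) (at s)"
proof -
  define k where "k = round s"
  have "open {t::real. \<bar>t - of_int k\<bar> < 1 - a}" by (intro open_Collect_less continuous_intros)
  moreover have "\<bar>s - of_int k\<bar> < 1 - a"
    using of_int_round_abs_le[of s] assms(3) unfolding k_def by linarith
  moreover have "((\<lambda>t. u (t - of_int k)) has_real_derivative deriv u (s - of_int k)) (at s)"
    by (rule DERIV_shift[THEN iffD1, of _ _ _ "- of_int k", simplified])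
      (use frechet_derivative_real(1)[OF assms(1)] in simp)
  ultimately show ?thesis
    unfolding periodize_def[of "deriv u"] k_def[symmetric]
    by (rule_tac has_field_derivative_transform_within_open[of "\<lambda>t. u (t - of_int k)" _ _ "{t. \<bar>t - of_int k\<bar> < 1 - a}"])
      (auto intro: periodize_local[OF assms(2,3), symmetric])
qed

lemma smooth_periodize:
  assumes "smooth u" "\<And>s. \<bar>s\<bar> \<ge> a \<Longrightarrow> u s = 0" "a < 1/2"
  shows "smooth (periodize u)"
proof -
  have "ck n (periodize u)" for n
    using assms(1,2)
  proof (induction n arbitrary: u)
    case 0
    then show ?case
      using periodize_has_derivative[OF 0 assms(3)] by (auto simp: ck_0 real_differentiable_def)
  next
    case (Suc n)
    have "ck n (\<lambda>s. periodize (deriv u) s * v)" for v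
      using Suc.IH[OF smooth_deriv[OF Suc.prems(1)] deriv_vanishes_outside[OF Suc.prems]]
      by (intro bounded_bilinear.ck_bilinear[OF bounded_bilinear_mult] ck_const)
    then show ?case
      using periodize_has_derivative[OF Suc.prems assms(3)]
      by (intro ck_SucI[where f' = "\<lambda>s v. periodize (deriv u) s * v"]) (auto simp: has_field_derivative_def)
  qed
  then show ?thesis by (simp add: smooth_iff_ck)
qed

lemma deriv_iterate_vanishes_outside:
  fixes u :: "real \<Rightarrow> real"
  assumes "smooth u" "\<And>s. \<bar>s\<bar> \<ge> a \<Longrightarrow> u s = 0"
  shows "\<bar>s\<bar> \<ge> a \<Longrightarrow> (deriv ^^ q) u s = 0"
proof (induction q arbitrary: s)
  case 0 then show ?case using assms(2) by simp
next
  case (Suc q)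
  show ?case
    using deriv_vanishes_outside[OF smooth_deriv_iterate[OF assms(1)] Suc.IH Suc.prems] by simp
qed

lemma deriv_iterate_periodize:
  assumes "smooth u" "\<And>s. \<bar>s\<bar> \<ge> a \<Longrightarrow> u s = 0" "a < 1/2"
  shows "(deriv ^^ q) (periodize u) = periodize ((deriv ^^ q) u)"
proof (induction q)
  case (Suc q)
  then show ?case
    using periodize_has_derivative[OF smooth_deriv_iterate[OF assms(1), of q]
        deriv_iterate_vanishes_outside[OF assms(1,2)] assms(3)]
    by (auto intro!: DERIV_imp_deriv)
qed auto

lemma bounded_if_vanishes_outside:
  fixes u :: "real \<Rightarrow> real"
  assumes "smooth u" "\<And>s. \<bar>s\<bar> \<ge> a \<Longrightarrow> u s = 0"
  obtains B where "\<And>s. \<bar>u s\<bar> \<le> B"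
proof -
  have "compact (u ` {-a..a})"
    by (intro compact_continuous_image smooth_continuous assms) auto
  then obtain B where B: "\<forall>y\<in>u ` {-a..a}. norm y \<le> B"
    using compact_imp_bounded bounded_iff by blast
  then have "\<bar>u s\<bar> \<le> max 0 B" for s
  proof (cases "\<bar>s\<bar> \<ge> a")
    case True then show ?thesis using assms(2) by simp
  next
    case False
    then have "s \<in> {-a..a}" by auto
    then have "norm (u s) \<le> B" using B by blast
    then show ?thesis by simp
  qed
  then show ?thesis using that by blast
qed

lemma deriv_iterate_shift:
  fixes U :: "real \<Rightarrow> real"
  assumes "smooth U"
  shows "(deriv ^^ q) (\<lambda>s. U (s - c)) = (\<lambda>s. (deriv ^^ q) U (s - c))"
proof (induction q)
  case (Suc q)
  have "((\<lambda>t. (deriv ^^ q) U (t - c)) has_real_derivative deriv ((deriv ^^ q) U) (s - c)) (at s)" for s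
    by (rule DERIV_shift[THEN iffD1, of _ _ _ "- c", simplified])
      (use frechet_derivative_real(1)[OF smooth_deriv_iterate[OF assms]] in simp)
  then show ?case using Suc by (auto intro: DERIV_imp_deriv)
qed auto

section \<open>The saw-shaped profiles and the wiggle between two heights\<close>

text \<open>The monomial has r-th derivative one. It is cut off before 1/2, so that it can be
  periodized, and kept intact up to 7/20, which is more than 1/4, so that the good intervals of the
  periodization and of its half-period shift overlap.\<close>

definition monomial_bump :: "nat \<Rightarrow> real \<Rightarrow> real" where
  "monomial_bump r s = s ^ r / fact r * bump (7/20) (9/20) 0 s"

lemma smooth_monomial_bump: "smooth (monomial_bump r)"
  unfolding monomial_bump_def[abs_def] divide_inverse
  by (intro smooth_mult smooth_power smooth_id smooth_const smooth_bump)

lemma monomial_bump_outside: "\<bar>s\<bar> \<ge> 9/20 \<Longrightarrow> monomial_bump r s = 0"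
  by (simp add: monomial_bump_def bump_simps(2))

lemma deriv_monomial_bump:
  assumes "\<bar>s\<bar> < 7/20" "q \<le> r"
  shows "(deriv ^^ q) (monomial_bump r) s = s ^ (r - q) / fact (r - q)"
  using assms
proof (induction q arbitrary: s)
  case 0 then show ?case by (simp add: monomial_bump_def bump_simps(1))
next
  case (Suc q)
  obtain p where p: "r - q = Suc p" "r - Suc q = p" using Suc.prems by (metis Suc_diff_Suc Suc_le_lessD)
  have o: "open {s::real. \<bar>s\<bar> < 7/20}" by (intro open_Collect_less continuous_intros)
  have "((\<lambda>s. s ^ Suc p / fact (Suc p)) has_real_derivative s ^ p / fact p) (at s)"
  proof -
    have "((\<lambda>s. s ^ Suc p / fact (Suc p)) has_real_derivative (real (Suc p) * s ^ p) / fact (Suc p)) (at s)"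
      using DERIV_pow[of "Suc p" s] by (intro DERIV_cdivide) simp
    then show ?thesis by (simp add: divide_simps)
  qed
  then have "((deriv ^^ q) (monomial_bump r) has_real_derivative s ^ p / fact p) (at s)"
    by (rule has_field_derivative_transform_within_open[OF _ o]) (use Suc p in auto)
  then show ?case using p by (auto intro: DERIV_imp_deriv)
qed

definition saw :: "nat \<Rightarrow> real \<Rightarrow> real" where
  "saw r = periodize (monomial_bump r)"

text \<open>With d the distance to the nearest integer, the saw is good for d < 7/20 and its
  half-period shift for d > 3/20. The transition here takes place for d between 1/5 and 3/10, inside
  that overlap.\<close>

definition wiggle :: "real \<Rightarrow> real" where
  "wiggle s = 1 - periodize (bump (1/5) (3/10) 0) s"

lemma smooth_saw: "smooth (saw r)"
  unfolding saw_def by (rule smooth_periodize[OF smooth_monomial_bump, where a = "9/20"]) (auto intro: monomial_bump_outside)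

lemma deriv_saw_eq: "(deriv ^^ q) (saw r) = periodize ((deriv ^^ q) (monomial_bump r))"
  unfolding saw_def
  by (rule deriv_iterate_periodize[OF smooth_monomial_bump, where a = "9/20"]) (auto intro: monomial_bump_outside)

lemma monomial_bump_bounded: "\<exists>B. \<forall>s. \<bar>(deriv ^^ q) (monomial_bump r) s\<bar> \<le> B"
proof (rule bounded_if_vanishes_outside[OF smooth_deriv_iterate[OF smooth_monomial_bump, of q r]])
  show "(deriv ^^ q) (monomial_bump r) s = 0" if "\<bar>s\<bar> \<ge> 9/20" for s
    by (rule deriv_iterate_vanishes_outside[OF smooth_monomial_bump monomial_bump_outside that])
qed blast

lemma saw_bounded: "\<exists>B. \<forall>s. \<bar>(deriv ^^ q) (saw r) s\<bar> \<le> B"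
  using monomial_bump_bounded[of q r] by (auto simp: deriv_saw_eq periodize_def)

lemma deriv_saw:
  assumes "\<bar>s - of_int k\<bar> < 7/20" shows "(deriv ^^ r) (saw r) s = 1"
proof -
  have "round s = k" using assms by (intro round_unique') simp
  then show ?thesis
    using deriv_monomial_bump[of "s - of_int k" r r] assms by (simp add: deriv_saw_eq periodize_def)
qed

lemma bump_wiggle_outside: "\<bar>s\<bar> \<ge> 3/10 \<Longrightarrow> bump (1/5) (3/10) 0 (s::real) = 0"
  by (simp add: bump_simps(2))

lemma smooth_wiggle: "smooth wiggle"
  unfolding wiggle_def[abs_def]
  by (intro smooth_diff smooth_const smooth_periodize[OF smooth_bump, where a = "3/10"])
    (auto intro: bump_wiggle_outside)

lemma wiggle_bounds: "0 \<le> wiggle s" "wiggle s \<le> 1"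
  by (auto simp: wiggle_def periodize_def bump_simps)

lemma wiggle_lipschitz: obtains L where "L \<ge> 0" "\<And>s t. \<bar>wiggle s - wiggle t\<bar> \<le> L * \<bar>s - t\<bar>"
proof -
  let ?u = "bump (1/5) (3/10) (0::real)"
  obtain B where B: "\<And>s. \<bar>deriv ?u s\<bar> \<le> B"
    using bounded_if_vanishes_outside[OF smooth_deriv[OF smooth_bump, of "1/5" "3/10" 0], where a = "3/10"]
      deriv_vanishes_outside[OF smooth_bump, where a = "3/10", OF bump_wiggle_outside] by blast
  have d: "(wiggle has_real_derivative - periodize (deriv ?u) s) (at s)" for s
    unfolding wiggle_def[abs_def]
    using DERIV_diff[OF DERIV_const periodize_has_derivative[OF smooth_bump, where a = "3/10"], OF bump_wiggle_outside]
    by simp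
  have "norm (wiggle s - wiggle t) \<le> B * norm (s - t)" for s t
    by (rule field_differentiable_bound[of UNIV wiggle "\<lambda>s. - periodize (deriv ?u) s"])
      (use d B in \<open>auto simp: periodize_def\<close>)
  moreover have "B \<ge> 0" using B[of 0] by linarith
  ultimately show ?thesis using that by auto
qed

text \<open>The two saws have \<open>r\<close>-th derivative one on overlapping families of intervals, and \<open>wiggle\<close>
  moves from one level to the other only where both are good.\<close>

lemma wiggle_cases:
  obtains "wiggle s = 0" "(deriv ^^ r) (saw r) s = 1"
  | "wiggle s = 1" "(deriv ^^ r) (saw r) (s - 1/2) = 1"
  | "(deriv ^^ r) (saw r) s = 1" "(deriv ^^ r) (saw r) (s - 1/2) = 1"
proof -
  define d where "d = s - of_int (round s)"
  have d: "\<bar>d\<bar> \<le> 1/2" using of_int_round_abs_le[of s] by (simp add: d_def abs_minus_commute)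
  have 1: "(deriv ^^ r) (saw r) s = 1" if "\<bar>d\<bar> < 7/20"
    using that by (intro deriv_saw) (simp add: d_def)
  have 2: "(deriv ^^ r) (saw r) (s - 1/2) = 1" if "\<bar>d\<bar> > 3/20"
  proof (cases "d > 0")
    case True then show ?thesis
      using that d by (intro deriv_saw[of _ "round s"]) (auto simp: d_def abs_if split: if_splits)
  next
    case False then show ?thesis
      using that d by (intro deriv_saw[of _ "round s - 1"]) (auto simp: d_def abs_if split: if_splits)
  qed
  have w: "wiggle s = 1 - bump (1/5) (3/10) 0 d" by (simp add: wiggle_def periodize_def d_def)
  consider "\<bar>d\<bar> \<le> 1/5" | "\<bar>d\<bar> \<ge> 3/10" | "\<bar>d\<bar> < 7/20" "\<bar>d\<bar> > 3/20" by linarith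
  then show ?thesis
    by cases (use 1 2 w that in \<open>auto simp: bump_simps\<close>)
qed

section \<open>Diffeomorphisms\<close>

lemma smooth_det:
  fixes A :: "'a::real_normed_vector \<Rightarrow> real^'n^'n"
  assumes "\<And>i j. smooth (\<lambda>x. A x $ i $ j)"
  shows "smooth (\<lambda>x. det (A x))"
  unfolding det_def by (intro smooth_sum smooth_mult smooth_const smooth_prod assms)

text \<open>The bound with \<open>C\<close> does double duty: it excludes a kernel of the derivative
  and makes \<open>g\<close> Lipschitz. The derivative of \<open>g\<close> at \<open>y\<close> is
  then the inverse matrix at \<open>g y\<close>, by Cramer's rule a smooth function of
  \<open>g y\<close>, so each level of differentiability of \<open>g\<close> yields the
  next.\<close>

lemma smooth_inverse_map:
  fixes f :: "real^'m \<Rightarrow> real^'m"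
  assumes f: "smooth f" and fg: "\<And>y. f (g y) = y" and gf: "\<And>x. g (f x) = x"
    and C: "\<And>x y. dist x y \<le> C * dist (f x) (f y)"
  shows "smooth g"
proof -
  define f' where "f' x = frechet_derivative f (at x)" for x
  have f': "(f has_derivative f' x) (at x)" for x
    using smooth_has_derivative[OF f] by (simp add: f'_def)
  have lin: "linear (f' x)" for x using f' has_derivative_linear by blast
  have C1: "dist x y \<le> (\<bar>C\<bar> + 1) * dist (f x) (f y)" for x y
    using C[of x y] by (meson abs_ge_self add_increasing2 dual_order.trans mult_right_mono zero_le_dist zero_le_one)
  have inj: "v = 0" if "f' x v = 0" for x v
  proof (rule ccontr)
    assume "v \<noteq> 0"
    \<comment> \<open>A step of length \<open>d / 2\<close> along the kernel vector changes
      \<open>f\<close> by at most \<open>d / (4 * (\<bar>C\<bar> + 1))\<close>, while the bound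
      demands twice as much.\<close>
    define \<epsilon> where "\<epsilon> = 1 / (2 * (\<bar>C\<bar> + 1))"
    have \<epsilon>: "\<epsilon> > 0" by (simp add: \<epsilon>_def)
    obtain d where d: "d > 0" "\<And>y. norm (y - x) < d \<Longrightarrow> norm (f y - f x - f' x (y - x)) \<le> \<epsilon> * norm (y - x)"
      using f'[of x] \<epsilon> unfolding has_derivative_at_alt by blast
    define y where "y = x + (d / (2 * norm v)) *\<^sub>R v"
    have yx: "norm (y - x) = d / 2" using \<open>v \<noteq> 0\<close> d(1) by (simp add: y_def)
    have "f' x (y - x) = 0" using that by (simp add: y_def linear_cmul[OF lin])
    then have "norm (f y - f x) \<le> \<epsilon> * (d/2)" using d yx by (metis diff_zero half_gt_zero_iff field_sum_of_halves less_add_same_cancel1)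
    moreover have "d / 2 \<le> (\<bar>C\<bar> + 1) * norm (f y - f x)"
      using C1[of y x] yx by (simp add: dist_norm)
    ultimately have "d / 2 \<le> (\<bar>C\<bar> + 1) * (\<epsilon> * (d/2))"
      by (meson abs_ge_zero add_nonneg_nonneg mult_left_mono order_trans zero_le_one)
    also have "\<dots> = d / 4"
    proof -
      have "(\<bar>C\<bar> + 1) * \<epsilon> = 1/2"
        unfolding \<epsilon>_def using abs_ge_zero[of C] by (simp add: field_simps)
      then show ?thesis by (simp only: mult.assoc[symmetric])
    qed
    finally show False using d(1) by simp
  qed
  define M where "M x = matrix (f' x)" for x
  have Mv: "M x *v v = f' x v" for x v
    unfolding M_def by (simp add: matrix_works lin)
  have det: "det (M x) \<noteq> 0" for x
    using inj Mv invertible_det_nz matrix_left_invertible_ker invertible_left_inverse by metis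
  have sM: "smooth (\<lambda>x. M x $ i $ j)" for i j
    unfolding M_def matrix_def f'_def by (simp, intro smooth_component smooth_derivative f)
  \<comment> \<open>Cramer's solution of \<open>f' x w = v\<close>. Written with determinants it is
    visibly smooth in \<open>x\<close>.\<close>
  define S where "S v x = (\<chi> k. det (\<chi> i j. if j = k then v $ i else M x $ i $ j) / det (M x))" for v x
  have sS: "smooth (S v)" for v
  proof -
    have "smooth (\<lambda>x. (\<chi> i j. if j = k then v $ i else M x $ i $ j) $ i $ j)" for i j k
      using sM by (cases "j = k") (auto intro: smooth_const)
    then show ?thesis
      unfolding S_def[abs_def] by (intro smooth_vec_lambda smooth_divide smooth_det det sM)
  qed
  have S: "f' x w = v \<longleftrightarrow> w = S v x" for x v w
    using cramer[OF det, of x w v] by (simp add: Mv S_def)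
  have SF: "S (f' x w) x = w" for x w using S[of x w "f' x w"] by simp
  have linS: "linear (\<lambda>v. S v x)" for x
  proof (rule linearI)
    show "S (a + b) x = S a x + S b x" for a b
      using S linear_add[OF lin] by metis
    show "S (c *\<^sub>R b) x = c *\<^sub>R S b x" for c b
      using S linear_cmul[OF lin] by metis
  qed
  have gl: "dist (g y) (g z) \<le> (\<bar>C\<bar> + 1) * dist y z" for y z
    using C1[of "g y" "g z"] by (simp add: fg)
  have gc: "continuous (at y) g" for y
  proof -
    have "(\<bar>C\<bar> + 1)-lipschitz_on UNIV g" by (rule lipschitz_onI) (use gl in auto)
    then show ?thesis using lipschitz_on_continuous_on continuous_on_eq_continuous_at open_UNIV by blast
  qed
  have g': "(g has_derivative (\<lambda>v. S v (g y))) (at y)" for y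
    by (rule has_derivative_inverse_basic[OF f' _ _ gc open_UNIV])
      (use linS SF fg in \<open>auto simp: linear_linear fun_eq_iff\<close>)
  have "ck n g" for n
  proof (induction n)
    case 0 then show ?case using g' by (auto simp: ck_0 differentiable_def)
  next
    case (Suc n)
    show ?case
      by (rule ck_SucI[OF g']) (intro ck_compose[OF smooth_ck[OF sS] Suc])
  qed
  then show ?thesis by (simp add: smooth_iff_ck)
qed

text \<open>Since \<open>g\<close> does not change under the displacement \<open>k\<close>, solving \<open>x - g x *\<^sub>R k x = y\<close> amounts to finding
  the fixed point of the contraction \<open>\<lambda>x. y + g y *\<^sub>R k x\<close>.\<close>

lemma fibred_diffeo:
  fixes g :: "'a::euclidean_space \<Rightarrow> real" and k :: "'a \<Rightarrow> 'a"
  assumes inv: "\<And>x y s. g (x + s *\<^sub>R k y) = g x"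
    and G: "\<And>x. \<bar>g x\<bar> \<le> G" and \<kappa>: "\<And>x y. dist (k x) (k y) \<le> \<kappa> * dist x y" and G\<kappa>: "G * \<kappa> \<le> 1/2"
    and K: "\<And>x. norm (k x) \<le> K" and L: "\<And>x y. \<bar>g x - g y\<bar> \<le> L * dist x y"
  shows "bij (\<lambda>x. x - g x *\<^sub>R k x)"
    and "dist x y \<le> 2 * (1 + L * K) * dist (x - g x *\<^sub>R k x) (y - g y *\<^sub>R k y)"
proof -
  let ?f = "\<lambda>x. x - g x *\<^sub>R k x"
  have gf: "g (?f x) = g x" for x using inv[of x "- g x" x] by simp
  have half: "dist (g z *\<^sub>R k x) (g z *\<^sub>R k y) \<le> 1/2 * dist x y" for x y z
  proof -
    have "dist (g z *\<^sub>R k x) (g z *\<^sub>R k y) = \<bar>g z\<bar> * dist (k x) (k y)"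
      by (simp add: dist_norm flip: scaleR_diff_right)
    also have "\<dots> \<le> G * (\<kappa> * dist x y)"
      using G[of z] \<kappa>[of x y] by (intro mult_mono) auto
    also have "\<dots> \<le> 1/2 * dist x y"
      using mult_right_mono[OF G\<kappa>, of "dist x y"] by (simp add: mult.assoc)
    finally show ?thesis .
  qed
  have K0: "K \<ge> 0" using K[of undefined] norm_ge_zero order_trans by blast
  have est: "dist x y \<le> 2 * (1 + L * K) * dist (?f x) (?f y)" for x y
  proof -
    \<comment> \<open>Since \<open>g\<close> takes the same value at \<open>x\<close> and
      \<open>?f x\<close>, the middle term is controlled by the distance of the images. The last
      term is at most half of \<open>dist x y\<close> and is absorbed on the left, whence the factor
      2.\<close>
    have "x - y = (?f x - ?f y) + (g (?f x) - g (?f y)) *\<^sub>R k x + (g y *\<^sub>R k x - g y *\<^sub>R k y)"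
      by (simp only: gf) (simp add: algebra_simps)
    then have "dist x y \<le> norm (?f x - ?f y) + norm ((g (?f x) - g (?f y)) *\<^sub>R k x) + norm (g y *\<^sub>R k x - g y *\<^sub>R k y)"
      by (simp only: dist_norm) (intro norm_triangle_mono order_refl)
    then have "dist x y \<le> dist (?f x) (?f y) + \<bar>g (?f x) - g (?f y)\<bar> * norm (k x) + dist (g y *\<^sub>R k x) (g y *\<^sub>R k y)"
      by (simp only: dist_norm norm_scaleR)
    also have "\<dots> \<le> dist (?f x) (?f y) + (L * dist (?f x) (?f y)) * K + 1/2 * dist x y"
      using half[of y x y] L[of "?f x" "?f y"] K[of x] K0
      by (intro add_mono mult_mono) auto
    finally show ?thesis by (simp add: algebra_simps)
  qed
  then show "dist x y \<le> 2 * (1 + L * K) * dist (?f x) (?f y)" .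
  have "inj ?f"
  proof (rule injI)
    fix x y assume "?f x = ?f y"
    then show "x = y" using est[of x y] by simp
  qed
  moreover have "surj ?f"
  proof (rule surjI)
    fix y
    have "\<exists>!x. x \<in> UNIV \<and> y + g y *\<^sub>R k x = x"
      by (rule Banach_fix[of UNIV "1/2"]) (use half in \<open>auto simp: complete_UNIV\<close>)
    then have e: "\<exists>x. y + g y *\<^sub>R k x = x" by blast
    define x where "x = (SOME x. y + g y *\<^sub>R k x = x)"
    have x: "y + g y *\<^sub>R k x = x" using someI_ex[OF e] by (simp add: x_def)
    have "g x = g y" using inv[of y "g y" x] x by simp
    then show "?f (SOME x. y + g y *\<^sub>R k x = x) = y" using x by (simp add: x_def[symmetric] algebra_simps)
  qed
  ultimately show "bij ?f" by (simp add: bij_def)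
qed

lemma compact_support_lipschitz:
  fixes f :: "'a::euclidean_space \<Rightarrow> 'b::real_normed_vector"
  assumes f: "smooth f" and S: "compact S" and z: "\<And>x. x \<notin> S \<Longrightarrow> f x = 0"
  obtains L where "L \<ge> 0" "\<And>x y. dist (f x) (f y) \<le> L * dist x y"
proof -
  let ?D = "\<lambda>x. frechet_derivative f (at x)"
  have D0: "?D x v = 0" if "x \<notin> S" for x v
  proof -
    have "(f has_derivative (\<lambda>h. 0)) (at x)"
      by (rule has_derivative_transform_within_open[of "\<lambda>_. 0" _ _ UNIV "- S"])
        (use that z S in \<open>auto intro: compact_imp_closed open_Compl\<close>)
    then show ?thesis using frechet_derivative_at by metis
  qed
  have "\<exists>B. \<forall>x\<in>S. norm (?D x b) \<le> B" for b
  proof -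
    have "compact ((\<lambda>x. ?D x b) ` S)"
      by (intro compact_continuous_image smooth_continuous smooth_derivative f S)
    then obtain B where "\<forall>y\<in>(\<lambda>x. ?D x b) ` S. norm y \<le> B"
      using compact_imp_bounded bounded_iff by blast
    then show ?thesis by blast
  qed
  then obtain B where B: "\<And>x b. x \<in> S \<Longrightarrow> norm (?D x b) \<le> B b" by metis
  define L where "L = (\<Sum>b\<in>Basis. max 0 (B b))"
  have Dv: "norm (?D x v) \<le> L * norm v" for x v
  proof -
    have lin: "linear (?D x)" using smooth_has_derivative[OF f] has_derivative_linear by blast
    have "?D x v = ?D x (\<Sum>b\<in>Basis. (v \<bullet> b) *\<^sub>R b)" by (simp add: euclidean_representation)
    also have "\<dots> = (\<Sum>b\<in>Basis. (v \<bullet> b) *\<^sub>R ?D x b)" using lin by (simp add: linear_sum linear_cmul)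
    also have "norm \<dots> \<le> (\<Sum>b\<in>Basis. max 0 (B b) * norm v)"
    proof (rule sum_norm_le)
      fix b :: 'a assume b: "b \<in> Basis"
      have "norm (?D x b) \<le> max 0 (B b)" using B[of x b] D0[of x b] by (cases "x \<in> S") auto
      moreover have "\<bar>v \<bullet> b\<bar> \<le> norm v" using b by (rule Basis_le_norm)
      ultimately have "norm (?D x b) * \<bar>v \<bullet> b\<bar> \<le> max 0 (B b) * norm v" by (intro mult_mono) auto
      then show "norm ((v \<bullet> b) *\<^sub>R ?D x b) \<le> max 0 (B b) * norm v" by (simp add: mult.commute)
    qed
    finally show ?thesis by (simp add: L_def sum_distrib_right)
  qed
  have "norm (f x - f y) \<le> L * norm (x - y)" for x y
    by (rule differentiable_bound[of UNIV f ?D])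
      (use smooth_has_derivative[OF f] Dv in \<open>auto intro: onorm_le\<close>)
  moreover have "L \<ge> 0" by (auto simp: L_def intro: sum_nonneg)
  ultimately show ?thesis using that by (auto simp: dist_norm)
qed

section \<open>Oscillating functions\<close>

lemma smooth_phase:
  fixes U :: "real \<Rightarrow> real" and \<theta> :: "'a::real_normed_vector \<Rightarrow> real"
  assumes "smooth U" "smooth \<theta>"
  shows "smooth (\<lambda>x. U (\<theta> x / P))"
proof -
  have "smooth (\<lambda>x. \<theta> x * inverse P)" by (intro smooth_mult smooth_const assms)
  then show ?thesis
    using smooth_compose[OF assms(1), of "\<lambda>x. \<theta> x / P"] by (simp add: divide_inverse)
qed

text \<open>Each derivative falls either on the coefficient or on \<open>U\<close>, and only the
  latter costs a factor \<open>1/P\<close>. What matters is that the \<open>D q\<close> are chosen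
  before \<open>P\<close> and keep the support in \<open>S\<close>: one bound for them then serves
  all periods. The top one has all derivatives on \<open>U\<close>, which leaves the product of the
  derivatives of the phase.\<close>

lemma oscillation_expansion:
  fixes U :: "real \<Rightarrow> real" and \<theta> :: "'a::real_normed_vector \<Rightarrow> real" and C :: "'a \<Rightarrow> 'b::real_normed_vector"
  assumes U: "smooth U" and \<theta>: "smooth \<theta>" and C: "smooth C"
    and S: "closed S" "\<And>x. x \<notin> S \<Longrightarrow> C x = 0"
  shows "\<exists>D. (\<forall>q. smooth (D q)) \<and> (\<forall>q x. x \<notin> S \<longrightarrow> D q x = 0)
    \<and> (\<forall>x. D (length vs) x = (\<Prod>v\<leftarrow>vs. frechet_derivative \<theta> (at x) v) *\<^sub>R C x)
    \<and> (\<forall>P>0. \<forall>x. pdl vs (\<lambda>x. P ^ r *\<^sub>R (U (\<theta> x / P) *\<^sub>R C x)) x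
        = (\<Sum>q\<le>length vs. (P ^ r * (1/P) ^ q * (deriv ^^ q) U (\<theta> x / P)) *\<^sub>R D q x))"
proof (induction vs)
  case Nil
  show ?case
    by (rule exI[of _ "\<lambda>q. C"]) (use C S in auto)
next
  case (Cons v vs)
  let ?l = "length vs"
  let ?\<theta>' = "\<lambda>x. frechet_derivative \<theta> (at x) v"
  obtain D where D: "\<And>q. smooth (D q)" "\<And>q x. x \<notin> S \<Longrightarrow> D q x = 0"
    "\<And>x. D ?l x = (\<Prod>v\<leftarrow>vs. frechet_derivative \<theta> (at x) v) *\<^sub>R C x"
    "\<And>P x. P > 0 \<Longrightarrow> pdl vs (\<lambda>x. P ^ r *\<^sub>R (U (\<theta> x / P) *\<^sub>R C x)) x
        = (\<Sum>q\<le>?l. (P ^ r * (1/P) ^ q * (deriv ^^ q) U (\<theta> x / P)) *\<^sub>R D q x)"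
    using Cons.IH by blast
  let ?D' = "\<lambda>q x. frechet_derivative (D q) (at x) v"
  \<comment> \<open>The term at \<open>q\<close> comes from differentiating the old coefficient at
    \<open>q\<close>, or from differentiating \<open>U\<close> in the old term at
    \<open>q - 1\<close>.\<close>
  define E where "E q x = (if q \<le> ?l then ?D' q x else 0) + (if q = 0 then 0 else ?\<theta>' x *\<^sub>R D (q - 1) x)" for q x
  have "smooth (E q)" for q
    unfolding E_def
    by (cases "q \<le> ?l"; cases "q = 0"; simp; intro smooth_add smooth_scaleR smooth_derivative smooth_const D \<theta>)
  moreover have "E q x = 0" if "x \<notin> S" for q x
  proof -
    have "(D q has_derivative (\<lambda>h. 0)) (at x)" for q
      by (rule has_derivative_transform_within_open[of "\<lambda>_. 0" _ _ UNIV "- S"])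
        (use that D(2) S(1) in \<open>auto intro: open_Compl\<close>)
    then have "?D' q x = 0" for q using frechet_derivative_at by metis
    then show ?thesis using D(2) that by (simp add: E_def)
  qed
  moreover have "E (length (v # vs)) x = (\<Prod>v\<leftarrow>v # vs. frechet_derivative \<theta> (at x) v) *\<^sub>R C x" for x
    by (simp add: E_def D(3))
  moreover have "pdl (v # vs) (\<lambda>x. P ^ r *\<^sub>R (U (\<theta> x / P) *\<^sub>R C x)) x
      = (\<Sum>q\<le>length (v # vs). (P ^ r * (1/P) ^ q * (deriv ^^ q) U (\<theta> x / P)) *\<^sub>R E q x)"
    if P: "P > 0" for P x
  proof -
    define a where "a q x = P ^ r * (1/P) ^ q * (deriv ^^ q) U (\<theta> x / P)" for q x
    have Uq: "((\<lambda>x. (deriv ^^ q) U (\<theta> x / P)) has_derivative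
        (\<lambda>w. frechet_derivative \<theta> (at x) w / P * (deriv ^^ Suc q) U (\<theta> x / P))) (at x)" for q
    proof -
      have "((\<lambda>x. \<theta> x / P) has_derivative (\<lambda>w. frechet_derivative \<theta> (at x) w / P)) (at x)"
        using P by (auto intro!: derivative_eq_intros smooth_has_derivative[OF \<theta>])
      from has_derivative_compose[OF this smooth_has_derivative[OF smooth_deriv_iterate[OF U, of q]]]
      show ?thesis by (simp add: frechet_derivative_real(2)[OF smooth_deriv_iterate[OF U]])
    qed
    have pe: "pdl vs (\<lambda>x. P ^ r *\<^sub>R (U (\<theta> x / P) *\<^sub>R C x)) = (\<lambda>x. \<Sum>q\<le>?l. a q x *\<^sub>R D q x)"
      unfolding a_def by (rule ext) (rule D(4)[OF P])
    have "((\<lambda>x. \<Sum>q\<le>?l. a q x *\<^sub>R D q x) has_derivative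
       (\<lambda>w. \<Sum>q\<le>?l. a q x *\<^sub>R frechet_derivative (D q) (at x) w
          + (P ^ r * (1/P) ^ q * (frechet_derivative \<theta> (at x) w / P * (deriv ^^ Suc q) U (\<theta> x / P))) *\<^sub>R D q x)) (at x)"
      unfolding a_def
      by (intro has_derivative_sum has_derivative_scaleR has_derivative_mult_right smooth_has_derivative D(1) Uq)
    from frechet_derivative_at[OF this, symmetric]
    have "pdl (v # vs) (\<lambda>x. P ^ r *\<^sub>R (U (\<theta> x / P) *\<^sub>R C x)) x
      = (\<Sum>q\<le>?l. a q x *\<^sub>R ?D' q x + (P ^ r * (1/P) ^ q * (?\<theta>' x / P * (deriv ^^ Suc q) U (\<theta> x / P))) *\<^sub>R D q x)"
      by (simp only: pdl.simps pe)
    also have "\<dots> = (\<Sum>q\<le>?l. a q x *\<^sub>R ?D' q x + a (Suc q) x *\<^sub>R (?\<theta>' x *\<^sub>R D q x))"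
      by (intro sum.cong refl) (simp add: a_def field_simps)
    also have "\<dots> = (\<Sum>q\<le>Suc ?l. a q x *\<^sub>R (if q \<le> ?l then ?D' q x else 0))
        + (\<Sum>q\<le>Suc ?l. a q x *\<^sub>R (if q = 0 then 0 else ?\<theta>' x *\<^sub>R D (q - 1) x))"
    proof -
      have "(\<Sum>q\<le>Suc ?l. a q x *\<^sub>R (if q = 0 then 0 else ?\<theta>' x *\<^sub>R D (q - 1) x))
        = (\<Sum>q\<le>?l. a (Suc q) x *\<^sub>R (?\<theta>' x *\<^sub>R D q x))"
        by (subst sum.atMost_Suc_shift) simp
      moreover have "(\<Sum>q\<le>Suc ?l. a q x *\<^sub>R (if q \<le> ?l then ?D' q x else 0)) = (\<Sum>q\<le>?l. a q x *\<^sub>R ?D' q x)"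
        by simp
      ultimately show ?thesis by (simp only: sum.distrib)
    qed
    also have "\<dots> = (\<Sum>q\<le>Suc ?l. a q x *\<^sub>R E q x)"
      by (simp add: E_def scaleR_add_right sum.distrib del: sum.atMost_Suc)
    finally show ?thesis by (simp add: a_def)
  qed
  ultimately show ?case by blast
qed

text \<open>In the expansion the q-th term carries \<open>P ^ (r - q)\<close>. All terms with
  \<open>q < r\<close> tend to zero uniformly, and \<open>q = r\<close> occurs only for derivatives
  of order exactly \<open>r\<close>. Finitely many directions give finitely many lists, so one
  \<open>P\<close> serves all.\<close>

lemma oscillation_small:
  fixes U :: "real \<Rightarrow> real" and \<theta> :: "'a::real_normed_vector \<Rightarrow> real" and C :: "'a \<Rightarrow> 'b::real_normed_vector"
  assumes U: "smooth U" and \<theta>: "smooth \<theta>" and C: "smooth C"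
    and S: "compact S" "\<And>x. x \<notin> S \<Longrightarrow> C x = 0"
    and bd: "\<And>q. \<exists>B. \<forall>s. \<bar>(deriv ^^ q) U s\<bar> \<le> B"
    and V: "finite V" and \<eta>: "\<eta> > 0"
  shows "\<forall>\<^sub>F P in at_right 0. \<forall>vs. set vs \<subseteq> V \<and> length vs \<le> r \<longrightarrow> (\<forall>x.
    norm (pdl vs (\<lambda>x. P ^ r *\<^sub>R (U (\<theta> x / P) *\<^sub>R C x)) x -
      (if length vs = r then ((deriv ^^ r) U (\<theta> x / P) * (\<Prod>v\<leftarrow>vs. frechet_derivative \<theta> (at x) v)) *\<^sub>R C x else 0)) \<le> \<eta>)"
    (is "\<forall>\<^sub>F P in _. \<forall>vs. _ \<longrightarrow> ?Q P vs")
proof -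
  have 1: "\<forall>\<^sub>F P in at_right 0. ?Q P vs" if "length vs \<le> r" for vs
  proof -
    obtain D where D: "\<And>q. smooth (D q)" "\<And>q x. x \<notin> S \<Longrightarrow> D q x = 0"
      "\<And>x. D (length vs) x = (\<Prod>v\<leftarrow>vs. frechet_derivative \<theta> (at x) v) *\<^sub>R C x"
      "\<And>P x. P > 0 \<Longrightarrow> pdl vs (\<lambda>x. P ^ r *\<^sub>R (U (\<theta> x / P) *\<^sub>R C x)) x
        = (\<Sum>q\<le>length vs. (P ^ r * (1/P) ^ q * (deriv ^^ q) U (\<theta> x / P)) *\<^sub>R D q x)"
      using oscillation_expansion[OF U \<theta> C compact_imp_closed[OF S(1)] S(2), of vs r] by blast
    have "\<exists>B. \<forall>x. norm (D q x) \<le> B" for q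
    proof -
      have "compact (D q ` S)" by (intro compact_continuous_image smooth_continuous D S)
      then obtain B where "\<forall>y\<in>D q ` S. norm y \<le> B" using compact_imp_bounded bounded_iff by blast
      then have "norm (D q x) \<le> max 0 B" for x using D(2)[of x q] by (cases "x \<in> S") (auto simp: max.coboundedI2)
      then show ?thesis by blast
    qed
    then obtain BD where BD: "\<And>q x. norm (D q x) \<le> BD q" by metis
    obtain BU where BU: "\<And>q s. \<bar>(deriv ^^ q) U s\<bar> \<le> BU q" using bd by metis
    have B0: "BU q \<ge> 0" "BD q \<ge> 0" for q
      using BU[of q 0] BD[of q undefined] by (meson abs_ge_zero norm_ge_zero order_trans)+
    define K where "K = (\<Sum>q\<le>r. BU q * BD q)"
    have K0: "K \<ge> 0" unfolding K_def by (intro sum_nonneg mult_nonneg_nonneg B0)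
    have *: "?Q P vs" if P: "P > 0" "P < 1" "K * P < \<eta>" for P
    proof
      fix x
      let ?t = "\<lambda>q. (P ^ r * (1/P) ^ q * (deriv ^^ q) U (\<theta> x / P)) *\<^sub>R D q x"
      let ?Z = "if length vs = r then ((deriv ^^ r) U (\<theta> x / P) * (\<Prod>v\<leftarrow>vs. frechet_derivative \<theta> (at x) v)) *\<^sub>R C x else 0"
      \<comment> \<open>The indices whose power of \<open>P\<close> is positive; the only one that
        can be missing is \<open>r\<close>.\<close>
      define I where "I = {q. q \<le> length vs \<and> q < r}"
      have I: "I \<subseteq> {..r}" "finite I" by (auto simp: I_def)
      have "(\<Sum>q\<le>length vs. ?t q) - ?Z = (\<Sum>q\<in>I. ?t q)"
      proof (cases "length vs = r")
        case True
        then have "{..length vs} = insert r I" "r \<notin> I" by (auto simp: I_def)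
        moreover have "?t r = ?Z" using True D(3)[of x] P by (simp add: power_one_over field_simps)
        ultimately show ?thesis using I(2) by simp
      next
        case False
        then have "{..length vs} = I" using \<open>length vs \<le> r\<close> by (auto simp: I_def)
        then show ?thesis using False by simp
      qed
      also have "norm \<dots> \<le> (\<Sum>q\<in>I. P * (BU q * BD q))"
      proof (rule sum_norm_le)
        fix q assume "q \<in> I"
        then have q: "q < r" by (simp add: I_def)
        have "P ^ r * (1/P) ^ q = P ^ (r - q)"
          using P q by (simp add: power_one_over power_diff divide_inverse power_inverse)
        also have "\<dots> \<le> P ^ 1" using P q by (intro power_decreasing) auto
        finally have "\<bar>P ^ r * (1/P) ^ q\<bar> \<le> P" using P by simp
        then have "\<bar>P ^ r * (1/P) ^ q\<bar> * (\<bar>(deriv ^^ q) U (\<theta> x / P)\<bar> * norm (D q x)) \<le> P * (BU q * BD q)"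
          using BU BD B0 P by (intro mult_mono mult_nonneg_nonneg) auto
        then show "norm (?t q) \<le> P * (BU q * BD q)" by (simp add: abs_mult mult.assoc)
      qed
      also have "\<dots> \<le> (\<Sum>q\<le>r. P * (BU q * BD q))"
        using I B0 P by (intro sum_mono2 mult_nonneg_nonneg) auto
      also have "\<dots> = K * P" by (simp add: K_def sum_distrib_left mult.commute)
      finally show "norm (pdl vs (\<lambda>x. P ^ r *\<^sub>R (U (\<theta> x / P) *\<^sub>R C x)) x - ?Z) \<le> \<eta>"
        using D(4)[OF P(1)] P(3) by simp
    qed
    have "\<forall>\<^sub>F P in at_right 0. P < min 1 (\<eta> / (K + 1))"
      using \<eta> K0 by (intro eventually_mono[OF eventually_at_right_real[of 0 "min 1 (\<eta> / (K + 1))"]]) auto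
    moreover have "\<forall>\<^sub>F P in at_right 0. (P::real) > 0" by (simp add: eventually_at_filter)
    ultimately show ?thesis
    proof eventually_elim
      case (elim P)
      have "K * P \<le> (K + 1) * P" using elim by (simp add: algebra_simps)
      also have "\<dots> < \<eta>" using elim K0 by (simp add: pos_less_divide_eq mult.commute)
      finally show ?case using elim by (intro *) auto
    qed
  qed
  have fin: "finite {vs. set vs \<subseteq> V \<and> length vs \<le> r}" by (rule finite_lists_length_le[OF V])
  have "\<forall>\<^sub>F P in at_right 0. \<forall>vs\<in>{vs. set vs \<subseteq> V \<and> length vs \<le> r}. ?Q P vs"
    by (rule eventually_ball_finite[OF fin]) (use 1 in blast)
  then show ?thesis by (rule eventually_mono) blast
qed

lemma pdl_add:
  assumes "smooth f" "smooth g"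
  shows "pdl vs (\<lambda>x. f x + g x) = (\<lambda>x. pdl vs f x + pdl vs g x)"
proof (induction vs)
  case (Cons v vs)
  have "((\<lambda>x. pdl vs f x + pdl vs g x) has_derivative
      (\<lambda>v. frechet_derivative (pdl vs f) (at x) v + frechet_derivative (pdl vs g) (at x) v)) (at x)" for x
    by (intro has_derivative_add smooth_has_derivative smooth_pdl assms)
  from frechet_derivative_at[OF this, symmetric] show ?case using Cons by simp
qed auto

section \<open>Corrugating the hyperplane\<close>

abbreviation axes :: "(real^'m) set" where
  "axes \<equiv> range (\<lambda>i. axis i 1)"

text \<open>\<open>h\<close> approximates \<open>\<Sum>j\<in>J. C j x * (d(\<theta> j))\<^sup>r\<close> up to \<open>\<eta>\<close>, with bounded factors \<open>\<Lambda>\<close> that are one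
  near the hypersurface \<open>x $ i = W (\<Phi> x)\<close>.\<close>

definition corrugated ::
  "nat \<Rightarrow> 'm \<Rightarrow> (real^'m \<Rightarrow> real^'m) \<Rightarrow> (real^'m) set \<Rightarrow> real \<Rightarrow> 'j set \<Rightarrow> ('j \<Rightarrow> real^'m \<Rightarrow> real^'n) \<Rightarrow>
    ('j \<Rightarrow> real^'m \<Rightarrow> real) \<Rightarrow> real \<Rightarrow> (real^'m \<Rightarrow> real^'n) \<Rightarrow> (real^'m::finite \<Rightarrow> real) \<Rightarrow> real \<Rightarrow> bool" where
  "corrugated r i \<Phi> S B J C \<theta> \<eta> h W \<tau> \<longleftrightarrow>
    smooth h \<and> (\<forall>x. x \<notin> S \<longrightarrow> h x = 0) \<and>
    smooth W \<and> (\<forall>x s. W (x + s *\<^sub>R axis i 1) = W x) \<and> (\<forall>x. \<bar>W x\<bar> \<le> \<eta>) \<and>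
    (\<exists>L. \<forall>x y. \<bar>W x - W y\<bar> \<le> L * dist x y) \<and> \<tau> > 0 \<and>
    (\<exists>\<Lambda>. (\<forall>j\<in>J. \<forall>x. \<bar>\<Lambda> j x\<bar> \<le> B) \<and>
      (\<forall>x. \<bar>x $ i - W (\<Phi> x)\<bar> \<le> \<tau> \<longrightarrow> (\<forall>j\<in>J. \<Lambda> j x = 1)) \<and>
      (\<forall>vs x. set vs \<subseteq> axes \<and> length vs \<le> r \<longrightarrow>
        norm (pdl vs h x - (if length vs = r
          then \<Sum>j\<in>J. (\<Lambda> j x * (\<Prod>v\<leftarrow>vs. frechet_derivative (\<theta> j) (at x) v)) *\<^sub>R C j x else 0)) \<le> \<eta>))"

lemma corrugatedE:
  assumes "corrugated r i \<Phi> S B J C \<theta> \<eta> h W \<tau>"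
  obtains L \<Lambda> where "smooth h" "\<forall>x. x \<notin> S \<longrightarrow> h x = 0" "smooth W"
    "\<forall>x s. W (x + s *\<^sub>R axis i 1) = W x" "\<forall>x. \<bar>W x\<bar> \<le> \<eta>" "\<forall>x y. \<bar>W x - W y\<bar> \<le> L * dist x y" "\<tau> > 0"
    "\<forall>j\<in>J. \<forall>x. \<bar>\<Lambda> j x\<bar> \<le> B"
    "\<forall>j x. j \<in> J \<and> \<bar>x $ i - W (\<Phi> x)\<bar> \<le> \<tau> \<longrightarrow> \<Lambda> j x = 1"
    "\<forall>vs x. set vs \<subseteq> axes \<and> length vs \<le> r \<longrightarrow>
        norm (pdl vs h x - (if length vs = r
          then \<Sum>j\<in>J. (\<Lambda> j x * (\<Prod>v\<leftarrow>vs. frechet_derivative (\<theta> j) (at x) v)) *\<^sub>R C j x else 0)) \<le> \<eta>"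
proof -
  note c = assms[unfolded corrugated_def]
  obtain L where L: "\<forall>x y. \<bar>W x - W y\<bar> \<le> L * dist x y"
    using c[THEN conjunct2, THEN conjunct2, THEN conjunct2, THEN conjunct2, THEN conjunct2, THEN conjunct1] by (rule exE)
  obtain \<Lambda> where \<Lambda>: "(\<forall>j\<in>J. \<forall>x. \<bar>\<Lambda> j x\<bar> \<le> B) \<and>
      (\<forall>x. \<bar>x $ i - W (\<Phi> x)\<bar> \<le> \<tau> \<longrightarrow> (\<forall>j\<in>J. \<Lambda> j x = 1)) \<and>
      (\<forall>vs x. set vs \<subseteq> axes \<and> length vs \<le> r \<longrightarrow>
        norm (pdl vs h x - (if length vs = r
          then \<Sum>j\<in>J. (\<Lambda> j x * (\<Prod>v\<leftarrow>vs. frechet_derivative (\<theta> j) (at x) v)) *\<^sub>R C j x else 0)) \<le> \<eta>)"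
    using c[THEN conjunct2, THEN conjunct2, THEN conjunct2, THEN conjunct2, THEN conjunct2, THEN conjunct2, THEN conjunct2] by (rule exE)
  show thesis
    by (rule that[of L \<Lambda>]) (use c L \<Lambda> in blast)+
qed

lemma pdl_zero: "pdl vs (\<lambda>x. 0) = (\<lambda>x. 0)"
  by (induction vs) auto

lemma corrugated_empty: "\<eta> \<ge> 0 \<Longrightarrow> corrugated r i \<Phi> S B {} C \<theta> \<eta> (\<lambda>x. 0) (\<lambda>x. 0) 1"
  by (auto simp: corrugated_def pdl_zero smooth_const intro!: exI[of _ 0])

lemma real_at_right_obtain:
  assumes "\<forall>\<^sub>F P in at_right (0::real). Q P" obtains P where "P > 0" "Q P"
  using eventually_happens[OF eventually_conj[OF assms eventually_at_right_less[of 0]]] by auto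

lemma frechet_derivative_component: "frechet_derivative (\<lambda>x::real^'m. x $ i) (at x) = (\<lambda>v. v $ i)"
  by (rule frechet_derivative_at[symmetric]) (auto intro: bounded_linear_imp_has_derivative bounded_linear_vec_nth)

text \<open>With the height as phase, the hyperplane itself is the set where the phase is zero, and
  there a single unperiodized profile has r-th derivative one. This works only as long as
  \<open>W\<close> is still zero.\<close>

lemma corrugated_insert_flat:
  fixes C :: "'j \<Rightarrow> real^'m \<Rightarrow> real^'n"
  assumes h: "corrugated r i \<Phi> S B J C \<theta> \<eta> h W \<tau>" and W: "W = (\<lambda>x. 0)" and "\<eta> < \<eta>'"
    and J: "finite J" "j \<notin> J" and \<theta>: "\<theta> j = (\<lambda>x. x $ i)"
    and C: "smooth (C j)" "\<And>x. x \<notin> S \<Longrightarrow> C j x = 0" and S: "compact S"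
    and B: "\<And>s. \<bar>(deriv ^^ r) (monomial_bump r) s\<bar> \<le> B"
  shows "\<exists>h' \<tau>'. corrugated r i \<Phi> S B (insert j J) C \<theta> \<eta>' h' W \<tau>'"
proof -
  let ?U = "monomial_bump r"
  have bd: "\<exists>B. \<forall>s. \<bar>(deriv ^^ q) ?U s\<bar> \<le> B" for q
    using monomial_bump_bounded[of q r] by blast
  have s\<theta>: "smooth (\<theta> j)" by (auto simp: \<theta> intro!: smooth_component smooth_id)
  have finax: "finite (axes :: (real^'m) set)" by simp
  have e0: "\<eta>' - \<eta> > 0" using \<open>\<eta> < \<eta>'\<close> by simp
  define Q where "Q P \<longleftrightarrow> (\<forall>vs. set vs \<subseteq> axes \<and> length vs \<le> r \<longrightarrow> (\<forall>x.
    norm (pdl vs (\<lambda>x. P ^ r *\<^sub>R (?U (\<theta> j x / P) *\<^sub>R C j x)) x -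
      (if length vs = r then ((deriv ^^ r) ?U (\<theta> j x / P) * (\<Prod>v\<leftarrow>vs. frechet_derivative (\<theta> j) (at x) v)) *\<^sub>R C j x else 0)) \<le> \<eta>' - \<eta>))" for P
  have "\<forall>\<^sub>F P in at_right 0. Q P"
    unfolding Q_def by (rule oscillation_small[OF smooth_monomial_bump s\<theta> C(1) S C(2) bd finax e0])
  then obtain P where P: "P > 0" "Q P" by (rule real_at_right_obtain)
  note hP = P(2)[unfolded Q_def, rule_format, OF conjI]
  from h obtain L \<Lambda> where hs0: "smooth h" "\<forall>x. x \<notin> S \<longrightarrow> h x = 0" "smooth W"
    "\<forall>x s. W (x + s *\<^sub>R axis i 1) = W x" "\<forall>x. \<bar>W x\<bar> \<le> \<eta>" "\<forall>x y. \<bar>W x - W y\<bar> \<le> L * dist x y" "\<tau> > 0"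
    and \<Lambda>0: "\<forall>j\<in>J. \<forall>x. \<bar>\<Lambda> j x\<bar> \<le> B"
    "\<forall>j x. j \<in> J \<and> \<bar>x $ i - W (\<Phi> x)\<bar> \<le> \<tau> \<longrightarrow> \<Lambda> j x = 1"
    "\<forall>vs x. set vs \<subseteq> axes \<and> length vs \<le> r \<longrightarrow>
        norm (pdl vs h x - (if length vs = r
          then \<Sum>j\<in>J. (\<Lambda> j x * (\<Prod>v\<leftarrow>vs. frechet_derivative (\<theta> j) (at x) v)) *\<^sub>R C j x else 0)) \<le> \<eta>"
    by (rule corrugatedE)
  note hs = hs0[rule_format] and \<Lambda> = \<Lambda>0(1,2)[rule_format] \<Lambda>0(3)[rule_format, OF conjI]
  define g where "g x = P ^ r *\<^sub>R (?U (\<theta> j x / P) *\<^sub>R C j x)" for x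
  have sg: "smooth g"
    unfolding g_def[abs_def] by (intro smooth_scaleR smooth_const smooth_phase smooth_monomial_bump s\<theta> C)
  define \<Lambda>' where "\<Lambda>' = \<Lambda>(j := \<lambda>x. (deriv ^^ r) ?U (\<theta> j x / P))"
  have "corrugated r i \<Phi> S B (insert j J) C \<theta> \<eta>' (\<lambda>x. h x + g x) W (min \<tau> (P/3))"
    unfolding corrugated_def
  proof (intro conjI allI impI exI[of _ \<Lambda>'] ballI)
    show "smooth (\<lambda>x. h x + g x)" by (intro smooth_add hs sg)
    show "h x + g x = 0" if "x \<notin> S" for x using that hs C by (simp add: g_def)
    show "\<bar>\<Lambda>' k x\<bar> \<le> B" if "k \<in> insert j J" for k x using that \<Lambda>(1) B by (auto simp: \<Lambda>'_def)
    show "\<Lambda>' k x = 1" if "k \<in> insert j J" "\<bar>x $ i - W (\<Phi> x)\<bar> \<le> min \<tau> (P/3)" for k x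
    proof (cases "k = j")
      case True
      \<comment> \<open>1/3 is below 7/20, where the profile stops being the exact monomial.\<close>
      have "\<bar>x $ i / P\<bar> \<le> 1/3" using that(2) P by (simp add: W field_simps)
      then show ?thesis using True deriv_monomial_bump[of "x $ i / P" r r] by (simp add: \<Lambda>'_def \<theta>)
    qed (use that \<Lambda>(2) in \<open>auto simp: \<Lambda>'_def\<close>)
    show "norm (pdl vs (\<lambda>x. h x + g x) x - (if length vs = r
          then \<Sum>k\<in>insert j J. (\<Lambda>' k x * (\<Prod>v\<leftarrow>vs. frechet_derivative (\<theta> k) (at x) v)) *\<^sub>R C k x else 0)) \<le> \<eta>'"
      if "set vs \<subseteq> axes \<and> length vs \<le> r" for vs x
    proof -
      let ?a = "if length vs = r then \<Sum>j\<in>J. (\<Lambda> j x * (\<Prod>v\<leftarrow>vs. frechet_derivative (\<theta> j) (at x) v)) *\<^sub>R C j x else 0"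
      let ?b = "if length vs = r then ((deriv ^^ r) ?U (\<theta> j x / P) * (\<Prod>v\<leftarrow>vs. frechet_derivative (\<theta> j) (at x) v)) *\<^sub>R C j x else 0"
      have "(\<Sum>k\<in>J. (\<Lambda>' k x * (\<Prod>v\<leftarrow>vs. frechet_derivative (\<theta> k) (at x) v)) *\<^sub>R C k x)
        = (\<Sum>k\<in>J. (\<Lambda> k x * (\<Prod>v\<leftarrow>vs. frechet_derivative (\<theta> k) (at x) v)) *\<^sub>R C k x)"
        using J by (intro sum.cong) (auto simp: \<Lambda>'_def)
      then have e: "(if length vs = r
          then \<Sum>k\<in>insert j J. (\<Lambda>' k x * (\<Prod>v\<leftarrow>vs. frechet_derivative (\<theta> k) (at x) v)) *\<^sub>R C k x else 0) = ?a + ?b"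
        using J by (simp add: \<Lambda>'_def)
      have "norm ((pdl vs h x - ?a) + (pdl vs g x - ?b)) \<le> \<eta> + (\<eta>' - \<eta>)"
        using that by (intro norm_triangle_mono \<Lambda>(3) hP[folded g_def]) auto
      then show ?thesis unfolding e pdl_add[OF hs(1) sg] by (simp add: algebra_simps)
    qed
  qed (use hs P \<open>\<eta> < \<eta>'\<close> W in \<open>auto simp: smooth_const intro!: exI[of _ 0]\<close>)
  then show ?thesis by blast
qed

text \<open>The coefficient is divided by \<open>\<beta>\<close> between the two saws, with weights
  of sum one: where both saws are good the factor is one whatever \<open>\<beta>\<close> is, and
  elsewhere the new graph stays at the height where \<open>\<beta>\<close> selects the good saw. As
  \<open>a $ i = 0\<close>, the new graph function again ignores the i-th coordinate.\<close>

lemma corrugated_insert: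
  fixes C :: "'j \<Rightarrow> real^'m \<Rightarrow> real^'n"
  assumes h: "corrugated r i \<Phi> S B J C \<theta> \<eta> h W \<tau>" and "\<eta> < \<eta>'"
    and J: "finite J" "j \<notin> J" and \<theta>: "\<theta> j = (\<lambda>x. a \<bullet> \<Phi> x)" and a: "a $ i = 0" and \<Phi>: "smooth \<Phi>"
    and C: "smooth (C j)" "\<And>x. x \<notin> S \<Longrightarrow> C j x = 0" and S: "compact S"
    and B: "\<And>s. \<bar>(deriv ^^ r) (saw r) s\<bar> \<le> B"
  shows "\<exists>h' W' \<tau>'. corrugated r i \<Phi> S B (insert j J) C \<theta> \<eta>' h' W' \<tau>'"
proof -
  have finax: "finite (axes :: (real^'m) set)" by simp
  have s\<theta>: "smooth (\<theta> j)" by (auto simp: \<theta> intro!: smooth_inner smooth_const \<Phi>)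
  from h obtain LW \<Lambda> where hs0: "smooth h" "\<forall>x. x \<notin> S \<longrightarrow> h x = 0" "smooth W"
    "\<forall>x s. W (x + s *\<^sub>R axis i 1) = W x" "\<forall>x. \<bar>W x\<bar> \<le> \<eta>" "\<forall>x y. \<bar>W x - W y\<bar> \<le> LW * dist x y" "\<tau> > 0"
    and \<Lambda>0: "\<forall>j\<in>J. \<forall>x. \<bar>\<Lambda> j x\<bar> \<le> B"
    "\<forall>j x. j \<in> J \<and> \<bar>x $ i - W (\<Phi> x)\<bar> \<le> \<tau> \<longrightarrow> \<Lambda> j x = 1"
    "\<forall>vs x. set vs \<subseteq> axes \<and> length vs \<le> r \<longrightarrow>
        norm (pdl vs h x - (if length vs = r
          then \<Sum>j\<in>J. (\<Lambda> j x * (\<Prod>v\<leftarrow>vs. frechet_derivative (\<theta> j) (at x) v)) *\<^sub>R C j x else 0)) \<le> \<eta>"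
    by (rule corrugatedE)
  note hs = hs0[rule_format] and \<Lambda> = \<Lambda>0(1,2)[rule_format] \<Lambda>0(3)[rule_format, OF conjI]
  note LW = hs(6)
  \<comment> \<open>The new graph lies between the old one and its translate by \<open>A\<close>. A
    point within \<open>A / 4\<close> of it is within \<open>5 * A / 4\<close>, hence within
    \<open>\<tau>\<close>, of the old graph, so the earlier factors remain one.\<close>
  define A where "A = min (\<tau> / 2) (\<eta>' - \<eta>)"
  have A: "A > 0" "A \<le> \<tau> / 2" "A \<le> \<eta>' - \<eta>"
    using hs(7) \<open>\<eta> < \<eta>'\<close> unfolding A_def by (simp_all only: min_less_iff_conj min.cobounded1 min.cobounded2) simp
  define y where "y x = (x $ i - W (\<Phi> x)) / A" for x
  \<comment> \<open>One for \<open>y x\<close> up to 1/3 and zero from 2/3 on. Near the new graph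
    \<open>y\<close> differs from the wiggle by at most 1/4, so at wiggle 0 and at wiggle 1 only the
    appropriate saw counts.\<close>
  define \<beta> where "\<beta> x = smooth_step (2 - 3 * y x)" for x
  have s\<beta>: "smooth \<beta>"
    unfolding \<beta>_def[abs_def] y_def using A
    by (intro smooth_compose[OF smooth_smooth_step] smooth_diff smooth_const smooth_mult smooth_divide
        smooth_component smooth_id smooth_compose[OF hs(3) \<Phi>]) auto
  have \<beta>: "0 \<le> \<beta> x" "\<beta> x \<le> 1" for x by (auto simp: \<beta>_def)
  define U2 where "U2 s = saw r (s - 1/2)" for s
  have sU2: "smooth U2"
    unfolding U2_def[abs_def] by (intro smooth_compose[OF smooth_saw] smooth_diff smooth_id smooth_const)
  have dU2: "(deriv ^^ q) U2 s = (deriv ^^ q) (saw r) (s - 1/2)" for q s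
    unfolding U2_def[abs_def] by (simp add: deriv_iterate_shift[OF smooth_saw])
  have bd1: "\<exists>B. \<forall>s. \<bar>(deriv ^^ q) (saw r) s\<bar> \<le> B" for q by (rule saw_bounded)
  then have bd2: "\<exists>B. \<forall>s. \<bar>(deriv ^^ q) U2 s\<bar> \<le> B" for q unfolding dU2 by metis
  define C1 where "C1 x = \<beta> x *\<^sub>R C j x" for x
  define C2 where "C2 x = (1 - \<beta> x) *\<^sub>R C j x" for x
  have C12: "smooth C1" "smooth C2" "\<And>x. x \<notin> S \<Longrightarrow> C1 x = 0" "\<And>x. x \<notin> S \<Longrightarrow> C2 x = 0"
    unfolding C1_def[abs_def] C2_def[abs_def] using C by (auto intro!: smooth_scaleR smooth_diff smooth_const s\<beta>)
  define \<epsilon> where "\<epsilon> = (\<eta>' - \<eta>) / 2"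
  have \<epsilon>: "\<epsilon> > 0" using \<open>\<eta> < \<eta>'\<close> by (simp add: \<epsilon>_def)
  define Q where "Q U C P \<longleftrightarrow> (\<forall>vs. set vs \<subseteq> axes \<and> length vs \<le> r \<longrightarrow> (\<forall>x.
    norm (pdl vs (\<lambda>x. P ^ r *\<^sub>R (U (\<theta> j x / P) *\<^sub>R C x)) x -
      (if length vs = r then ((deriv ^^ r) U (\<theta> j x / P) * (\<Prod>v\<leftarrow>vs. frechet_derivative (\<theta> j) (at x) v)) *\<^sub>R C x else 0)) \<le> \<epsilon>))"
    for P U and C :: "real^'m \<Rightarrow> real^'n"
  have "\<forall>\<^sub>F P in at_right 0. Q (saw r) C1 P"
    unfolding Q_def by (rule oscillation_small[OF smooth_saw s\<theta> C12(1) S C12(3) bd1 finax \<epsilon>])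
  moreover have "\<forall>\<^sub>F P in at_right 0. Q U2 C2 P"
    unfolding Q_def by (rule oscillation_small[OF sU2 s\<theta> C12(2) S C12(4) bd2 finax \<epsilon>])
  ultimately have "\<forall>\<^sub>F P in at_right 0. Q (saw r) C1 P \<and> Q U2 C2 P" by (rule eventually_conj)
  then obtain P where P: "P > 0" "Q (saw r) C1 P \<and> Q U2 C2 P" by (rule real_at_right_obtain)
  note hP1 = P(2)[THEN conjunct1, unfolded Q_def, rule_format, OF conjI]
  note hP2 = P(2)[THEN conjunct2, unfolded Q_def, rule_format, OF conjI]
  define g1 where "g1 x = P ^ r *\<^sub>R (saw r (\<theta> j x / P) *\<^sub>R C1 x)" for x
  define g2 where "g2 x = P ^ r *\<^sub>R (U2 (\<theta> j x / P) *\<^sub>R C2 x)" for x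
  have sg: "smooth g1" "smooth g2"
    unfolding g1_def[abs_def] g2_def[abs_def]
    by (intro smooth_scaleR smooth_const smooth_phase smooth_saw sU2 s\<theta> C12)+
  \<comment> \<open>The period is that of the saws. Evaluated at \<open>\<Phi> x\<close> the
    argument is \<open>\<theta> j x / P\<close>, so the graph and the saws are in phase.\<close>
  define \<omega> where "\<omega> x = wiggle ((a \<bullet> x) / P)" for x
  define W' where "W' x = W x + A * \<omega> x" for x
  define l where "l x = (deriv ^^ r) (saw r) (\<theta> j x / P) * \<beta> x + (deriv ^^ r) U2 (\<theta> j x / P) * (1 - \<beta> x)" for x
  define \<Lambda>' where "\<Lambda>' = \<Lambda>(j := l)"
  have lB: "\<bar>l x\<bar> \<le> B" for x
  proof -
    have "\<bar>l x\<bar> \<le> \<bar>(deriv ^^ r) (saw r) (\<theta> j x / P)\<bar> * \<beta> x + \<bar>(deriv ^^ r) U2 (\<theta> j x / P)\<bar> * (1 - \<beta> x)"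
      unfolding l_def using \<beta>[of x] by (intro order_trans[OF abs_triangle_ineq]) (simp add: abs_mult)
    also have "\<dots> \<le> B * \<beta> x + B * (1 - \<beta> x)"
      using \<beta>[of x] B by (intro add_mono mult_right_mono) (auto simp: dU2)
    finally show ?thesis by (simp add: algebra_simps)
  qed
  have near: "\<bar>x $ i - W (\<Phi> x)\<bar> \<le> \<tau> \<and> l x = 1" if "\<bar>x $ i - W' (\<Phi> x)\<bar> \<le> A / 4" for x
  proof
    let ?w = "wiggle (\<theta> j x / P)"
    have W'eq: "x $ i - W' (\<Phi> x) = (x $ i - W (\<Phi> x)) - A * ?w" by (simp add: W'_def \<omega>_def \<theta>)
    have "\<bar>A * ?w\<bar> \<le> A" using A wiggle_bounds[of "\<theta> j x / P"] by (simp add: abs_mult)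
    then show "\<bar>x $ i - W (\<Phi> x)\<bar> \<le> \<tau>" using that A unfolding W'eq by linarith
    have "\<bar>y x - ?w\<bar> = \<bar>x $ i - W' (\<Phi> x)\<bar> / A"
    proof -
      have "y x - ?w = (x $ i - W' (\<Phi> x)) / A"
        using A unfolding W'eq y_def by (simp add: diff_divide_distrib)
      then show ?thesis using A by simp
    qed
    also have "\<dots> \<le> 1/4" using that A by (simp add: field_simps)
    finally have yw: "\<bar>y x - ?w\<bar> \<le> 1/4" .
    show "l x = 1"
    proof (cases rule: wiggle_cases[of "\<theta> j x / P" r])
      case 1
      then have "2 - 3 * y x \<ge> 1" using yw unfolding abs_le_iff by linarith
      then have "\<beta> x = 1" unfolding \<beta>_def by (rule smooth_step_simps)
      then show ?thesis using 1 by (simp add: l_def)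
    next
      case 2
      then have "2 - 3 * y x \<le> 0" using yw unfolding abs_le_iff by linarith
      then have "\<beta> x = 0" unfolding \<beta>_def by (rule smooth_step_simps)
      then show ?thesis using 2 by (simp add: l_def dU2)
    next
      case 3 then show ?thesis by (simp add: l_def dU2)
    qed
  qed
  have "corrugated r i \<Phi> S B (insert j J) C \<theta> \<eta>' (\<lambda>x. h x + (g1 x + g2 x)) W' (A / 4)"
    unfolding corrugated_def
  proof (intro conjI allI impI exI[of _ \<Lambda>'] ballI)
    show "smooth (\<lambda>x. h x + (g1 x + g2 x))" by (intro smooth_add hs sg)
    show "h x + (g1 x + g2 x) = 0" if "x \<notin> S" for x using that hs C12 by (simp add: g1_def g2_def)
    have "smooth (\<lambda>x. wiggle ((a \<bullet> x) / P))"
      by (intro smooth_phase smooth_wiggle smooth_inner smooth_const smooth_id)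
    then show "smooth W'"
      unfolding W'_def[abs_def] \<omega>_def by (intro smooth_add hs smooth_mult smooth_const)
    show "W' (x + s *\<^sub>R axis i 1) = W' x" for x s
      using a by (simp add: W'_def \<omega>_def hs inner_add_right inner_axis)
    show "\<bar>W' x\<bar> \<le> \<eta>'" for x
    proof -
      have "\<bar>A * \<omega> x\<bar> \<le> A" using A wiggle_bounds by (simp add: abs_mult \<omega>_def)
      then show ?thesis using hs(5)[of x] A(3) unfolding W'_def by linarith
    qed
    \<comment> \<open>The constant obtained grows like \<open>1/P\<close>; later only its finiteness
      matters.\<close>
    show "\<exists>L. \<forall>x y. \<bar>W' x - W' y\<bar> \<le> L * dist x y"
    proof -
      obtain L where L: "L \<ge> 0" "\<And>s t. \<bar>wiggle s - wiggle t\<bar> \<le> L * \<bar>s - t\<bar>" using wiggle_lipschitz by blast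
      have "\<bar>W' u - W' v\<bar> \<le> (LW + A * (L * (norm a / P))) * dist u v" for u v
      proof -
        have "\<bar>(a \<bullet> u) / P - (a \<bullet> v) / P\<bar> = \<bar>a \<bullet> (u - v)\<bar> / P"
          using P by (simp add: inner_diff_right flip: diff_divide_distrib)
        also have "\<dots> \<le> norm a * norm (u - v) / P"
          using P Cauchy_Schwarz_ineq2[of a "u - v"] by (simp add: divide_right_mono)
        finally have "\<bar>(a \<bullet> u) / P - (a \<bullet> v) / P\<bar> \<le> norm a * norm (u - v) / P" .
        from order_trans[OF L(2) mult_left_mono[OF this L(1)]]
        have "\<bar>\<omega> u - \<omega> v\<bar> \<le> L * (norm a * norm (u - v) / P)" by (simp only: \<omega>_def)
        then have "A * \<bar>\<omega> u - \<omega> v\<bar> \<le> A * (L * (norm a * norm (u - v) / P))"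
          using A(1) by (intro mult_left_mono) auto
        moreover have "\<bar>W' u - W' v\<bar> \<le> \<bar>W u - W v\<bar> + A * \<bar>\<omega> u - \<omega> v\<bar>"
        proof -
          have "W' u - W' v = (W u - W v) + A * (\<omega> u - \<omega> v)" by (simp add: W'_def algebra_simps)
          also have "\<bar>\<dots>\<bar> \<le> \<bar>W u - W v\<bar> + \<bar>A * (\<omega> u - \<omega> v)\<bar>" by (rule abs_triangle_ineq)
          finally show ?thesis using A by (simp add: abs_mult)
        qed
        ultimately show ?thesis using LW[of u v] by (simp add: dist_norm algebra_simps)
      qed
      then show ?thesis by blast
    qed
    show "A / 4 > 0" using A by simp
    show "\<bar>\<Lambda>' k x\<bar> \<le> B" if "k \<in> insert j J" for k x using that \<Lambda>(1) lB by (auto simp: \<Lambda>'_def)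
    show "\<Lambda>' k x = 1" if "\<bar>x $ i - W' (\<Phi> x)\<bar> \<le> A / 4" "k \<in> insert j J" for k x
      using near[OF that(1)] \<Lambda>(2) that(2) by (auto simp: \<Lambda>'_def)
    show "norm (pdl vs (\<lambda>x. h x + (g1 x + g2 x)) x - (if length vs = r
          then \<Sum>k\<in>insert j J. (\<Lambda>' k x * (\<Prod>v\<leftarrow>vs. frechet_derivative (\<theta> k) (at x) v)) *\<^sub>R C k x else 0)) \<le> \<eta>'"
      if "set vs \<subseteq> axes \<and> length vs \<le> r" for vs x
    proof -
      let ?a = "if length vs = r then \<Sum>j\<in>J. (\<Lambda> j x * (\<Prod>v\<leftarrow>vs. frechet_derivative (\<theta> j) (at x) v)) *\<^sub>R C j x else 0"
      let ?b1 = "if length vs = r then ((deriv ^^ r) (saw r) (\<theta> j x / P) * (\<Prod>v\<leftarrow>vs. frechet_derivative (\<theta> j) (at x) v)) *\<^sub>R C1 x else 0"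
      let ?b2 = "if length vs = r then ((deriv ^^ r) U2 (\<theta> j x / P) * (\<Prod>v\<leftarrow>vs. frechet_derivative (\<theta> j) (at x) v)) *\<^sub>R C2 x else 0"
      have 1: "(\<Sum>k\<in>J. (\<Lambda>' k x * (\<Prod>v\<leftarrow>vs. frechet_derivative (\<theta> k) (at x) v)) *\<^sub>R C k x)
        = (\<Sum>k\<in>J. (\<Lambda> k x * (\<Prod>v\<leftarrow>vs. frechet_derivative (\<theta> k) (at x) v)) *\<^sub>R C k x)"
        using J by (intro sum.cong) (auto simp: \<Lambda>'_def)
      have 2: "?b1 + ?b2 = (if length vs = r then (\<Lambda>' j x * (\<Prod>v\<leftarrow>vs. frechet_derivative (\<theta> j) (at x) v)) *\<^sub>R C j x else 0)"
        by (simp add: \<Lambda>'_def l_def C1_def C2_def algebra_simps)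
      have e: "(if length vs = r
          then \<Sum>k\<in>insert j J. (\<Lambda>' k x * (\<Prod>v\<leftarrow>vs. frechet_derivative (\<theta> k) (at x) v)) *\<^sub>R C k x else 0) = ?a + (?b1 + ?b2)"
        unfolding 2 using J 1 by simp
      have "norm ((pdl vs h x - ?a) + ((pdl vs g1 x - ?b1) + (pdl vs g2 x - ?b2))) \<le> \<eta> + (\<epsilon> + \<epsilon>)"
        using that by (intro norm_triangle_mono \<Lambda>(3) hP1[folded g1_def] hP2[folded g2_def]) auto
      then show ?thesis
        unfolding e pdl_add[OF hs(1) smooth_add[OF sg]] pdl_add[OF sg] by (simp add: algebra_simps \<epsilon>_def)
    qed
  qed
  then show ?thesis by blast
qed

text \<open>The flat pieces \<open>J\<close> come first, because inserting one requires the graph to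
  be the hyperplane. Each insertion is given half of the tolerance for what precedes it.\<close>

lemma ex_corrugated:
  fixes C :: "'j \<Rightarrow> real^'m \<Rightarrow> real^'n"
  assumes J: "finite J" and K: "finite K" "J \<inter> K = {}"
    and flat: "\<And>j. j \<in> J \<Longrightarrow> \<theta> j = (\<lambda>x. x $ i)"
    and wig: "\<And>j. j \<in> K \<Longrightarrow> \<theta> j = (\<lambda>x. a j \<bullet> \<Phi> x)" "\<And>j. j \<in> K \<Longrightarrow> a j $ i = 0" and \<Phi>: "smooth \<Phi>"
    and C: "\<And>j. j \<in> J \<union> K \<Longrightarrow> smooth (C j)" "\<And>j x. j \<in> J \<union> K \<Longrightarrow> x \<notin> S \<Longrightarrow> C j x = 0" and S: "compact S"
    and B: "\<And>s. \<bar>(deriv ^^ r) (monomial_bump r) s\<bar> \<le> B" "\<And>s. \<bar>(deriv ^^ r) (saw r) s\<bar> \<le> B"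
    and \<eta>: "\<eta> > 0"
  shows "\<exists>h W \<tau>. corrugated r i \<Phi> S B (J \<union> K) C \<theta> \<eta> h W \<tau>"
proof -
  have 1: "\<exists>h \<tau>. corrugated r i \<Phi> S B J C \<theta> \<eta> h (\<lambda>x. 0) \<tau>" if "\<eta> > 0" for \<eta>
    using J flat C that
  proof (induction J arbitrary: \<eta>)
    case empty then show ?case using corrugated_empty by (metis less_imp_le)
  next
    case (insert j J)
    have "\<exists>h \<tau>. corrugated r i \<Phi> S B J C \<theta> (\<eta>/2) h (\<lambda>x. 0) \<tau>"
      by (rule insert.IH) (use insert.prems in auto)
    then obtain h \<tau> where h: "corrugated r i \<Phi> S B J C \<theta> (\<eta>/2) h (\<lambda>x. 0) \<tau>" by blast
    show ?case
      by (rule corrugated_insert_flat[OF h refl _ insert.hyps(1,2) _ _ _ S B(1)]) (use insert.prems in auto)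
  qed
  show ?thesis
    using K wig C \<eta>
  proof (induction K arbitrary: \<eta>)
    case empty then show ?case using 1[of \<eta>] by auto
  next
    case (insert j K)
    have "\<exists>h W \<tau>. corrugated r i \<Phi> S B (J \<union> K) C \<theta> (\<eta>/2) h W \<tau>"
      by (rule insert.IH) (use insert.prems in auto)
    then obtain h W \<tau> where h: "corrugated r i \<Phi> S B (J \<union> K) C \<theta> (\<eta>/2) h W \<tau>" by blast
    have "\<exists>h' W' \<tau>'. corrugated r i \<Phi> S B (insert j (J \<union> K)) C \<theta> \<eta> h' W' \<tau>'"
      by (rule corrugated_insert[OF h _ _ _ _ _ \<Phi> _ _ S B(2), where a = "a j"])
        (use insert.prems insert.hyps J in auto)
    then show ?case by simp
  qed
qed

section \<open>Jets whose restriction to a hyperplane vanishes\<close>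

definition mon :: "real^'m \<Rightarrow> 'm multiset \<Rightarrow> real" where
  "mon t \<alpha> = (\<Prod>i\<in>#\<alpha>. t $ i)"

lemma mon_simps [simp]: "mon t {#} = 1" "mon t (add_mset i \<alpha>) = t $ i * mon t \<alpha>"
  by (simp_all add: mon_def)

lemma mon_mset: "mon t (mset l) = (\<Prod>i\<leftarrow>l. t $ i)"
  by (induction l) auto

lemma tendsto_mon: "(t \<longlongrightarrow> t0) F \<Longrightarrow> ((\<lambda>q. mon (t q) \<alpha>) \<longlongrightarrow> mon t0 \<alpha>) F"
  by (induction \<alpha>) (auto intro!: tendsto_intros)

lemma mon_le_1: "(\<And>k. \<bar>s $ k\<bar> \<le> 1) \<Longrightarrow> \<bar>mon s \<alpha>\<bar> \<le> 1"
  by (induction \<alpha>) (auto simp: abs_mult intro: mult_le_one)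

text \<open>One factor is exchanged at a time. The exchanged entries are at most 2 in absolute value
  because \<open>\<eta>\<close> is at most 1, which explains the power of 2.\<close>

lemma mon_diff:
  assumes s: "\<And>k. \<bar>s $ k\<bar> \<le> 1" and d: "\<And>k. \<bar>t $ k - s $ k\<bar> \<le> \<eta>" and \<eta>: "\<eta> \<le> 1"
  shows "\<bar>mon t \<alpha> - mon s \<alpha>\<bar> \<le> real (size \<alpha>) * 2 ^ size \<alpha> * \<eta>"
proof (induction \<alpha>)
  case (add i \<alpha>)
  have \<eta>0: "\<eta> \<ge> 0" using d[of i] by linarith
  have t: "\<bar>t $ i\<bar> \<le> 2" using s[of i] d[of i] \<eta> by linarith
  have "mon t (add_mset i \<alpha>) - mon s (add_mset i \<alpha>) = t $ i * (mon t \<alpha> - mon s \<alpha>) + (t $ i - s $ i) * mon s \<alpha>"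
    by (simp add: algebra_simps)
  also have "\<bar>\<dots>\<bar> \<le> \<bar>t $ i\<bar> * \<bar>mon t \<alpha> - mon s \<alpha>\<bar> + \<bar>t $ i - s $ i\<bar> * \<bar>mon s \<alpha>\<bar>"
    by (intro order_trans[OF abs_triangle_ineq]) (simp add: abs_mult)
  also have "\<dots> \<le> 2 * (real (size \<alpha>) * 2 ^ size \<alpha> * \<eta>) + \<eta> * 1"
    using t d[of i] mon_le_1[of s \<alpha>] s add by (intro add_mono mult_mono) auto
  also have "\<dots> \<le> 2 * (real (size \<alpha>) * 2 ^ size \<alpha> * \<eta>) + 2 ^ Suc (size \<alpha>) * \<eta>"
    using mult_right_mono[OF one_le_power[of "2::real" "Suc (size \<alpha>)"] \<eta>0] by simp
  also have "\<dots> = real (size (add_mset i \<alpha>)) * 2 ^ size (add_mset i \<alpha>) * \<eta>"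
    by (simp add: algebra_simps)
  finally show ?case .
qed auto

lemma finite_multisets_of_size: "finite {\<alpha> :: 'm::finite multiset. size \<alpha> = r}"
proof (rule finite_subset)
  show "{\<alpha> :: 'm multiset. size \<alpha> = r} \<subseteq> mset ` {l. set l \<subseteq> UNIV \<and> length l = r}"
  proof
    fix \<alpha> :: "'m multiset" assume "\<alpha> \<in> {\<alpha>. size \<alpha> = r}"
    moreover obtain l where "mset l = \<alpha>" using ex_mset by blast
    ultimately show "\<alpha> \<in> mset ` {l. set l \<subseteq> UNIV \<and> length l = r}" by auto
  qed
qed (intro finite_imageI finite_lists_length_eq finite)

text \<open>A symmetric tensor that vanishes as soon as one argument lies in the kernel of \<open>n\<close> is a multiple
  of the power of \<open>n\<close>.\<close>

lemma jet_structure: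
  fixes s :: "'m::finite multiset \<Rightarrow> real^'n"
  assumes "r \<ge> 1" and n: "n $ i = 1"
    and s: "\<And>\<alpha> \<nu>. size \<alpha> = r - 1 \<Longrightarrow> n \<bullet> \<nu> = 0 \<Longrightarrow> (\<Sum>k\<in>UNIV. (\<nu> $ k) *\<^sub>R s (add_mset k \<alpha>)) = 0"
    and \<alpha>: "size \<alpha> = r"
  shows "s \<alpha> = mon n \<alpha> *\<^sub>R s (replicate_mset r i)"
proof -
  have step: "s (add_mset j \<beta>) = n $ j *\<^sub>R s (add_mset i \<beta>)" if "size \<beta> = r - 1" for j \<beta>
  proof -
    \<comment> \<open>Because \<open>n $ i = 1\<close>, this vector lies in the kernel, so an index
      \<open>j\<close> may be traded for \<open>i\<close> at the price of a factor
      \<open>n $ j\<close>.\<close>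
    have "n \<bullet> (axis j 1 - n $ j *\<^sub>R axis i 1) = 0"
      by (simp add: inner_diff_right inner_axis n)
    from s[OF that this] have "(\<Sum>k\<in>UNIV. (axis j 1 $ k) *\<^sub>R s (add_mset k \<beta>)) - n $ j *\<^sub>R (\<Sum>k\<in>UNIV. (axis i 1 $ k) *\<^sub>R s (add_mset k \<beta>)) = 0"
      by (simp add: scaleR_diff_left sum_subtractf scaleR_sum_right)
    moreover have "(\<Sum>k\<in>UNIV. (axis j 1 $ k) *\<^sub>R s (add_mset k \<beta>)) = s (add_mset j \<beta>)" for j
      by (simp add: axis_def if_distrib[of "\<lambda>c. c *\<^sub>R _"] sum.If_cases cong: if_cong)
    ultimately show ?thesis by simp
  qed
  have "size \<gamma> + k = r \<Longrightarrow> s (\<gamma> + replicate_mset k i) = mon n \<gamma> *\<^sub>R s (replicate_mset r i)" for \<gamma> k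
  proof (induction \<gamma> arbitrary: k)
    case (add j \<gamma>)
    have "s (add_mset j \<gamma> + replicate_mset k i) = n $ j *\<^sub>R s (\<gamma> + replicate_mset (Suc k) i)"
      using step[of "\<gamma> + replicate_mset k i" j] add.prems by simp
    then show ?case using add.IH[of "Suc k"] add.prems by simp
  qed simp
  from this[of \<alpha> 0] \<alpha> show ?thesis by simp
qed

text \<open>Dividing by the largest entry makes one entry exactly one. The coefficient of the power
  in \<open>jet_structure\<close> is then itself an entry of the jet and inherits its
  bounds.\<close>

lemma sup_normalized:
  fixes N :: "real^'m"
  assumes "N \<noteq> 0"
  obtains c i where "c \<noteq> 0" "(c *\<^sub>R N) $ i = 1" "\<And>k. \<bar>(c *\<^sub>R N) $ k\<bar> \<le> 1"
proof -
  let ?A = "range (\<lambda>k. \<bar>N $ k\<bar>)"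
  have "Max ?A \<in> ?A" by (intro Max_in) auto
  then obtain i where i: "\<bar>N $ i\<bar> = Max ?A" unfolding image_iff by metis
  have m: "\<bar>N $ k\<bar> \<le> \<bar>N $ i\<bar>" for k unfolding i by (intro Max_ge) auto
  have "N $ i \<noteq> 0"
  proof
    assume "N $ i = 0"
    then have "N $ k = 0" for k using m[of k] by simp
    then show False using assms by (simp add: vec_eq_iff)
  qed
  then show thesis using m by (intro that[of "1 / N $ i" i]) (auto simp: divide_simps)
qed

lemma same_kernel_parallel:
  fixes n N :: "'a::euclidean_space"
  assumes "{v. n \<bullet> v = 0} = {v. N \<bullet> v = 0}" "N \<noteq> 0"
  obtains c where "n = c *\<^sub>R N"
proof -
  define c where "c = (n \<bullet> N) / (N \<bullet> N)"
  define v where "v = n - c *\<^sub>R N"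
  have "N \<bullet> v = 0" using assms(2) by (simp add: v_def c_def inner_diff_right inner_commute)
  moreover from this assms(1) have "n \<bullet> v = 0" by blast
  ultimately have "v \<bullet> v = 0" by (simp add: v_def inner_diff_left)
  then show thesis by (intro that[of c]) (simp add: v_def)
qed

section \<open>Isotopies\<close>

lemma ck_sin_cos: "ck n (sin :: real \<Rightarrow> real) \<and> ck n (cos :: real \<Rightarrow> real)"
proof (induction n)
  case 0 show ?case
    by (auto simp: ck_0 real_differentiable_def intro: DERIV_sin DERIV_cos)
next
  case (Suc n)
  have "ck (Suc n) (sin :: real \<Rightarrow> real)"
  proof (rule ck_SucI)
    show "(sin has_derivative (\<lambda>v. cos x * v)) (at x)" for x :: real
      using DERIV_sin by (simp add: has_field_derivative_def)
  qed (intro bounded_bilinear.ck_bilinear[OF bounded_bilinear_mult] ck_const Suc[THEN conjunct2])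
  moreover have "ck (Suc n) (cos :: real \<Rightarrow> real)"
  proof (rule ck_SucI)
    show "(cos has_derivative (\<lambda>v. sin x * (- 1) * v)) (at x)" for x :: real
      by (auto intro!: derivative_eq_intros)
  qed (intro bounded_bilinear.ck_bilinear[OF bounded_bilinear_mult] ck_const Suc[THEN conjunct1])
  ultimately show ?case by simp
qed

lemma abs_sin_diff_le: "\<bar>sin x - sin y\<bar> \<le> \<bar>x - y\<bar>" for x y :: real
proof -
  have "norm (sin x - sin y) \<le> 1 * norm (x - y)"
    by (rule field_differentiable_bound[of UNIV sin cos]) (auto intro: DERIV_sin)
  then show ?thesis by simp
qed

text \<open>On the hyperplane \<open>x $ i = 0\<close> the derivative of \<open>\<Phi>\<close> maps \<open>b + axis i 1\<close> to \<open>axis i 1\<close>.\<close>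

lemma straightening:
  fixes b :: "real^'m \<Rightarrow> real^'m"
  assumes b: "smooth b" "\<And>x. b x $ i = 0" and S: "compact S" "\<And>x. x \<notin> S \<Longrightarrow> b x = 0"
  obtains \<Phi> \<Psi> :: "real^'m \<Rightarrow> real^'m" and C :: real where "smooth \<Phi>" "smooth \<Psi>"
    "\<forall>x. \<Phi> (\<Psi> x) = x" "\<forall>x. \<Psi> (\<Phi> x) = x" "\<forall>x. \<Phi> x $ i = x $ i"
    "\<forall>x. x \<notin> S \<longrightarrow> \<Phi> x = x" "\<forall>x. x $ i = 0 \<longrightarrow> \<Phi> x = x"
    "\<forall>x. x $ i = 0 \<longrightarrow> (\<Phi> has_derivative (\<lambda>v. v - v $ i *\<^sub>R b x)) (at x)"
    "C > 0" "\<forall>x y. dist x y \<le> C * dist (\<Phi> x) (\<Phi> y)"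
proof -
  obtain \<kappa> where \<kappa>: "\<kappa> \<ge> 0" "\<And>x y. dist (b x) (b y) \<le> \<kappa> * dist x y"
    using compact_support_lipschitz[OF b(1) S] by blast
  have "compact (b ` S)" by (intro compact_continuous_image smooth_continuous b S)
  then obtain K0 where "\<forall>y\<in>b ` S. norm y \<le> K0" using compact_imp_bounded bounded_iff by blast
  then have K: "norm (b x) \<le> max 0 K0" for x using S(2)[of x] by (cases "x \<in> S") (auto simp: max.coboundedI2)
  define z where "z = 1 / (2 * (\<kappa> + 1))"
  have z: "z > 0" "z * \<kappa> \<le> 1/2" using \<kappa>(1) by (auto simp: z_def field_simps)
  \<comment> \<open>The sine gives a function of the height with slope one at height zero, as the
    derivative of \<open>\<Phi>\<close> requires, yet bounded by \<open>z\<close>, which makes the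
    displacement along \<open>b\<close> a contraction. It vanishes at height zero, so the hyperplane
    is fixed.\<close>
  define g where "g x = z * sin (x $ i / z)" for x :: "real^'m"
  define \<Phi> where "\<Phi> x = x - g x *\<^sub>R b x" for x
  have sg: "smooth g"
    unfolding g_def[abs_def]
    by (intro smooth_mult smooth_const smooth_phase smooth_component smooth_id) (simp add: smooth_iff_ck ck_sin_cos)
  have s\<Phi>: "smooth \<Phi>" unfolding \<Phi>_def[abs_def] by (intro smooth_diff smooth_id smooth_scaleR sg b)
  have inv: "g (x + s *\<^sub>R b y) = g x" for x y s by (simp add: g_def b)
  have G: "\<bar>g x\<bar> \<le> z" for x using z by (simp add: g_def abs_mult)
  have L: "\<bar>g x - g y\<bar> \<le> 1 * dist x y" for x y
  proof -
    have "\<bar>g x - g y\<bar> = z * \<bar>sin (x $ i / z) - sin (y $ i / z)\<bar>"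
      using z by (simp add: g_def abs_mult flip: right_diff_distrib)
    also have "\<dots> \<le> z * \<bar>x $ i / z - y $ i / z\<bar>"
      using z abs_sin_diff_le by (intro mult_left_mono) auto
    also have "\<dots> = \<bar>(x - y) $ i\<bar>" using z by (simp flip: diff_divide_distrib)
    also have "\<dots> \<le> dist x y" unfolding dist_norm by (rule component_le_norm_cart)
    finally show ?thesis by simp
  qed
  note fd = fibred_diffeo[where g = g and k = b, OF inv G \<kappa>(2) z(2) K L, folded \<Phi>_def]
  define C where "C = 2 * (1 + 1 * max 0 K0)"
  have C: "C > 0" by (simp add: C_def add_pos_nonneg)
  have bij: "bij \<Phi>" using fd(1) by (simp add: \<Phi>_def[abs_def])
  have CC: "dist x y \<le> C * dist (\<Phi> x) (\<Phi> y)" for x y using fd(2)[of x y] by (simp add: C_def)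
  define \<Psi> where "\<Psi> = inv \<Phi>"
  have pq: "\<Phi> (\<Psi> x) = x" "\<Psi> (\<Phi> x) = x" for x
    using bij by (auto simp: \<Psi>_def bij_def surj_f_inv_f)
  show thesis
  proof (rule that[of \<Phi> \<Psi> C]; (intro allI impI)?)
    show "\<Phi> x $ i = x $ i" for x by (simp add: \<Phi>_def b)
    show "\<Phi> x = x" if "x \<notin> S" for x using that S by (simp add: \<Phi>_def)
    show "\<Phi> x = x" if "x $ i = 0" for x using that by (simp add: \<Phi>_def g_def)
    show "(\<Phi> has_derivative (\<lambda>v. v - v $ i *\<^sub>R b x)) (at x)" if x: "x $ i = 0" for x
    proof -
      have c: "((\<lambda>x. x $ i) has_derivative (\<lambda>v. v $ i)) (at x)"
        by (auto intro: bounded_linear_imp_has_derivative bounded_linear_vec_nth)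
      have "((\<lambda>x. z * sin (x $ i / z)) has_derivative (\<lambda>v. z * (v $ i / z * cos (x $ i / z)))) (at x)"
        using z by (auto intro!: derivative_eq_intros c)
      then have "(g has_derivative (\<lambda>v. v $ i)) (at x)"
        using x z by (simp add: g_def[abs_def])
      from has_derivative_diff[OF has_derivative_ident has_derivative_scaleR[OF this smooth_has_derivative[OF b(1)]]]
      show ?thesis using x by (simp add: \<Phi>_def[abs_def] g_def)
    qed
  qed (rule s\<Phi> smooth_inverse_map[OF s\<Phi> pq CC] pq C CC)+
qed

text \<open>Conjugated by \<open>\<Phi>\<close>, the map adds a multiple of the i-th axis vector. In
  \<open>fibred_diffeo\<close> the graph function is the part constant along the displacement and
  the cutoff is the displacement, so invertibility rests on \<open>\<eta> * \<kappa>\<close>; the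
  slope \<open>L\<close> of \<open>W\<close> enters only the Lipschitz bound of the inverse and may
  be huge.\<close>

lemma sheared_isotopy:
  fixes \<Phi> \<Psi> :: "real^'m \<Rightarrow> real^'m" and W \<zeta> :: "real^'m \<Rightarrow> real"
  assumes \<Phi>: "smooth \<Phi>" "smooth \<Psi>" "\<And>x. \<Phi> (\<Psi> x) = x" "\<And>x. \<Psi> (\<Phi> x) = x"
    and C: "C \<ge> 0" "\<And>x y. dist x y \<le> C * dist (\<Phi> x) (\<Phi> y)"
    and W: "smooth W" "\<And>x s. W (x + s *\<^sub>R axis i 1) = W x" "\<And>x. \<bar>W x\<bar> \<le> \<eta>"
      "\<And>x y. \<bar>W x - W y\<bar> \<le> L * dist x y"
    and \<zeta>: "smooth \<zeta>" "\<And>x. 0 \<le> \<zeta> x" "\<And>x. \<zeta> x \<le> 1" "\<And>x y. dist (\<zeta> x) (\<zeta> y) \<le> \<kappa> * dist x y" "\<eta> * \<kappa> \<le> 1/2"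
    and S: "S \<subseteq> cube" "\<And>x. x \<notin> S \<Longrightarrow> \<zeta> (\<Phi> x) = 0"
  defines "F \<equiv> \<lambda>t x. \<Psi> (\<Phi> x + (t * W (\<Phi> x) * \<zeta> (\<Phi> x)) *\<^sub>R axis i 1)"
  shows "isotopy F" "\<And>t x. x \<notin> S \<Longrightarrow> F t x = x" "\<And>t x. t \<in> {0..1} \<Longrightarrow> dist (F t x) x \<le> C * \<eta>"
proof -
  show id: "F t x = x" if "x \<notin> S" for t x using S(2)[OF that] by (simp add: F_def \<Phi>)
  have \<eta>0: "\<eta> \<ge> 0" using W(3)[of 0] by linarith
  have L0: "L \<ge> 0"
  proof -
    have "0 \<le> L * dist 0 (axis i 1 :: real^'m)" using W(4)[of 0 "axis i 1"] abs_ge_zero order_trans by blast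
    then show ?thesis by (simp add: norm_axis_1 dist_norm norm_minus_commute)
  qed
  show "dist (F t x) x \<le> C * \<eta>" if t: "t \<in> {0..1}" for t x
  proof -
    have "dist (F t x) x \<le> C * dist (\<Phi> (F t x)) (\<Phi> x)" by (rule C)
    also have "dist (\<Phi> (F t x)) (\<Phi> x) = \<bar>t * W (\<Phi> x) * \<zeta> (\<Phi> x)\<bar>"
      by (simp add: F_def \<Phi> dist_norm norm_axis_1)
    also have "\<dots> \<le> 1 * \<eta> * 1"
      unfolding abs_mult using t W(3) \<zeta>(2,3) \<eta>0 by (intro mult_mono) auto
    finally show ?thesis using C(1) by (simp add: mult_left_mono)
  qed
  have diffeo: "\<exists>G. smooth G \<and> (\<forall>x. G (F t x) = x) \<and> (\<forall>x. F t (G x) = x)" if t: "t \<in> {0..1}" for t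
  proof -
    define sh where "sh x = x + (t * W x * \<zeta> x) *\<^sub>R axis i (1::real)" for x
    have she: "sh = (\<lambda>x. x - (- t * W x) *\<^sub>R (\<zeta> x *\<^sub>R axis i 1))" by (simp add: sh_def[abs_def])
    have ssh: "smooth sh"
      unfolding sh_def[abs_def] by (intro smooth_add smooth_id smooth_scaleR smooth_mult smooth_const W \<zeta>)
    have 1: "- t * W (x + s *\<^sub>R (\<zeta> y *\<^sub>R axis i 1)) = - t * W x" for x y s
      using W(2)[of x "s * \<zeta> y"] by simp
    have 2: "\<bar>- t * W x\<bar> \<le> \<eta>" for x
      using t W(3)[of x] mult_mono[of t 1 "\<bar>W x\<bar>" \<eta>] by (simp add: abs_mult)
    have 3: "dist (\<zeta> x *\<^sub>R (axis i 1 :: real^'m)) (\<zeta> y *\<^sub>R axis i 1) \<le> \<kappa> * dist x y" for x y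
      using \<zeta>(4)[of x y] by (simp add: dist_norm norm_axis_1 flip: scaleR_diff_left)
    have 4: "norm (\<zeta> x *\<^sub>R (axis i 1 :: real^'m)) \<le> 1" for x
      using \<zeta>(2,3)[of x] by (simp add: norm_axis_1)
    have 5: "\<bar>- t * W x - - t * W y\<bar> \<le> L * dist x y" for x y
    proof -
      have "\<bar>- t * W x - - t * W y\<bar> = \<bar>t\<bar> * \<bar>W x - W y\<bar>"
      proof -
        have "- t * W x - - t * W y = t * (W y - W x)" by (simp add: algebra_simps)
        then show ?thesis by (simp only: abs_mult abs_minus_commute[of "W y"])
      qed
      also have "\<dots> \<le> 1 * \<bar>W x - W y\<bar>" using t by (intro mult_right_mono) auto
      finally show ?thesis using W(4)[of x y] by simp
    qed
    note fd = fibred_diffeo[where g = "\<lambda>x. - t * W x" and k = "\<lambda>x. \<zeta> x *\<^sub>R axis i 1", OF 1 2 3 \<zeta>(5) 4 5]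
    have bij: "bij sh" using fd(1) by (simp only: she)
    have e: "dist x y \<le> 2 * (1 + L * 1) * dist (sh x) (sh y)" for x y using fd(2)[of x y] by (simp only: she)
    define shi where "shi = inv sh"
    have si: "sh (shi x) = x" "shi (sh x) = x" for x
      using bij by (auto simp: shi_def bij_def surj_f_inv_f)
    have sshi: "smooth shi" by (rule smooth_inverse_map[OF ssh si e])
    have Fe: "F t x = \<Psi> (sh (\<Phi> x))" for x by (simp add: F_def sh_def)
    have "smooth (\<lambda>x. \<Psi> (shi (\<Phi> x)))" by (intro smooth_compose[OF \<Phi>(2)] smooth_compose[OF sshi] \<Phi>)
    then show ?thesis
      by (intro exI[of _ "\<lambda>x. \<Psi> (shi (\<Phi> x))"]) (simp add: Fe \<Phi> si)
  qed
  have sF: "smooth (\<lambda>p. F (fst p) (snd p))"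
    unfolding F_def
    by (intro smooth_compose[OF \<Phi>(2)] smooth_add smooth_scaleR smooth_mult smooth_const
        smooth_compose[OF W(1)] smooth_compose[OF \<zeta>(1)] smooth_compose[OF \<Phi>(1)]
        smooth_bounded_linear bounded_linear_fst bounded_linear_snd)
  show "isotopy F"
    unfolding isotopy_def
  proof (intro conjI ballI)
    show "smooth_on_set ({0..1} \<times> cube) (\<lambda>(t, x). F t x)"
      unfolding smooth_on_set_def
      by (rule exI[of _ UNIV], rule exI[of _ "\<lambda>p. F (fst p) (snd p)"]) (use sF in auto)
    show "F 0 x = x" for x by (simp add: F_def \<Phi>)
    fix t :: real assume t: "t \<in> {0..1}"
    obtain G where G: "smooth G" "\<And>x. G (F t x) = x" "\<And>x. F t (G x) = x" using diffeo[OF t] by blast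
    have Fc: "F t x \<in> cube \<longleftrightarrow> x \<in> cube" for x
    proof (cases "x \<in> S")
      case True
      \<comment> \<open>An image outside the cube would be a fixed point, and by injectivity equal
        to \<open>x\<close>, which lies in the cube.\<close>
      have "F t x \<in> cube"
      proof (rule ccontr)
        assume "F t x \<notin> cube"
        then have "F t (F t x) = F t x" using id S by blast
        then have "F t x = x" using G(2) by metis
        then show False using True S \<open>F t x \<notin> cube\<close> by auto
      qed
      then show ?thesis using True S by auto
    qed (simp add: id)
    have Gc: "G x \<in> cube \<longleftrightarrow> x \<in> cube" for x using Fc[of "G x"] by (simp add: G)
    show bij: "bij_betw (F t) cube cube"
      by (rule bij_betw_byWitness[where f' = G]) (use G Fc Gc in auto)
    have "inv_into cube (F t) x = G x" if "x \<in> cube" for x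
      using that G Gc by (intro inv_into_f_eq[OF bij_betw_imp_inj_on[OF bij]]) auto
    then show "smooth_on_set cube (inv_into cube (F t))"
      unfolding smooth_on_set_def by (intro exI[of _ UNIV] exI[of _ G]) (use G in auto)
  qed
qed

section \<open>Local data\<close>

lemma smooth_on_continuous: "smooth_on U f \<Longrightarrow> x \<in> U \<Longrightarrow> isCont f x"
  unfolding smooth_on_def by (metis differentiable_imp_continuous_within pdl.simps(1))

lemma smooth_on_set_continuous: "smooth_on_set S f \<Longrightarrow> continuous_on S f"
proof -
  assume "smooth_on_set S f"
  then obtain U g where g: "S \<subseteq> U" "smooth_on U g" "\<And>x. x \<in> S \<Longrightarrow> g x = f x"
    unfolding smooth_on_set_def by blast
  have "continuous_on S g"
    using g smooth_on_continuous by (intro continuous_at_imp_continuous_on) blast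
  then show ?thesis by (rule continuous_on_eq) (use g in auto)
qed

section \<open>Cubes with a margin, and neighbourhoods of the boundary\<close>

text \<open>The parameter is the width of the collar that is removed, so larger values give smaller
  sets.\<close>

definition inner_cube :: "real \<Rightarrow> (real^'m) set" where
  "inner_cube \<rho> = {x. \<forall>i. \<bar>x $ i\<bar> \<le> 1 - \<rho>}"

lemma cube_cbox: "(cube :: (real^'m) set) = cbox (\<chi> i. -1) (\<chi> i. 1)"
  by (auto simp: cube_def mem_box_cart abs_le_iff minus_le_iff)

lemma compact_cube: "compact (cube :: (real^'m) set)"
  by (simp add: cube_cbox)

lemma compact_inner_cube: "compact (inner_cube \<rho> :: (real^'m) set)"
proof -
  have "inner_cube \<rho> = cbox (\<chi> i::'m. - (1 - \<rho>)) (\<chi> i. 1 - \<rho>)"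
  proof -
    have "\<bar>a\<bar> \<le> 1 - \<rho> \<longleftrightarrow> - (1 - \<rho>) \<le> a \<and> a \<le> 1 - \<rho>" for a :: real by linarith
    then show ?thesis
      unfolding inner_cube_def set_eq_iff mem_box_cart mem_Collect_eq vec_lambda_beta by blast
  qed
  then show ?thesis by (simp only: compact_cbox)
qed

lemma inner_cube_subset: "\<rho> \<ge> 0 \<Longrightarrow> inner_cube \<rho> \<subseteq> cube"
  unfolding inner_cube_def cube_def by (auto intro: order_trans)

lemma inner_cube_mono: "a \<le> b \<Longrightarrow> inner_cube b \<subseteq> inner_cube a"
  unfolding inner_cube_def by (auto intro: order_trans)

lemma frontier_cube: "frontier (cube :: (real^'m) set) = {x \<in> cube. \<exists>i. \<bar>x $ i\<bar> = 1}"
proof -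
  have "frontier (cube :: (real^'m) set) = cube - box (\<chi> i. -1) (\<chi> i. 1)"
    unfolding cube_cbox by (rule frontier_cbox)
  also have "\<dots> = {x \<in> cube. \<exists>i. \<bar>x $ i\<bar> = 1}"
  proof -
    have "x \<in> box (\<chi> i. -1) (\<chi> i. 1) \<longleftrightarrow> (\<forall>i. \<bar>x $ i\<bar> \<noteq> 1)" if "x \<in> cube" for x :: "real^'m"
    proof -
      have "- 1 < x $ i \<and> x $ i < 1 \<longleftrightarrow> \<bar>x $ i\<bar> \<noteq> 1" for i
        using that[unfolded cube_def, simplified, rule_format, of i] by linarith
      then show ?thesis by (simp add: mem_box_cart)
    qed
    then show ?thesis by blast
  qed
  finally show ?thesis .
qed

lemma inner_cube_dist:
  assumes "p \<in> inner_cube a" "x \<notin> inner_cube b" shows "a - b < dist p (x :: real^'m)"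
proof -
  obtain i where i: "\<bar>x $ i\<bar> > 1 - b" using assms(2) by (auto simp: inner_cube_def not_le)
  have "\<bar>p $ i\<bar> \<le> 1 - a" using assms(1) by (simp add: inner_cube_def)
  then have "a - b < \<bar>(p - x) $ i\<bar>" using i by simp
  also have "\<dots> \<le> dist p x" unfolding dist_norm by (rule component_le_norm_cart)
  finally show ?thesis .
qed

text \<open>A neighbourhood of the compact boundary contains a uniform collar: a point with one
  coordinate near 1 or -1 becomes a boundary point when that coordinate is pushed all the way.
  Capping the width by 1 keeps that coordinate nonzero, so its sign is defined.\<close>

lemma ex_inner_cube:
  assumes "open W" "frontier cube \<subseteq> W"
  obtains \<rho> where "0 < \<rho>" "\<And>x::real^'m. x \<in> cube \<Longrightarrow> x \<notin> inner_cube \<rho> \<Longrightarrow> x \<in> W"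
proof -
  have "compact (frontier (cube :: (real^'m) set))"
    by (intro compact_frontier_bounded compact_imp_bounded compact_cube)
  then obtain e where e: "e > 0" "(\<Union>x\<in>frontier cube. ball x e) \<subseteq> W"
    using compact_subset_open_imp_ball_epsilon_subset assms by metis
  show thesis
  proof (rule that[of "min e 1"])
    show "min e 1 > 0" using e by simp
    fix x :: "real^'m" assume x: "x \<in> cube" "x \<notin> inner_cube (min e 1)"
    then obtain i where i: "\<bar>x $ i\<bar> > 1 - min e 1" by (auto simp: inner_cube_def not_le)
    have xi: "\<bar>x $ i\<bar> \<le> 1" using x by (simp add: cube_def)
    define x' where "x' = x + (sgn (x $ i) - x $ i) *\<^sub>R axis i 1"
    have "x $ i \<noteq> 0" using i by auto
    then have x'i: "\<bar>x' $ i\<bar> = 1" by (simp add: x'_def sgn_if)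
    have x'j: "x' $ j = x $ j" if "j \<noteq> i" for j using that by (simp add: x'_def axis_def)
    have "\<bar>x' $ j\<bar> \<le> 1" for j using x'i x'j[of j] x(1) by (cases "j = i") (auto simp: cube_def)
    then have "x' \<in> cube" by (simp add: cube_def)
    then have "x' \<in> frontier cube" using x'i by (auto simp: frontier_cube)
    moreover have "dist x' x < e"
    proof -
      have "dist x' x = \<bar>sgn (x $ i) - x $ i\<bar>" by (simp add: x'_def dist_norm norm_axis_1)
      also have "\<dots> = 1 - \<bar>x $ i\<bar>" using xi \<open>x $ i \<noteq> 0\<close> by (auto simp: sgn_if abs_if split: if_splits)
      finally show ?thesis using i by linarith
    qed
    ultimately have "x \<in> (\<Union>x\<in>frontier cube. ball x e)" by (intro UN_I[of x']) simp_all
    then show "x \<in> W" using e(2) by (rule subsetD[rotated])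
  qed
qed

lemma power_approximation_nearby:
  fixes t :: "real^'m::finite \<Rightarrow> real^'m" and \<sigma> :: "('m, 'n::finite) jet_section"
  assumes \<sigma>: "\<And>\<alpha>. size \<alpha> = r \<Longrightarrow> continuous_on cube (\<lambda>x. \<sigma> x \<alpha>)" and t: "isCont t p" and p: "p \<in> cube"
    and g: "\<And>\<alpha>. size \<alpha> = r \<Longrightarrow> norm (mon (t p) \<alpha> *\<^sub>R c - \<sigma> p \<alpha>) < \<epsilon>"
  shows "\<exists>e>0. \<forall>q\<in>cube. dist p q < e \<longrightarrow> (\<forall>\<alpha>. size \<alpha> = r \<longrightarrow> norm (mon (t q) \<alpha> *\<^sub>R c - \<sigma> q \<alpha>) < \<epsilon>)"
proof -
  have "\<forall>\<^sub>F q in at p within cube. norm (mon (t q) \<alpha> *\<^sub>R c - \<sigma> q \<alpha>) < \<epsilon>" if "size \<alpha> = r" for \<alpha>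
  proof (rule order_tendstoD(2)[OF _ g[OF that]])
    have "(t \<longlongrightarrow> t p) (at p within cube)"
      using t continuous_at_imp_continuous_at_within continuous_within by blast
    moreover have "((\<lambda>q. \<sigma> q \<alpha>) \<longlongrightarrow> \<sigma> p \<alpha>) (at p within cube)"
      using \<sigma>[OF that] p by (simp add: continuous_on)
    ultimately show "((\<lambda>q. norm (mon (t q) \<alpha> *\<^sub>R c - \<sigma> q \<alpha>)) \<longlongrightarrow> norm (mon (t p) \<alpha> *\<^sub>R c - \<sigma> p \<alpha>)) (at p within cube)"
      by (intro tendsto_intros tendsto_mon)
  qed
  then have "\<forall>\<^sub>F q in at p within cube. \<forall>\<alpha>\<in>{\<alpha>. size \<alpha> = r}. norm (mon (t q) \<alpha> *\<^sub>R c - \<sigma> q \<alpha>) < \<epsilon>"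
    by (intro eventually_ball_finite finite_multisets_of_size) blast
  then have "\<exists>e>0. \<forall>q\<in>cube. q \<noteq> p \<and> dist q p < e \<longrightarrow>
      (\<forall>\<alpha>\<in>{\<alpha>. size \<alpha> = r}. norm (mon (t q) \<alpha> *\<^sub>R c - \<sigma> q \<alpha>) < \<epsilon>)"
    by (simp only: eventually_at)
  then show ?thesis
  proof (elim exE conjE, intro exI conjI ballI impI allI)
    fix e q \<alpha>
    assume e: "\<forall>q\<in>cube. q \<noteq> p \<and> dist q p < e \<longrightarrow>
      (\<forall>\<alpha>\<in>{\<alpha>. size \<alpha> = r}. norm (mon (t q) \<alpha> *\<^sub>R c - \<sigma> q \<alpha>) < \<epsilon>)"
      and q: "q \<in> cube" "dist p q < e" "size (\<alpha> :: 'm multiset) = r"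
    show "norm (mon (t q) \<alpha> *\<^sub>R c - \<sigma> q \<alpha>) < \<epsilon>"
    proof (cases "q = p")
      case False
      then have "q \<noteq> p \<and> dist q p < e" using q by (simp add: dist_commute)
      from e[rule_format, OF q(1) this] show ?thesis using q(3) by simp
    qed (use g q in simp)
  qed
qed

section \<open>Normals of the field, their horizontal parts and transverse directions\<close>

lemma hyperplane_field_normal:
  assumes "smooth_hyperplane_field \<tau>" "x \<in> cube"
  obtains n i where "\<tau> x = {v. n \<bullet> v = 0}" "n $ i = 1" "\<And>k. \<bar>n $ k\<bar> \<le> 1"
proof -
  obtain V N where N: "open V \<and> x \<in> V \<and> smooth_on V N \<and> (\<forall>y\<in>V. N y \<noteq> 0) \<and> (\<forall>y\<in>V \<inter> cube. \<tau> y = {v. N y \<bullet> v = 0})"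
    using assms(1)[unfolded smooth_hyperplane_field_def, rule_format, OF assms(2)] by (elim exE)
  then have "N x \<noteq> 0" by blast
  then obtain c i where c: "c \<noteq> 0" "(c *\<^sub>R N x) $ i = 1" "\<And>k. \<bar>(c *\<^sub>R N x) $ k\<bar> \<le> 1"
    using sup_normalized[of "N x"] by blast
  show thesis by (rule that[of "c *\<^sub>R N x" i]) (use N assms(2) c in auto)
qed

text \<open>The normalized normals are chosen pointwise and may jump, so the estimate is made for
  all of them. For the local smooth normal \<open>N\<close> it is the inequality
  \<open>\<bar>N q \<bullet> w\<bar> < \<eta> * \<bar>N q $ i\<bar>\<close>, which is open in
  \<open>q\<close> and invariant under scaling of \<open>N q\<close>.\<close>

lemma hyperplane_field_nearby:
  fixes \<tau> :: "real^'m::finite \<Rightarrow> (real^'m) set"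
  assumes "smooth_hyperplane_field \<tau>" "p \<in> cube" "w \<in> \<tau> p" "\<eta> > 0"
  shows "\<exists>e>0. \<forall>q\<in>cube. dist p q < e \<longrightarrow>
    (\<forall>n. \<tau> q = {v. n \<bullet> v = 0} \<and> (\<forall>k. \<bar>n $ k\<bar> \<le> 1) \<longrightarrow> \<bar>n \<bullet> w\<bar> \<le> \<eta>)"
proof -
  obtain V N where VN: "open V \<and> p \<in> V \<and> smooth_on V N \<and> (\<forall>y\<in>V. N y \<noteq> 0) \<and> (\<forall>y\<in>V \<inter> cube. \<tau> y = {v. N y \<bullet> v = 0})"
    using assms(1)[unfolded smooth_hyperplane_field_def, rule_format, OF assms(2)] by (elim exE)
  then have V: "open V" "p \<in> V" "smooth_on V N" "y \<in> V \<Longrightarrow> N y \<noteq> 0"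
    and N: "y \<in> V \<inter> cube \<Longrightarrow> \<tau> y = {v. N y \<bullet> v = 0}" for y
    by blast+
  obtain i where i: "N p $ i \<noteq> 0" using V(4)[OF V(2)] by (auto simp: vec_eq_iff)
  have cN: "isCont N p" using smooth_on_continuous V by blast
  define f where "f q = \<eta> * \<bar>N q $ i\<bar> - \<bar>N q \<bullet> w\<bar>" for q
  have "isCont f p"
    unfolding f_def[abs_def] by (intro continuous_intros cN)
  then have "(f \<longlongrightarrow> f p) (nhds p)" unfolding isCont_def tendsto_at_iff_tendsto_nhds .
  moreover have "f p > 0"
    using N[of p] V(2) assms i by (simp add: f_def)
  ultimately have "\<forall>\<^sub>F q in nhds p. \<eta> * \<bar>N q $ i\<bar> - \<bar>N q \<bullet> w\<bar> > 0"
    unfolding f_def[symmetric] by (rule order_tendstoD(1))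
  moreover have "\<forall>\<^sub>F q in nhds p. q \<in> V" using V eventually_nhds_in_open by blast
  ultimately have "\<forall>\<^sub>F q in nhds p. \<eta> * \<bar>N q $ i\<bar> - \<bar>N q \<bullet> w\<bar> > 0 \<and> q \<in> V" by (rule eventually_conj)
  then obtain e where e: "e > 0" "\<And>q. dist q p < e \<Longrightarrow> \<eta> * \<bar>N q $ i\<bar> - \<bar>N q \<bullet> w\<bar> > 0 \<and> q \<in> V"
    unfolding eventually_nhds_metric by blast
  show ?thesis
  proof (intro exI[of _ e] conjI ballI impI allI)
    fix q n assume q: "q \<in> cube" "dist p q < e" and n: "\<tau> q = {v. n \<bullet> v = 0} \<and> (\<forall>k. \<bar>n $ k\<bar> \<le> 1)"
    have eq: "\<eta> * \<bar>N q $ i\<bar> > \<bar>N q \<bullet> w\<bar>" "q \<in> V" using e(2)[of q] q by (auto simp: dist_commute)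
    have "{v. n \<bullet> v = 0} = {v. N q \<bullet> v = 0}" using n N[of q] q eq by auto
    then obtain c where c: "n = c *\<^sub>R N q" using same_kernel_parallel[of n "N q"] V(4)[OF eq(2)] by blast
    have "\<bar>n \<bullet> w\<bar> = \<bar>c\<bar> * \<bar>N q \<bullet> w\<bar>" by (simp add: c abs_mult)
    also have "\<dots> \<le> \<bar>c\<bar> * (\<eta> * \<bar>N q $ i\<bar>)" using eq by (intro mult_left_mono) auto
    also have "\<dots> = \<eta> * \<bar>n $ i\<bar>" by (simp add: c abs_mult)
    also have "\<dots> \<le> \<eta> * 1" using n assms(4) by (intro mult_left_mono) auto
    finally show "\<bar>n \<bullet> w\<bar> \<le> \<eta>" by simp
  qed (rule e)
qed

definition hor :: "'m \<Rightarrow> real^'m \<Rightarrow> real^'m" where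
  "hor i n = n - n $ i *\<^sub>R axis i 1"

text \<open>\<open>tilt i n + axis i 1\<close> lies in the kernel of \<open>n\<close>, except for vertical \<open>n\<close>, where the division by zero
  makes \<open>tilt i n\<close> zero.\<close>

definition tilt :: "'m \<Rightarrow> real^'m \<Rightarrow> real^'m" where
  "tilt i n = - (n $ i / (hor i n \<bullet> hor i n)) *\<^sub>R hor i n"

lemma hor_component [simp]: "hor i n $ i = 0"
  by (simp add: hor_def)

lemma hor_inner: "b $ i = 0 \<Longrightarrow> hor i n \<bullet> b = n \<bullet> b"
  by (simp add: hor_def inner_diff_left inner_axis')

lemma tilt_component [simp]: "tilt i n $ i = 0"
  by (simp add: tilt_def)

lemma tilt_kernel:
  assumes "hor i n \<noteq> 0" shows "n \<bullet> (tilt i n + axis i 1) = 0"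
proof -
  have "hor i n \<bullet> hor i n \<noteq> 0" using assms by simp
  moreover have "n \<bullet> hor i n = hor i n \<bullet> hor i n" by (simp add: hor_inner)
  ultimately show ?thesis by (simp add: tilt_def inner_add_right inner_diff_right inner_axis del: inner_eq_zero_iff)
qed

text \<open>The vector inside \<open>mon\<close> is the gradient of
  \<open>hor i n \<bullet> \<Phi> x\<close> at a point of the hyperplane, where
  \<open>\<Phi>\<close> has derivative \<open>v - v $ i *\<^sub>R b\<close>. It equals
  \<open>n\<close> in all entries but the i-th; there it is \<open>- (n \<bullet> b)\<close>, which
  differs from \<open>n $ i\<close> by \<open>n \<bullet> (b + axis i 1)\<close> up to sign.\<close>

lemma horizontal_perturbation:
  fixes c :: "'b::real_normed_vector"
  assumes n: "\<And>k. \<bar>n $ k\<bar> \<le> 1" and b: "b $ i = 0" "\<bar>n \<bullet> (b + axis i 1)\<bar> \<le> \<eta>" "\<eta> \<le> 1"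
  shows "norm (mon (\<chi> k. hor i n \<bullet> (axis k 1 - axis k 1 $ i *\<^sub>R b)) \<alpha> *\<^sub>R c - mon n \<alpha> *\<^sub>R c)
    \<le> real (size \<alpha>) * 2 ^ size \<alpha> * \<eta> * norm c"
proof -
  have "\<bar>(\<chi> k. hor i n \<bullet> (axis k 1 - axis k 1 $ i *\<^sub>R b)) $ k - n $ k\<bar> \<le> \<eta>" for k
  proof (cases "k = i")
    case True
    then show ?thesis using b(1,2) hor_inner[OF b(1), of n]
      by (simp add: inner_diff_right inner_add_right inner_axis abs_minus_commute)
  next
    case False
    then have "hor i n $ k = n $ k" by (simp add: hor_def axis_def)
    then show ?thesis using False b(2) abs_ge_zero order_trans
      by (auto simp: inner_diff_right inner_axis) (auto simp: axis_def)
  qed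
  from mon_diff[OF n this b(3), of \<alpha>] show ?thesis
    by (simp add: mult_right_mono flip: scaleR_diff_left)
qed

section \<open>Holonomic approximation\<close>

definition grad :: "(real^'m \<Rightarrow> real) \<Rightarrow> real^'m \<Rightarrow> real^'m" where
  "grad f x = (\<chi> k. frechet_derivative f (at x) (axis k 1))"

lemma isCont_grad: "smooth f \<Longrightarrow> isCont (grad f) x"
proof -
  assume "smooth f"
  then have "smooth (grad f)"
    unfolding grad_def[abs_def] by (intro smooth_vec_lambda smooth_derivative)
  then show ?thesis
    using smooth_continuous[of "grad f" UNIV] by (simp add: continuous_on_eq_continuous_at)
qed

lemma grad_component: "grad (\<lambda>x. x $ i) x = axis i 1"
  by (simp add: grad_def frechet_derivative_component vec_eq_iff axis_def)

lemma mon_grad: "mset l = \<alpha> \<Longrightarrow> (\<Prod>v\<leftarrow>map (\<lambda>i. axis i 1) l. frechet_derivative f (at x) v) = mon (grad f x) \<alpha>"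
  by (auto simp: mon_mset[symmetric] grad_def mon_mset o_def)

lemma choose_radii:
  assumes "\<And>p. p \<in> D \<Longrightarrow> \<exists>e>0. \<forall>q\<in>A. dist p q < e \<longrightarrow> Q p q" "b > 0"
  obtains \<rho> where "\<And>p. p \<in> D \<Longrightarrow> 0 < \<rho> p" "\<And>p. p \<in> D \<Longrightarrow> \<rho> p \<le> (b::real)"
    "\<And>p q. p \<in> D \<Longrightarrow> q \<in> A \<Longrightarrow> dist p q < \<rho> p \<Longrightarrow> Q p q"
proof -
  have "\<forall>p\<in>D. \<exists>e>0. \<forall>q\<in>A. dist p q < e \<longrightarrow> Q p q" using assms(1) by blast
  from bchoice[OF this] obtain f where f: "\<forall>p\<in>D. f p > 0 \<and> (\<forall>q\<in>A. dist p q < f p \<longrightarrow> Q p q)" by blast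
  show thesis by (rule that[of "\<lambda>p. min (f p) b"]) (use f assms(2) in auto)
qed

text \<open>The points of the hyperplane are split according to whether \<open>\<sigma>\<close> is close to a power of the vertical
  covector. At the remaining points the kernel of the normal contains a vector transverse to the hyperplane;
  these vectors are averaged to a field, which is straightened.\<close>

lemma ex_phases:
  fixes \<tau> :: "real^'m::finite \<Rightarrow> (real^'m) set" and \<sigma> :: "('m, 'n::finite) jet_section"
  assumes \<tau>: "smooth_hyperplane_field \<tau>"
    and \<sigma>: "\<And>\<alpha>. size \<alpha> = r \<Longrightarrow> continuous_on cube (\<lambda>x. \<sigma> x \<alpha>)"
    and perp: "\<And>x. x \<in> cube \<Longrightarrow> perp_zero_at r \<tau> \<sigma> x"
    and r: "r \<ge> 1" and \<rho>: "\<rho> > 0" and \<epsilon>: "\<epsilon> > 0"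
  obtains \<Phi> \<Psi> :: "real^'m \<Rightarrow> real^'m" and C :: real and J K :: "(real^'m) set"
    and \<phi> :: "real^'m \<Rightarrow> real^'m \<Rightarrow> real" and c \<theta> a O'
  where "smooth \<Phi>" "smooth \<Psi>"
    "\<forall>x. \<Phi> (\<Psi> x) = x" "\<forall>x. \<Psi> (\<Phi> x) = x" "\<forall>x. \<Phi> x $ i = x $ i"
    "\<forall>x. x \<notin> inner_cube (\<rho>/2) \<longrightarrow> \<Phi> x = x" "\<forall>x. x $ i = 0 \<longrightarrow> \<Phi> x = x"
    "C > 0" "\<forall>x y. dist x y \<le> C * dist (\<Phi> x) (\<Phi> y)"
    "finite J" "finite K" "J \<inter> K = {}"
    "\<forall>p\<in>J. \<theta> p = (\<lambda>x. x $ i)" "\<forall>p\<in>K. \<theta> p = (\<lambda>x. a p \<bullet> \<Phi> x)" "\<forall>p\<in>K. a p $ i = 0"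
    "\<forall>p\<in>J \<union> K. smooth (\<phi> p)" "\<forall>p\<in>J \<union> K. \<forall>x. 0 \<le> \<phi> p x"
    "\<forall>p\<in>J \<union> K. \<forall>x. x \<notin> inner_cube (\<rho>/2) \<longrightarrow> \<phi> p x = 0" "\<forall>x. (\<Sum>p\<in>J \<union> K. \<phi> p x) \<le> 1"
    "open O'" "{x \<in> inner_cube \<rho>. x $ i = 0} \<subseteq> O'" "\<forall>x\<in>O'. (\<Sum>p\<in>J \<union> K. \<phi> p x) = 1"
    "\<forall>p\<in>J \<union> K. \<forall>x\<in>cube. \<phi> p x \<noteq> 0 \<longrightarrow>
      (\<forall>\<alpha>. size \<alpha> = r \<longrightarrow> norm (mon (grad (\<theta> p) x) \<alpha> *\<^sub>R (c p :: real^'n) - \<sigma> x \<alpha>) \<le> \<epsilon>)"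
proof -
  define D where "D = {x::real^'m. x \<in> inner_cube \<rho> \<and> x $ i = 0}"
  have Dcube: "p \<in> cube" if "p \<in> D" for p
    using that inner_cube_subset[of \<rho>] \<rho> by (auto simp: D_def)
  have cD: "compact D"
  proof -
    have "D = inner_cube \<rho> \<inter> {x. x $ i = 0}" by (auto simp: D_def)
    moreover have "closed {x::real^'m. x $ i = 0}" by (intro closed_Collect_eq continuous_intros)
    ultimately show ?thesis using compact_inner_cube compact_Int_closed by metis
  qed
  have "\<forall>x\<in>cube. \<exists>n j. \<tau> x = {v. n \<bullet> v = 0} \<and> n $ j = 1 \<and> (\<forall>k. \<bar>n $ k\<bar> \<le> 1)"
    using hyperplane_field_normal[OF \<tau>] by metis
  then obtain n j where n: "\<And>x. x \<in> cube \<Longrightarrow> \<tau> x = {v. n x \<bullet> v = 0}"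
      "\<And>x. x \<in> cube \<Longrightarrow> n x $ j x = 1" "\<And>x k. x \<in> cube \<Longrightarrow> \<bar>n x $ k\<bar> \<le> 1"
    by metis
  \<comment> \<open>The normal has entry one at \<open>j x\<close>, so the factor of its r-th power
    is this entry of the jet. It is bounded on the cube even though \<open>n\<close> and
    \<open>j\<close> are not continuous.\<close>
  define c0 where "c0 x = \<sigma> x (replicate_mset r (j x))" for x
  have struct: "\<sigma> x \<alpha> = mon (n x) \<alpha> *\<^sub>R c0 x" if x: "x \<in> cube" and \<alpha>: "size \<alpha> = r" for x \<alpha>
    unfolding c0_def
  proof (rule jet_structure[OF r n(2)[OF x] _ \<alpha>])
    fix \<beta> \<nu> assume "size (\<beta> :: 'm multiset) = r - 1" "n x \<bullet> \<nu> = 0"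
    then show "(\<Sum>k\<in>UNIV. (\<nu> $ k) *\<^sub>R \<sigma> x (add_mset k \<beta>)) = 0"
      using perp[OF x] n(1)[OF x] by (auto simp: perp_zero_at_def jet_dir_def)
  qed
  have "\<exists>M. \<forall>x\<in>cube. norm (\<sigma> x (replicate_mset r k)) \<le> M" for k
  proof -
    have "compact ((\<lambda>x. \<sigma> x (replicate_mset r k)) ` cube)"
      by (intro compact_continuous_image \<sigma> compact_cube) simp
    then obtain M where "\<forall>y\<in>(\<lambda>x. \<sigma> x (replicate_mset r k)) ` cube. norm y \<le> M"
      using compact_imp_bounded bounded_iff by blast
    then show ?thesis by blast
  qed
  then obtain Mk where Mk: "\<And>k x. x \<in> cube \<Longrightarrow> norm (\<sigma> x (replicate_mset r k)) \<le> Mk k" by metis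
  define M where "M = (\<Sum>k\<in>UNIV. max 0 (Mk k))"
  have M: "norm (c0 x) \<le> M" if "x \<in> cube" for x
  proof -
    have "max 0 (Mk (j x)) \<le> M" unfolding M_def by (rule member_le_sum) auto
    then show ?thesis using Mk[OF that, of "j x"] by (simp add: c0_def)
  qed
  have M0: "M \<ge> 0" unfolding M_def by (intro sum_nonneg) auto
  define Q where "Q = real r * 2 ^ r * M"
  have Q0: "Q \<ge> 0" using M0 by (simp add: Q_def)
  \<comment> \<open>\<open>Q\<close> converts a deviation of the covector into a deviation of the
    r-th order jet, so \<open>Q * \<eta>\<close> has to stay below \<open>\<epsilon>\<close>; the
    added 1 guards the division.\<close>
  define \<eta> where "\<eta> = min 1 (\<epsilon> / (2 * (Q + 1)))"
  have \<eta>: "\<eta> > 0" "\<eta> \<le> 1" using \<epsilon> Q0 by (auto simp: \<eta>_def)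
  have Q\<eta>: "Q * \<eta> < \<epsilon>"
  proof -
    have "Q * \<eta> \<le> (Q + 1) * (\<epsilon> / (2 * (Q + 1)))"
      using Q0 \<eta>(1) by (intro mult_mono) (auto simp: \<eta>_def)
    also have "\<dots> = \<epsilon> / 2" using Q0 by (simp add: field_simps)
    finally show ?thesis using \<epsilon> by simp
  qed
  define good where "good p t c \<longleftrightarrow> (\<forall>\<alpha>. size \<alpha> = r \<longrightarrow> norm (mon t \<alpha> *\<^sub>R c - \<sigma> p \<alpha>) < \<epsilon>)" for p t c
  have nearby: "\<exists>e>0. \<forall>q\<in>cube. dist p q < e \<longrightarrow> good q (t q) c" if "isCont t p" "p \<in> cube" "good p (t p) c" for t p c
    unfolding good_def
    by (rule power_approximation_nearby[OF \<sigma> that(1,2)]) (use that(3) in \<open>simp_all add: good_def\<close>)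
  \<comment> \<open>The test is made on \<open>\<sigma>\<close> and not on the field itself. It is
    an open condition within \<open>D\<close>, so the remaining points form a compact set; where
    \<open>\<sigma>\<close> is small it holds with \<open>c = 0\<close>.\<close>
  define Dv where "Dv = {p \<in> D. \<exists>c. good p (axis i 1) c}"
  define Dn where "Dn = D - Dv"
  have cDn: "compact Dn"
  proof -
    have "\<forall>p\<in>Dv. \<exists>e>0. \<forall>q\<in>cube. dist p q < e \<longrightarrow> (\<exists>c. good q (axis i 1) c)"
    proof
      fix p assume "p \<in> Dv"
      then obtain c where "good p (axis i 1) c" "p \<in> D" by (auto simp: Dv_def)
      then have "\<exists>e>0. \<forall>q\<in>cube. dist p q < e \<longrightarrow> good q (axis i 1) c"
        using nearby[where t = "\<lambda>_. axis i 1" and p = p and c = c] Dcube by simp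
      then show "\<exists>e>0. \<forall>q\<in>cube. dist p q < e \<longrightarrow> (\<exists>c. good q (axis i 1) c)" by blast
    qed
    from bchoice[OF this] obtain f where f: "\<forall>p\<in>Dv. f p > 0 \<and> (\<forall>q\<in>cube. dist p q < f p \<longrightarrow> (\<exists>c. good q (axis i 1) c))"
      by blast
    have "Dn = D - (\<Union>p\<in>Dv. ball p (f p))"
    proof
      show "Dn \<subseteq> D - (\<Union>p\<in>Dv. ball p (f p))"
      proof
        fix q assume q: "q \<in> Dn"
        then have "\<not> (\<exists>c. good q (axis i 1) c)" "q \<in> D" by (auto simp: Dn_def Dv_def)
        moreover from this have "q \<notin> ball p (f p)" if "p \<in> Dv" for p
          using f[rule_format, OF that] Dcube[of q] unfolding mem_ball by blast
        ultimately show "q \<in> D - (\<Union>p\<in>Dv. ball p (f p))" by blast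
      qed
      show "D - (\<Union>p\<in>Dv. ball p (f p)) \<subseteq> Dn" using f by (auto simp: Dn_def)
    qed
    then show ?thesis using cD by (auto intro!: compact_diff)
  qed
  \<comment> \<open>A normalized vertical normal can only be \<open>axis i 1\<close>, and then
    \<open>\<sigma> p\<close> is an exact multiple of its power.\<close>
  have hor0: "hor i (n p) \<noteq> 0" if p: "p \<in> Dn" for p
  proof
    assume h0: "hor i (n p) = 0"
    have pc: "p \<in> cube" using p Dcube by (simp add: Dn_def)
    have e: "n p = n p $ i *\<^sub>R axis i 1" using h0 by (simp add: hor_def)
    have "(n p $ i *\<^sub>R axis i 1) $ j p = (1::real)" using n(2)[OF pc] arg_cong[OF e, of "\<lambda>v. v $ j p"] by (rule trans[OF sym, rotated])
    then have "j p = i" by (auto simp: axis_def split: if_splits)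
    then have "n p = axis i 1" using n(2)[OF pc] e by simp
    then have "good p (axis i 1) (c0 p)" using struct[OF pc] \<epsilon> by (simp add: good_def)
    then show False using p by (auto simp: Dn_def Dv_def)
  qed
  define w where "w p = tilt i (n p)" for p
  have "\<exists>e>0. \<forall>q\<in>cube. dist p q < e \<longrightarrow> \<bar>n q \<bullet> (w p + axis i 1)\<bar> \<le> \<eta>" if p: "p \<in> Dn" for p
  proof -
    have pc: "p \<in> cube" using p Dcube by (simp add: Dn_def)
    have "w p + axis i 1 \<in> \<tau> p" using n(1)[OF pc] tilt_kernel[OF hor0[OF p]] by (simp add: w_def)
    from hyperplane_field_nearby[OF \<tau> pc this \<eta>(1)] show ?thesis
    proof (elim exE conjE, intro exI conjI ballI impI)
      fix e q
      assume e: "\<forall>q\<in>cube. dist p q < e \<longrightarrow>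
          (\<forall>n. \<tau> q = {v. n \<bullet> v = 0} \<and> (\<forall>k. \<bar>n $ k\<bar> \<le> 1) \<longrightarrow> \<bar>n \<bullet> (w p + axis i 1)\<bar> \<le> \<eta>)"
        and q: "q \<in> cube" "dist p q < e"
      show "\<bar>n q \<bullet> (w p + axis i 1)\<bar> \<le> \<eta>"
        by (rule e[rule_format, OF q]) (use n[OF q(1)] in simp)
    qed
  qed
  then obtain \<rho>1 where \<rho>1: "\<And>p. p \<in> Dn \<Longrightarrow> 0 < \<rho>1 p" "\<And>p. p \<in> Dn \<Longrightarrow> \<rho>1 p \<le> \<rho>/2"
    "\<And>p q. p \<in> Dn \<Longrightarrow> q \<in> cube \<Longrightarrow> dist p q < \<rho>1 p \<Longrightarrow> \<bar>n q \<bullet> (w p + axis i 1)\<bar> \<le> \<eta>"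
    using choose_radii[of Dn cube "\<lambda>p q. \<bar>n q \<bullet> (w p + axis i 1)\<bar> \<le> \<eta>" "\<rho>/2"] \<rho> half_gt_zero by blast
  obtain P1 and \<psi> :: "real^'m \<Rightarrow> real^'m \<Rightarrow> real" and O1 where P10: "finite P1" "P1 \<subseteq> Dn" "\<forall>p\<in>P1. smooth (\<psi> p)"
    "\<forall>p\<in>P1. \<forall>x. 0 \<le> \<psi> p x" "\<forall>p\<in>P1. \<forall>x. dist p x \<ge> \<rho>1 p \<longrightarrow> \<psi> p x = 0"
    "\<forall>x. (\<Sum>p\<in>P1. \<psi> p x) \<le> 1" "open O1" "Dn \<subseteq> O1" "\<forall>x\<in>O1. (\<Sum>p\<in>P1. \<psi> p x) = 1"
    by (rule compact_partition_of_unity[OF cDn \<rho>1(1)])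
  note P1 = P10[rule_format]
  define b where "b x = (\<Sum>p\<in>P1. \<psi> p x *\<^sub>R w p)" for x
  \<comment> \<open>All radii are capped by half the margin, which keeps every support inside
    \<open>inner_cube (\<rho>/2)\<close>.\<close>
  have far: "\<rho>/2 \<le> dist p x" if "p \<in> D" "x \<notin> inner_cube (\<rho>/2)" for p x
    using inner_cube_dist[of p \<rho> x "\<rho>/2"] that by (simp add: D_def)
  have sb: "smooth b" unfolding b_def[abs_def] by (intro smooth_sum smooth_scaleR smooth_const P1)
  have bi: "b x $ i = 0" for x by (simp add: b_def w_def)
  have b0: "b x = 0" if "x \<notin> inner_cube (\<rho>/2)" for x
    unfolding b_def
  proof (rule sum.neutral, rule ballI)
    fix p assume p: "p \<in> P1"
    then have "p \<in> Dn" "p \<in> D" using P1(2) by (auto simp: Dn_def)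
    then have "\<rho>1 p \<le> dist p x" using \<rho>1(2)[of p] far[of p x] that by linarith
    then show "\<psi> p x *\<^sub>R w p = 0" using P1(5)[OF p] by simp
  qed
  \<comment> \<open>The averaged vectors all have vertical component one and satisfy this bound
    wherever their weight is nonzero, and the bound is preserved by convex combinations.\<close>
  have bn: "\<bar>n q \<bullet> (b q + axis i 1)\<bar> \<le> \<eta>" if q: "q \<in> Dn" for q
  proof -
    have qc: "q \<in> cube" using q Dcube by (simp add: Dn_def)
    have s1: "(\<Sum>p\<in>P1. \<psi> p q) = 1" using P1(8,9) q by blast
    have "b q + axis i 1 = (\<Sum>p\<in>P1. \<psi> p q *\<^sub>R (w p + axis i 1))"
      by (simp add: b_def scaleR_add_right sum.distrib s1 flip: scaleR_sum_left)
    then have "n q \<bullet> (b q + axis i 1) = (\<Sum>p\<in>P1. \<psi> p q * (n q \<bullet> (w p + axis i 1)))"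
      by (simp add: inner_sum_right)
    also have "\<bar>\<dots>\<bar> \<le> (\<Sum>p\<in>P1. \<psi> p q * \<eta>)"
    proof (rule order_trans[OF sum_abs], rule sum_mono)
      fix p assume p: "p \<in> P1"
      have "p \<in> Dn" using p P1(2) by blast
      show "\<bar>\<psi> p q * (n q \<bullet> (w p + axis i 1))\<bar> \<le> \<psi> p q * \<eta>"
      proof (cases "dist p q < \<rho>1 p")
        case True
        from \<rho>1(3)[OF \<open>p \<in> Dn\<close> qc this] show ?thesis
          using P1(4)[OF p, of q] by (simp add: abs_mult mult_left_mono)
      qed (use P1(5)[OF p, of q] in simp)
    qed
    also have "\<dots> = \<eta>" by (simp add: s1 flip: sum_distrib_right)
    finally show ?thesis .
  qed
  obtain \<Phi> \<Psi> and C :: real where \<Phi>0: "smooth \<Phi>" "smooth \<Psi>"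
    "\<forall>x. \<Phi> (\<Psi> x) = x" "\<forall>x. \<Psi> (\<Phi> x) = x" "\<forall>x. \<Phi> x $ i = x $ i"
    "\<forall>x. x \<notin> inner_cube (\<rho>/2) \<longrightarrow> \<Phi> x = x" "\<forall>x. x $ i = 0 \<longrightarrow> \<Phi> x = x"
    "\<forall>x. x $ i = 0 \<longrightarrow> (\<Phi> has_derivative (\<lambda>v. v - v $ i *\<^sub>R b x)) (at x)"
    "C > 0" "\<forall>x y. dist x y \<le> C * dist (\<Phi> x) (\<Phi> y)"
    by (rule straightening[OF sb bi compact_inner_cube b0])
  note \<Phi> = \<Phi>0[rule_format]
  \<comment> \<open>On the hyperplane the derivative of \<open>\<Phi>\<close> sends
    \<open>b p + axis i 1\<close> to the axis, on which the horizontal covector vanishes. So the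
    gradient at \<open>p\<close> kills the averaged direction exactly and equals \<open>n p\<close>
    up to \<open>\<eta>\<close>.\<close>
  define \<theta> where "\<theta> p = (if p \<in> Dv then (\<lambda>x. x $ i) else (\<lambda>x. hor i (n p) \<bullet> \<Phi> x))" for p
  define c where "c p = (if p \<in> Dv then SOME c. good p (axis i 1) c else c0 p)" for p
  have s\<theta>: "smooth (\<theta> p)" for p
    by (auto simp: \<theta>_def intro!: smooth_component smooth_id smooth_inner smooth_const \<Phi>)
  have gp: "good p (grad (\<theta> p) p) (c p)" if p: "p \<in> D" for p
  proof (cases "p \<in> Dv")
    case True
    then have "\<exists>c. good p (axis i 1) c" by (simp add: Dv_def)
    from someI_ex[OF this] show ?thesis using True by (simp add: \<theta>_def c_def grad_component)
  next
    case False
    then have pn: "p \<in> Dn" and pc: "p \<in> cube" and pi: "p $ i = 0" using p Dcube by (auto simp: Dn_def D_def)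
    have "((\<lambda>x. hor i (n p) \<bullet> \<Phi> x) has_derivative (\<lambda>v. hor i (n p) \<bullet> (v - v $ i *\<^sub>R b p))) (at p)"
      by (rule has_derivative_inner_right[OF \<Phi>(8)[OF pi]])
    from frechet_derivative_at[OF this, symmetric]
    have g: "grad (\<theta> p) p = (\<chi> k. hor i (n p) \<bullet> (axis k 1 - axis k 1 $ i *\<^sub>R b p))"
      using False by (simp add: grad_def \<theta>_def)
    show ?thesis
      unfolding good_def
    proof (intro allI impI)
      fix \<alpha> :: "'m multiset" assume \<alpha>: "size \<alpha> = r"
      have "norm (mon (grad (\<theta> p) p) \<alpha> *\<^sub>R c0 p - mon (n p) \<alpha> *\<^sub>R c0 p) \<le> real r * 2 ^ r * \<eta> * norm (c0 p)"
        using horizontal_perturbation[OF n(3)[OF pc] bi bn[OF pn] \<eta>(2), of \<alpha> "c0 p"] unfolding g \<alpha> .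
      also have "\<dots> \<le> real r * 2 ^ r * \<eta> * M" using M[OF pc] \<eta>(1) by (intro mult_left_mono) auto
      also have "\<dots> = Q * \<eta>" by (simp add: Q_def)
      also note Q\<eta>
      finally show "norm (mon (grad (\<theta> p) p) \<alpha> *\<^sub>R c p - \<sigma> p \<alpha>) < \<epsilon>"
        using False struct[OF pc \<alpha>] by (simp add: c_def)
    qed
  qed
  \<comment> \<open>A second partition of unity is taken, now over all of \<open>D\<close>: its
    radii depend on the phases, hence on \<open>\<Phi>\<close>, which was built from the first
    one.\<close>
  have "\<exists>e>0. \<forall>q\<in>cube. dist p q < e \<longrightarrow> good q (grad (\<theta> p) q) (c p)" if "p \<in> D" for p
    using nearby[OF isCont_grad[OF s\<theta>] Dcube[OF that] gp[OF that]] .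
  then obtain \<rho>2 where \<rho>2: "\<And>p. p \<in> D \<Longrightarrow> 0 < \<rho>2 p" "\<And>p. p \<in> D \<Longrightarrow> \<rho>2 p \<le> \<rho>/2"
    "\<And>p q. p \<in> D \<Longrightarrow> q \<in> cube \<Longrightarrow> dist p q < \<rho>2 p \<Longrightarrow> good q (grad (\<theta> p) q) (c p)"
    using choose_radii[of D cube "\<lambda>p q. good q (grad (\<theta> p) q) (c p)" "\<rho>/2"] \<rho> half_gt_zero by blast
  obtain P2 and \<phi> :: "real^'m \<Rightarrow> real^'m \<Rightarrow> real" and O2 where P20: "finite P2" "P2 \<subseteq> D" "\<forall>p\<in>P2. smooth (\<phi> p)"
    "\<forall>p\<in>P2. \<forall>x. 0 \<le> \<phi> p x" "\<forall>p\<in>P2. \<forall>x. dist p x \<ge> \<rho>2 p \<longrightarrow> \<phi> p x = 0"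
    "\<forall>x. (\<Sum>p\<in>P2. \<phi> p x) \<le> 1" "open O2" "D \<subseteq> O2" "\<forall>x\<in>O2. (\<Sum>p\<in>P2. \<phi> p x) = 1"
    by (rule compact_partition_of_unity[OF cD \<rho>2(1)])
  note P2 = P20[rule_format]
  have un: "(P2 \<inter> Dv) \<union> (P2 - Dv) = P2" by blast
  show thesis
  proof (rule that[of \<Phi> \<Psi> C "P2 \<inter> Dv" "P2 - Dv" \<theta> "\<lambda>p. hor i (n p)" \<phi> O2 c], unfold un)
    show "\<forall>p\<in>P2. \<forall>x. x \<notin> inner_cube (\<rho>/2) \<longrightarrow> \<phi> p x = 0"
    proof (intro ballI allI impI)
      fix p x :: "real^'m" assume p: "p \<in> P2" and x: "x \<notin> inner_cube (\<rho>/2)"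
      then have "p \<in> D" using P2(2) by blast
      then show "\<phi> p x = 0" using \<rho>2(2)[of p] far[of p x] x by (intro P2(5)[OF p]) linarith
    qed
    show "\<forall>p\<in>P2. \<forall>x\<in>cube. \<phi> p x \<noteq> 0 \<longrightarrow>
      (\<forall>\<alpha>. size \<alpha> = r \<longrightarrow> norm (mon (grad (\<theta> p) x) \<alpha> *\<^sub>R c p - \<sigma> x \<alpha>) \<le> \<epsilon>)"
    proof (intro ballI allI impI)
      fix p x \<alpha> assume p: "p \<in> P2" and x: "x \<in> cube" "\<phi> p x \<noteq> 0" and \<alpha>: "size (\<alpha> :: 'm multiset) = r"
      have "p \<in> D" using p P2(2) by blast
      moreover have "dist p x < \<rho>2 p" using P2(5)[OF p, of x] x(2) by linarith
      ultimately have "good x (grad (\<theta> p) x) (c p)" using \<rho>2(3) x(1) by blast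
      then show "norm (mon (grad (\<theta> p) x) \<alpha> *\<^sub>R c p - \<sigma> x \<alpha>) \<le> \<epsilon>"
        using \<alpha> unfolding good_def by (intro less_imp_le) blast
    qed
  qed (use \<Phi> P2 in \<open>auto simp: \<theta>_def D_def\<close>)
qed

section \<open>Cutoffs, and the assembly of the approximation\<close>

lemma cube_cutoff:
  assumes "0 \<le> s" "s < t" "t \<le> 1"
  obtains \<zeta> :: "real^'m \<Rightarrow> real" and \<kappa> where "smooth \<zeta>" "\<And>x. 0 \<le> \<zeta> x" "\<And>x. \<zeta> x \<le> 1"
    "\<And>x. x \<in> inner_cube t \<Longrightarrow> \<zeta> x = 1" "\<And>x. x \<notin> inner_cube s \<Longrightarrow> \<zeta> x = 0"
    "\<kappa> \<ge> 0" "\<And>x y. dist (\<zeta> x) (\<zeta> y) \<le> \<kappa> * dist x y"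
proof -
  have st: "0 \<le> 1 - t" "1 - t < 1 - s" using assms by auto
  define \<zeta> where "\<zeta> x = (\<Prod>i\<in>UNIV. bump (1 - t) (1 - s) 0 (x $ i))" for x :: "real^'m"
  have sm: "smooth \<zeta>"
    unfolding \<zeta>_def[abs_def] by (intro smooth_prod smooth_compose[OF smooth_bump] smooth_component smooth_id)
  have z: "\<zeta> x = 0" if x: "x \<notin> inner_cube s" for x
  proof -
    obtain i where "\<bar>x $ i\<bar> > 1 - s" using x by (auto simp: inner_cube_def not_le)
    then have "bump (1 - t) (1 - s) 0 (x $ i) = 0" by (intro bump_simps(2)[OF st]) simp
    then show ?thesis unfolding \<zeta>_def by (intro prod_zero) auto
  qed
  obtain \<kappa> where \<kappa>: "\<kappa> \<ge> 0" "\<And>x y. dist (\<zeta> x) (\<zeta> y) \<le> \<kappa> * dist x y"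
    using compact_support_lipschitz[OF sm compact_inner_cube z] by blast
  show thesis
  proof (rule that[OF sm _ _ _ z \<kappa>])
    show "0 \<le> \<zeta> x" "\<zeta> x \<le> 1" for x
      unfolding \<zeta>_def by (intro prod_nonneg prod_le_1 ballI conjI bump_simps(3,4)[OF st])+
    show "\<zeta> x = 1" if "x \<in> inner_cube t" for x
      unfolding \<zeta>_def using that by (intro prod.neutral ballI bump_simps(1)[OF st]) (simp add: inner_cube_def)
  qed
qed

text \<open>On the compact part outside \<open>O'\<close> the continuous function
  \<open>\<bar>x $ i\<bar>\<close> attains a minimum, which is positive.\<close>

lemma inner_cube_neighbourhood:
  fixes O' :: "(real^'m) set"
  assumes "open O'" "{x \<in> inner_cube \<rho>. x $ i = 0} \<subseteq> O'"
  obtains s where "s > 0" "\<And>x. x \<in> inner_cube \<rho> \<Longrightarrow> \<bar>x $ i\<bar> < s \<Longrightarrow> x \<in> O'"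
proof (cases "inner_cube \<rho> - O' = {}")
  case True then show thesis by (intro that[of 1]) auto
next
  case False
  have c: "compact (inner_cube \<rho> - O')" using assms compact_inner_cube compact_diff by blast
  have "continuous_on (inner_cube \<rho> - O') (\<lambda>x. \<bar>x $ i\<bar>)" by (intro continuous_intros)
  from continuous_attains_inf[OF c False this] obtain x0
    where x0: "x0 \<in> inner_cube \<rho> - O'" "\<And>x. x \<in> inner_cube \<rho> - O' \<Longrightarrow> \<bar>x0 $ i\<bar> \<le> \<bar>x $ i\<bar>" by blast
  have "x0 $ i \<noteq> 0" using x0(1) assms(2) by blast
  then show thesis using x0(2) by (intro that[of "\<bar>x0 $ i\<bar>"]) (force simp: not_le)+
qed

lemma pdl_vanishes_off_support:
  assumes "closed S" "\<And>x. x \<notin> S \<Longrightarrow> h x = 0"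
  shows "x \<notin> S \<Longrightarrow> pdl vs h x = 0"
proof (induction vs arbitrary: x)
  case (Cons v vs)
  have "(pdl vs h has_derivative (\<lambda>_. 0)) (at x)"
    by (rule has_derivative_transform_within_open[of "\<lambda>_. 0" _ _ UNIV "- S"])
      (use Cons assms(1) in \<open>auto intro: open_Compl\<close>)
  from frechet_derivative_at[OF this, symmetric] show ?case by simp
qed (use assms in auto)

theorem mainTheorem8:
  fixes k r :: nat
    and e :: "'m::finite \<Rightarrow> nat"
    and \<tau> :: "real^'m \<Rightarrow> (real^'m) set"
    and \<sigma> :: "('m, 'n::finite) jet_section"
  assumes "bij_betw e UNIV {..<CARD('m)}"
    and "k < CARD('m)" and "r \<ge> 1"
    and "smooth_hyperplane_field \<tau>"
    and "smooth_jet_section r \<sigma>"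
    and "\<exists>W. open W \<and> frontier cube \<subseteq> W \<and>
           (\<forall>x\<in>W \<inter> cube. \<forall>\<alpha>. size \<alpha> \<le> r \<longrightarrow> \<sigma> x \<alpha> = 0)"
    and "\<forall>x\<in>cube. perp_zero_at r \<tau> \<sigma> x"
  shows "\<forall>\<epsilon>>0. \<exists>F (\<sigma>h :: ('m, 'n) jet_section).
     isotopy F \<and> holonomic r \<sigma>h \<and>
     (\<exists>V. open V \<and> F 1 ` cube_k e k \<subseteq> V \<and>
        (\<exists>\<delta><\<epsilon>. \<forall>x\<in>V \<inter> cube. \<forall>\<alpha>. size \<alpha> \<le> r \<longrightarrow> norm (\<sigma>h x \<alpha> - \<sigma> x \<alpha>) \<le> \<delta>)) \<and>
     (\<exists>\<delta><\<epsilon>. \<forall>x\<in>cube. perp_bound_at r \<tau> \<sigma>h x \<delta>) \<and>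
     (\<exists>\<delta><\<epsilon>. \<forall>t\<in>{0..1}. \<forall>x\<in>cube. dist (F t x) x \<le> \<delta>) \<and>
     (\<exists>W. open W \<and> frontier cube \<subseteq> W \<and>
        (\<forall>t\<in>{0..1}. \<forall>x\<in>W \<inter> cube. F t x = x) \<and>
        (\<forall>x\<in>W \<inter> cube. \<forall>\<alpha>. size \<alpha> \<le> r \<longrightarrow> \<sigma>h x \<alpha> = 0))"
proof (intro allI impI)
  fix \<epsilon> :: real assume \<epsilon>: "\<epsilon> > 0"
  \<comment> \<open>The last coordinate has index at least \<open>k\<close>, so it vanishes on the
    small cube; the rest of the proof sees only this hyperplane.\<close>
  let ?m = "real CARD('m)"
  have m1: "?m \<ge> 1" by (simp add: Suc_leI)
  obtain i where i: "e i = CARD('m) - 1"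
  proof -
    have "CARD('m) - 1 \<in> e ` UNIV" using assms(1) by (simp add: bij_betw_def)
    then show thesis using that by (metis imageE)
  qed
  have plane: "x $ i = 0" "x \<in> cube" if "x \<in> cube_k e k" for x
    using that assms(2) i by (auto simp: cube_k_def)
  obtain W0 where W0: "open W0 \<and> frontier cube \<subseteq> W0 \<and>
           (\<forall>x\<in>W0 \<inter> cube. \<forall>\<alpha>. size \<alpha> \<le> r \<longrightarrow> \<sigma> x \<alpha> = 0)"
    using assms(6) by (elim exE)
  obtain \<rho>0 where \<rho>0: "0 < \<rho>0" "\<And>x::real^'m. x \<in> cube \<Longrightarrow> x \<notin> inner_cube \<rho>0 \<Longrightarrow> x \<in> W0"
    using W0 ex_inner_cube[of W0] by blast
  define \<rho> where "\<rho> = min \<rho>0 1"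
  have \<rho>: "0 < \<rho>" "\<rho> \<le> 1" using \<rho>0 by (auto simp: \<rho>_def)
  have \<sigma>0: "\<sigma> x \<alpha> = 0" if "x \<in> cube" "x \<notin> inner_cube \<rho>" "size \<alpha> \<le> r" for x \<alpha>
  proof -
    have "x \<notin> inner_cube \<rho>0" using that(2) inner_cube_mono[of \<rho> \<rho>0] by (auto simp: \<rho>_def)
    then show ?thesis using W0 \<rho>0(2) that by blast
  qed
  have cont: "continuous_on cube (\<lambda>x. \<sigma> x \<alpha>)" if "size \<alpha> = r" for \<alpha>
    using assms(5) that by (auto simp: smooth_jet_section_def intro: smooth_on_set_continuous)
  obtain B1 B2 where B12: "\<forall>s. \<bar>(deriv ^^ r) (monomial_bump r) s\<bar> \<le> B1" "\<forall>s. \<bar>(deriv ^^ r) (saw r) s\<bar> \<le> B2"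
    using monomial_bump_bounded saw_bounded by meson
  define B where "B = max 1 (max B1 B2)"
  have B: "B \<ge> 1" "\<And>s. \<bar>(deriv ^^ r) (monomial_bump r) s\<bar> \<le> B" "\<And>s. \<bar>(deriv ^^ r) (saw r) s\<bar> \<le> B"
    using B12 by (auto simp: B_def le_max_iff_disj)
  \<comment> \<open>The estimate in directions of the field sums over all coordinates and multiplies
    by the bound \<open>B\<close> of the factors.\<close>
  define \<epsilon>' where "\<epsilon>' = \<epsilon> / (4 * ?m * B)"
  have mB: "?m * B \<ge> 1" using mult_mono[of 1 ?m 1 B] m1 B(1) by simp
  have \<epsilon>': "\<epsilon>' > 0" "?m * B * \<epsilon>' = \<epsilon> / 4" "\<epsilon>' \<le> \<epsilon> / 4"
  proof -
    show "\<epsilon>' > 0" unfolding \<epsilon>'_def using \<epsilon> m1 B(1) by (intro divide_pos_pos mult_pos_pos) auto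
    show eq: "?m * B * \<epsilon>' = \<epsilon> / 4" using m1 B(1) by (simp add: \<epsilon>'_def field_simps)
    show "\<epsilon>' \<le> \<epsilon> / 4" using mult_right_mono[OF mB, of \<epsilon>'] \<open>\<epsilon>' > 0\<close> unfolding eq by simp
  qed
  obtain \<Phi> \<Psi> :: "real^'m \<Rightarrow> real^'m" and C :: real and J K :: "(real^'m) set"
    and \<phi> :: "real^'m \<Rightarrow> real^'m \<Rightarrow> real" and c :: "real^'m \<Rightarrow> real^'n" and \<theta> a O'
  where \<Phi>: "smooth \<Phi>" "smooth \<Psi>"
    "\<forall>x. \<Phi> (\<Psi> x) = x" "\<forall>x. \<Psi> (\<Phi> x) = x" "\<forall>x. \<Phi> x $ i = x $ i"
    "\<forall>x. x \<notin> inner_cube (\<rho>/2) \<longrightarrow> \<Phi> x = x" "\<forall>x. x $ i = 0 \<longrightarrow> \<Phi> x = x"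
    "C > 0" "\<forall>x y. dist x y \<le> C * dist (\<Phi> x) (\<Phi> y)"
    and JK: "finite J" "finite K" "J \<inter> K = {}"
    "\<forall>p\<in>J. \<theta> p = (\<lambda>x. x $ i)" "\<forall>p\<in>K. \<theta> p = (\<lambda>x. a p \<bullet> \<Phi> x)" "\<forall>p\<in>K. a p $ i = 0"
    and \<phi>: "\<forall>p\<in>J \<union> K. smooth (\<phi> p)" "\<forall>p\<in>J \<union> K. \<forall>x. 0 \<le> \<phi> p x"
    "\<forall>p\<in>J \<union> K. \<forall>x. x \<notin> inner_cube (\<rho>/2) \<longrightarrow> \<phi> p x = 0" "\<forall>x. (\<Sum>p\<in>J \<union> K. \<phi> p x) \<le> 1"
    and O': "open O'" "{x \<in> inner_cube \<rho>. x $ i = 0} \<subseteq> O'" "\<forall>x\<in>O'. (\<Sum>p\<in>J \<union> K. \<phi> p x) = 1"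
    and near: "\<forall>p\<in>J \<union> K. \<forall>x\<in>cube. \<phi> p x \<noteq> 0 \<longrightarrow>
      (\<forall>\<alpha>. size \<alpha> = r \<longrightarrow> norm (mon (grad (\<theta> p) x) \<alpha> *\<^sub>R c p - \<sigma> x \<alpha>) \<le> \<epsilon>')"
    by (rule ex_phases[OF assms(4) cont assms(7)[rule_format] assms(3) \<rho>(1) \<epsilon>'(1), where i = i])
  obtain s0 where s0: "s0 > 0" "\<And>x. x \<in> inner_cube \<rho> \<Longrightarrow> \<bar>x $ i\<bar> < s0 \<Longrightarrow> x \<in> O'"
    by (rule inner_cube_neighbourhood[OF O'(1,2)]) blast
  \<comment> \<open>\<open>h\<close> and the straightening live in
    \<open>inner_cube (\<rho>/2)\<close>, the cutoff falls between the margins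
    \<open>\<rho>/4\<close> and \<open>\<rho>/8\<close>, and displacements will be at most
    \<open>\<rho>/8\<close>. So points where the cutoff is not one stay where both jets
    vanish.\<close>
  obtain \<zeta> :: "real^'m \<Rightarrow> real" and \<kappa> where \<zeta>: "smooth \<zeta>" "\<And>x. 0 \<le> \<zeta> x" "\<And>x. \<zeta> x \<le> 1"
    "\<And>x. x \<in> inner_cube (\<rho>/4) \<Longrightarrow> \<zeta> x = 1" "\<And>x. x \<notin> inner_cube (\<rho>/8) \<Longrightarrow> \<zeta> x = 0"
    and \<kappa>: "\<kappa> \<ge> 0" "\<And>x y. dist (\<zeta> x) (\<zeta> y) \<le> \<kappa> * dist x y"
    by (rule cube_cutoff[of "\<rho>/8" "\<rho>/4"]) (use \<rho> in auto)
  \<comment> \<open>In this order the bounds serve sums over the coordinates, invertibility of the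
    shear, the margins, closeness of the isotopy to the identity, and keeping the graph in the zone
    where the weights sum to one.\<close>
  define \<eta> where "\<eta> = Min {\<epsilon> / (8 * ?m), 1 / (2 * (\<kappa> + 1)), \<rho> / (8 * C), \<epsilon> / (2 * C), s0 / 2}"
  have \<eta>_le: "\<eta> \<le> \<epsilon> / (8 * ?m)" "\<eta> \<le> 1 / (2 * (\<kappa> + 1))" "\<eta> \<le> \<rho> / (8 * C)" "\<eta> \<le> \<epsilon> / (2 * C)" "\<eta> \<le> s0 / 2"
    unfolding \<eta>_def by (rule Min_le; simp)+
  have \<eta>0: "\<eta> > 0"
    unfolding \<eta>_def using \<epsilon> m1 \<kappa>(1) \<rho> \<Phi>(8) s0(1) by (subst Min_gr_iff) auto
  have \<eta>m: "?m * \<eta> \<le> \<epsilon> / 8" "\<eta> \<le> \<epsilon> / 8"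
  proof -
    show 1: "?m * \<eta> \<le> \<epsilon> / 8" using \<eta>_le(1) m1 by (simp add: field_simps)
    show "\<eta> \<le> \<epsilon> / 8" using mult_right_mono[OF m1, of \<eta>] 1 \<eta>0 by linarith
  qed
  have \<eta>\<kappa>: "\<eta> * \<kappa> \<le> 1/2"
  proof -
    have "\<eta> * \<kappa> \<le> 1 / (2 * (\<kappa> + 1)) * (\<kappa> + 1)" using \<eta>_le(2) \<kappa>(1) \<eta>0 by (intro mult_mono) auto
    also have "\<dots> = 1/2" using \<kappa>(1) by (simp add: field_simps)
    finally show ?thesis .
  qed
  have C\<eta>: "C * \<eta> \<le> \<rho> / 8" "C * \<eta> \<le> \<epsilon> / 2"
    using \<eta>_le(3,4) \<Phi>(8) by (simp_all add: field_simps)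
  define Cp where "Cp p x = \<phi> p x *\<^sub>R c p" for p x
  have "\<exists>h W \<tau>'. corrugated r i \<Phi> (inner_cube (\<rho>/2)) B (J \<union> K) Cp \<theta> \<eta> h W \<tau>'"
  proof (rule ex_corrugated[OF JK(1-3) _ _ _ \<Phi>(1) _ _ compact_inner_cube B(2,3) \<eta>0])
    show "smooth (Cp p)" if "p \<in> J \<union> K" for p
      unfolding Cp_def[abs_def] using \<phi>(1) that by (intro smooth_scaleR smooth_const) blast
    show "Cp p x = 0" if "p \<in> J \<union> K" "x \<notin> inner_cube (\<rho>/2)" for p x
      using \<phi>(3) that unfolding Cp_def by (metis scaleR_zero_left)
  qed (use JK in blast)+
  then obtain h W \<tau>' where cor: "corrugated r i \<Phi> (inner_cube (\<rho>/2)) B (J \<union> K) Cp \<theta> \<eta> h W \<tau>'" by (elim exE)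
  from cor obtain L \<Lambda> where h: "smooth h" "\<forall>x. x \<notin> inner_cube (\<rho>/2) \<longrightarrow> h x = 0"
    and W: "smooth W" "\<forall>x s. W (x + s *\<^sub>R axis i 1) = W x" "\<forall>x. \<bar>W x\<bar> \<le> \<eta>" "\<forall>x y. \<bar>W x - W y\<bar> \<le> L * dist x y"
    and \<tau>': "\<tau>' > 0" and \<Lambda>: "\<forall>p\<in>J \<union> K. \<forall>x. \<bar>\<Lambda> p x\<bar> \<le> B"
    "\<forall>p x. p \<in> J \<union> K \<and> \<bar>x $ i - W (\<Phi> x)\<bar> \<le> \<tau>' \<longrightarrow> \<Lambda> p x = 1"
    "\<forall>vs x. set vs \<subseteq> axes \<and> length vs \<le> r \<longrightarrow>
        norm (pdl vs h x - (if length vs = r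
          then \<Sum>p\<in>J \<union> K. (\<Lambda> p x * (\<Prod>v\<leftarrow>vs. frechet_derivative (\<theta> p) (at x) v)) *\<^sub>R Cp p x else 0)) \<le> \<eta>"
    by (rule corrugatedE)
  let ?P = "J \<union> K"
  define G where "G x \<alpha> = (\<Sum>p\<in>?P. (\<Lambda> p x * \<phi> p x) *\<^sub>R (mon (grad (\<theta> p) x) \<alpha> *\<^sub>R c p))" for x \<alpha>
  have hest: "norm (pd_ms \<alpha> h x) \<le> \<eta>" if "size \<alpha> < r" for x \<alpha>
  proof -
    \<comment> \<open>\<open>pd_ms\<close> fixes an unspecified order of the coordinates; the
      estimate for \<open>h\<close> covers every list of axes, so any order will do.\<close>
    define l where "l = (SOME l. mset l = \<alpha>)"
    have l: "mset l = \<alpha>" unfolding l_def by (rule someI_ex[OF ex_mset])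
    have "length l = size \<alpha>" by (simp flip: l)
    then show ?thesis
      using \<Lambda>(3)[rule_format, of "map (\<lambda>i. axis i 1) l" x] that by (auto simp: pd_ms_def l_def[symmetric])
  qed
  have hest_r: "norm (pd_ms \<alpha> h x - G x \<alpha>) \<le> \<eta>" if \<alpha>: "size \<alpha> = r" for x \<alpha>
  proof -
    define l where "l = (SOME l. mset l = \<alpha>)"
    have l: "mset l = \<alpha>" unfolding l_def by (rule someI_ex[OF ex_mset])
    have ll: "length l = r" using \<alpha> by (simp flip: l)
    have "(\<Sum>p\<in>?P. (\<Lambda> p x * (\<Prod>v\<leftarrow>map (\<lambda>i. axis i 1) l. frechet_derivative (\<theta> p) (at x) v)) *\<^sub>R Cp p x) = G x \<alpha>"
      unfolding G_def Cp_def mon_grad[OF l] by (intro sum.cong) (simp_all add: mult_ac)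
    then show ?thesis
      using \<Lambda>(3)[rule_format, of "map (\<lambda>i. axis i 1) l" x] ll by (auto simp: pd_ms_def l_def[symmetric])
  qed
  define F where "F t x = \<Psi> (\<Phi> x + (t * W (\<Phi> x) * \<zeta> (\<Phi> x)) *\<^sub>R axis i 1)" for t x
  have iso: "isotopy F" "\<And>t x. x \<notin> inner_cube (\<rho>/8) \<Longrightarrow> F t x = x" "\<And>t x. t \<in> {0..1} \<Longrightarrow> dist (F t x) x \<le> C * \<eta>"
  proof -
    have S: "inner_cube (\<rho>/8) \<subseteq> (cube :: (real^'m) set)" using \<rho> by (intro inner_cube_subset) simp
    have Z: "\<zeta> (\<Phi> x) = 0" if x: "x \<notin> inner_cube (\<rho>/8)" for x
    proof -
      have "x \<notin> inner_cube (\<rho>/2)" using x \<rho> inner_cube_mono[of "\<rho>/8" "\<rho>/2"] by auto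
      then show ?thesis using \<Phi>(6) \<zeta>(5)[OF x] by simp
    qed
    note si = sheared_isotopy[OF \<Phi>(1,2) \<Phi>(3)[rule_format] \<Phi>(4)[rule_format] less_imp_le[OF \<Phi>(8)] \<Phi>(9)[rule_format]
        W(1) W(2)[rule_format] W(3)[rule_format] W(4)[rule_format] \<zeta>(1-3) \<kappa>(2) \<eta>\<kappa> S Z, folded F_def]
    have Fe: "F = (\<lambda>t x. \<Psi> (\<Phi> x + (t * W (\<Phi> x) * \<zeta> (\<Phi> x)) *\<^sub>R axis i 1))" by (intro ext) (simp add: F_def)
    show "isotopy F" unfolding Fe using si(1) by (simp add: F_def)
    show "F t x = x" if "x \<notin> inner_cube (\<rho>/8)" for t x by (rule si(2)) (use that in auto)
    show "dist (F t x) x \<le> C * \<eta>" if "t \<in> {0..1}" for t x by (rule si(3)) (use that in auto)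
  qed
  define \<sigma>h :: "('m, 'n) jet_section" where "\<sigma>h x \<alpha> = pd_ms \<alpha> h x" for x \<alpha>
  \<comment> \<open>The first part is a neighbourhood of the corrugated hypersurface on which all
    factors are one. In the second part both \<open>h\<close> and \<open>\<sigma>\<close> vanish,
    which covers points near the boundary that the cutoff keeps from reaching the
    hypersurface.\<close>
  define V where "V = {y. \<bar>y $ i - W (\<Phi> y)\<bar> < \<tau>' \<and> \<bar>y $ i\<bar> < s0} \<union> - inner_cube (\<rho>/2)"
  have holo: "holonomic r \<sigma>h"
    unfolding holonomic_def by (intro exI[of _ UNIV] exI[of _ h]) (simp add: h \<sigma>h_def)
  have openV: "open V"
    unfolding V_def Collect_conj_eq
    by (intro open_Un open_Int open_Collect_less continuous_intros open_Compl compact_imp_closed compact_inner_cube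
       smooth_continuous smooth_compose[OF W(1) \<Phi>(1)])
  have FV: "F 1 ` cube_k e k \<subseteq> V"
  proof
    fix y assume "y \<in> F 1 ` cube_k e k"
    then obtain x where x: "x \<in> cube_k e k" and y: "y = F 1 x" by blast
    have \<Phi>x: "\<Phi> x = x" using \<Phi>(7) plane(1)[OF x] by blast
    have \<Phi>y: "\<Phi> y = x + (W x * \<zeta> x) *\<^sub>R axis i 1" using \<Phi>(3) by (simp add: y F_def \<Phi>x)
    show "y \<in> V"
    proof (cases "x \<in> inner_cube (\<rho>/4)")
      case True
      have "y $ i = \<Phi> y $ i" using \<Phi>(5) by simp
      then have yi: "y $ i = W x" using \<zeta>(4)[OF True] plane(1)[OF x] by (simp add: \<Phi>y)
      have Wy: "W (\<Phi> y) = W x" unfolding \<Phi>y using W(2) by blast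
      have "\<bar>W x\<bar> \<le> \<eta>" using W(3) by blast
      then have "\<bar>W x\<bar> < s0" using \<eta>_le(5) s0(1) by linarith
      then show ?thesis using \<tau>' by (simp add: V_def yi Wy)
    next
      case False
      have "dist y x \<le> \<rho>/8" using iso(3)[of 1 x] C\<eta>(1) y by simp
      have "y \<notin> inner_cube (\<rho>/2)"
      proof
        assume "y \<in> inner_cube (\<rho>/2)"
        from inner_cube_dist[OF this False] show False using \<open>dist y x \<le> \<rho>/8\<close> \<rho> by linarith
      qed
      then show ?thesis by (simp add: V_def)
    qed
  qed
  have approx: "norm (\<sigma>h x \<alpha> - \<sigma> x \<alpha>) \<le> \<epsilon> / 2" if x: "x \<in> V \<inter> cube" and \<alpha>: "size \<alpha> \<le> r" for x \<alpha>
  proof (cases "size \<alpha> = r")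
    case False
    then have a: "size \<alpha> < r" using \<alpha> by simp
    then have "\<sigma> x \<alpha> = 0" using assms(7) x by (auto simp: perp_zero_at_def)
    then show ?thesis using hest[OF a, of x] \<eta>m(2) \<epsilon> by (simp add: \<sigma>h_def)
  next
    case True
    have xc: "x \<in> cube" using x by simp
    have "norm (G x \<alpha> - \<sigma> x \<alpha>) \<le> \<epsilon>'"
    proof (cases "x \<in> inner_cube (\<rho>/2)")
      case False
      have "x \<notin> inner_cube \<rho>" using False \<rho> inner_cube_mono[of "\<rho>/2" \<rho>] by auto
      then have "\<sigma> x \<alpha> = 0" using \<sigma>0[OF xc] \<alpha> by simp
      moreover have "G x \<alpha> = 0" unfolding G_def using \<phi>(3) False by (intro sum.neutral) auto
      ultimately show ?thesis using \<epsilon>'(1) by simp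
    next
      case inner: True
      have xV: "\<bar>x $ i - W (\<Phi> x)\<bar> < \<tau>'" "\<bar>x $ i\<bar> < s0" using x inner by (auto simp: V_def)
      have \<Lambda>1: "\<Lambda> p x = 1" if "p \<in> ?P" for p using \<Lambda>(2) that xV(1) by (meson less_imp_le)
      \<comment> \<open>Either the weights sum to one, or \<open>x\<close> lies in the collar where
        \<open>\<sigma>\<close> is zero.\<close>
      have "(\<Sum>p\<in>?P. \<phi> p x) *\<^sub>R \<sigma> x \<alpha> = \<sigma> x \<alpha>"
      proof (cases "x \<in> inner_cube \<rho>")
        case True then show ?thesis using s0(2)[OF True xV(2)] O'(3) by simp
      next
        case False then show ?thesis using \<sigma>0[OF xc False \<alpha>] by simp
      qed
      then have "G x \<alpha> - \<sigma> x \<alpha> = (\<Sum>p\<in>?P. \<phi> p x *\<^sub>R (mon (grad (\<theta> p) x) \<alpha> *\<^sub>R c p)) - (\<Sum>p\<in>?P. \<phi> p x *\<^sub>R \<sigma> x \<alpha>)"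
      proof -
        have "G x \<alpha> = (\<Sum>p\<in>?P. \<phi> p x *\<^sub>R (mon (grad (\<theta> p) x) \<alpha> *\<^sub>R c p))"
          unfolding G_def by (intro sum.cong refl) (simp add: \<Lambda>1)
        with \<open>(\<Sum>p\<in>?P. \<phi> p x) *\<^sub>R \<sigma> x \<alpha> = \<sigma> x \<alpha>\<close> show ?thesis by (simp only: scaleR_sum_left)
      qed
      also have "\<dots> = (\<Sum>p\<in>?P. \<phi> p x *\<^sub>R (mon (grad (\<theta> p) x) \<alpha> *\<^sub>R c p - \<sigma> x \<alpha>))"
        by (simp only: scaleR_diff_right sum_subtractf)
      also have "norm \<dots> \<le> (\<Sum>p\<in>?P. \<phi> p x * \<epsilon>')"
      proof (rule sum_norm_le)
        fix p assume p: "p \<in> ?P"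
        show "norm (\<phi> p x *\<^sub>R (mon (grad (\<theta> p) x) \<alpha> *\<^sub>R c p - \<sigma> x \<alpha>)) \<le> \<phi> p x * \<epsilon>'"
        proof (cases "\<phi> p x = 0")
          case False
          from near[rule_format, OF p xc False True] \<phi>(2)[rule_format, OF p, of x] show ?thesis
            by (simp add: mult_left_mono)
        qed simp
      qed
      also have "\<dots> \<le> 1 * \<epsilon>'"
        unfolding sum_distrib_right[symmetric] using \<phi>(4) \<epsilon>'(1) by (intro mult_right_mono) auto
      finally show ?thesis by simp
    qed
    then have "norm ((pd_ms \<alpha> h x - G x \<alpha>) + (G x \<alpha> - \<sigma> x \<alpha>)) \<le> \<eta> + \<epsilon>'"
      by (intro norm_triangle_mono hest_r[OF True])
    then show ?thesis using \<eta>m(2) \<epsilon>'(3) \<epsilon> by (simp add: \<sigma>h_def)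
  qed
  have perp: "perp_bound_at r \<tau> \<sigma>h x (\<epsilon> / 2)" if xc: "x \<in> cube" for x
    unfolding perp_bound_at_def
  proof (intro conjI allI impI ballI)
    fix \<alpha> :: "'m multiset" assume a: "size \<alpha> < r"
    show "norm (\<sigma>h x \<alpha>) \<le> \<epsilon> / 2" using hest[OF a, of x] \<eta>m(2) \<epsilon> by (simp add: \<sigma>h_def)
    fix \<nu> assume \<nu>: "\<nu> \<in> \<tau> x" "norm \<nu> = 1"
    have \<nu>1: "\<bar>\<nu> $ j\<bar> \<le> 1" for j using component_le_norm_cart[of \<nu> j] \<nu>(2) by simp
    have avg: "norm (\<Sum>j\<in>UNIV. (\<nu> $ j) *\<^sub>R f j) \<le> ?m * b"
      if "\<And>j. norm (f j) \<le> b" for f :: "'m \<Rightarrow> real^'n" and b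
    proof -
      have "norm (\<Sum>j\<in>UNIV. (\<nu> $ j) *\<^sub>R f j) \<le> (\<Sum>j\<in>(UNIV :: 'm set). b)"
      proof (rule sum_norm_le)
        fix j
        have "\<bar>\<nu> $ j\<bar> * norm (f j) \<le> 1 * b" using \<nu>1 that by (intro mult_mono) auto
        then show "norm ((\<nu> $ j) *\<^sub>R f j) \<le> b" by simp
      qed
      then show ?thesis by simp
    qed
    show "norm (jet_dir \<sigma>h x \<nu> \<alpha>) \<le> \<epsilon> / 2"
    proof (cases "size \<alpha> = r - 1")
      case False
      then have "norm (jet_dir \<sigma>h x \<nu> \<alpha>) \<le> ?m * \<eta>"
        unfolding jet_dir_def \<sigma>h_def using a by (intro avg hest) simp
      then show ?thesis using \<eta>m(1) \<epsilon> by linarith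
    next
      case True
      then have sz: "size (add_mset j \<alpha>) = r" for j using a by simp
      have \<sigma>\<nu>: "(\<Sum>j\<in>UNIV. (\<nu> $ j) *\<^sub>R \<sigma> x (add_mset j \<alpha>)) = 0"
        using assms(7) xc True \<nu>(1) by (auto simp: perp_zero_at_def jet_dir_def)
      \<comment> \<open>The contraction of \<open>\<sigma> x\<close> with \<open>\<nu>\<close> is
        zero, so it can be subtracted from every piece at no cost. Of the factors
        \<open>\<Lambda>\<close> only the bound \<open>B\<close> enters, so the estimate holds on
        the whole cube.\<close>
      let ?d = "\<lambda>p j. mon (grad (\<theta> p) x) (add_mset j \<alpha>) *\<^sub>R c p - \<sigma> x (add_mset j \<alpha>)"
      have "(\<Sum>j\<in>UNIV. (\<nu> $ j) *\<^sub>R G x (add_mset j \<alpha>))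
          = (\<Sum>j\<in>UNIV. \<Sum>p\<in>?P. (\<Lambda> p x * \<phi> p x) *\<^sub>R ((\<nu> $ j) *\<^sub>R (mon (grad (\<theta> p) x) (add_mset j \<alpha>) *\<^sub>R c p)))"
        unfolding G_def scaleR_sum_right by (intro sum.cong refl) (simp add: mult_ac)
      also have "\<dots> = (\<Sum>p\<in>?P. \<Sum>j\<in>UNIV. (\<Lambda> p x * \<phi> p x) *\<^sub>R ((\<nu> $ j) *\<^sub>R (mon (grad (\<theta> p) x) (add_mset j \<alpha>) *\<^sub>R c p)))"
        by (rule sum.swap)
      also have "\<dots> = (\<Sum>p\<in>?P. (\<Lambda> p x * \<phi> p x) *\<^sub>R (\<Sum>j\<in>UNIV. (\<nu> $ j) *\<^sub>R ?d p j))"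
        by (simp only: scaleR_sum_right[symmetric] scaleR_diff_right sum_subtractf \<sigma>\<nu> diff_zero)
      also have "norm \<dots> \<le> (\<Sum>p\<in>?P. \<phi> p x * (B * (?m * \<epsilon>')))"
      proof (rule sum_norm_le)
        fix p assume p: "p \<in> ?P"
        show "norm ((\<Lambda> p x * \<phi> p x) *\<^sub>R (\<Sum>j\<in>UNIV. (\<nu> $ j) *\<^sub>R ?d p j)) \<le> \<phi> p x * (B * (?m * \<epsilon>'))"
        proof (cases "\<phi> p x = 0")
          case False
          have 1: "norm (\<Sum>j\<in>UNIV. (\<nu> $ j) *\<^sub>R ?d p j) \<le> ?m * \<epsilon>'"
            by (rule avg) (rule near[rule_format, OF p xc False sz])
          have "\<bar>\<Lambda> p x\<bar> * norm (\<Sum>j\<in>UNIV. (\<nu> $ j) *\<^sub>R ?d p j) \<le> B * (?m * \<epsilon>')"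
            using \<Lambda>(1)[rule_format, OF p, of x] 1 B(1) by (intro mult_mono) auto
          from mult_left_mono[OF this \<phi>(2)[rule_format, OF p, of x]] show ?thesis
            using \<phi>(2)[rule_format, OF p, of x] by (simp only: norm_scaleR abs_mult abs_of_nonneg mult_ac)
        qed simp
      qed
      also have "\<dots> \<le> 1 * (B * (?m * \<epsilon>'))"
        unfolding sum_distrib_right[symmetric] using \<phi>(4) \<epsilon>'(1) B(1) by (intro mult_right_mono) auto
      also have "\<dots> = \<epsilon> / 4" using \<epsilon>'(2) by (simp add: mult_ac)
      finally have 2: "norm (\<Sum>j\<in>UNIV. (\<nu> $ j) *\<^sub>R G x (add_mset j \<alpha>)) \<le> \<epsilon> / 4" .
      have "jet_dir \<sigma>h x \<nu> \<alpha> = (\<Sum>j\<in>UNIV. (\<nu> $ j) *\<^sub>R (pd_ms (add_mset j \<alpha>) h x - G x (add_mset j \<alpha>)))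
          + (\<Sum>j\<in>UNIV. (\<nu> $ j) *\<^sub>R G x (add_mset j \<alpha>))"
        by (simp add: jet_dir_def \<sigma>h_def scaleR_diff_right sum_subtractf)
      also have "norm \<dots> \<le> ?m * \<eta> + \<epsilon> / 4"
        by (intro norm_triangle_mono avg hest_r sz 2)
      finally show ?thesis using \<eta>m(1) \<epsilon> by linarith
    qed
  qed
  have close: "dist (F t x) x \<le> \<epsilon> / 2" if "t \<in> {0..1}" for t x
    using iso(3)[OF that, of x] C\<eta>(2) by linarith
  have bdry: "\<exists>W. open W \<and> frontier cube \<subseteq> W \<and>
        (\<forall>t\<in>{0..1}. \<forall>x\<in>W \<inter> cube. F t x = x) \<and>
        (\<forall>x\<in>W \<inter> cube. \<forall>\<alpha>. size \<alpha> \<le> r \<longrightarrow> \<sigma>h x \<alpha> = 0)"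
  proof (intro exI[of _ "- inner_cube (\<rho>/8)"] conjI ballI allI impI)
    show "open (- inner_cube (\<rho>/8) :: (real^'m) set)"
      by (intro open_Compl compact_imp_closed compact_inner_cube)
    show "frontier cube \<subseteq> - (inner_cube (\<rho>/8) :: (real^'m) set)"
    proof
      fix x :: "real^'m" assume "x \<in> frontier cube"
      then obtain j where "\<bar>x $ j\<bar> = 1" by (auto simp: frontier_cube)
      then have "\<not> \<bar>x $ j\<bar> \<le> 1 - \<rho>/8" using \<rho>(1) by simp
      then show "x \<in> - inner_cube (\<rho>/8)" unfolding inner_cube_def by blast
    qed
    show "F t x = x" if "x \<in> - inner_cube (\<rho>/8) \<inter> cube" for t x using iso(2) that by simp
    fix x :: "real^'m" and \<alpha> :: "'m multiset" assume x: "x \<in> - inner_cube (\<rho>/8) \<inter> cube"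
    have "x \<notin> inner_cube (\<rho>/2)" using x \<rho> inner_cube_mono[of "\<rho>/8" "\<rho>/2"] by auto
    then have "pdl vs h x = 0" for vs
      using pdl_vanishes_off_support[of "inner_cube (\<rho>/2)" h x vs] h(2)
      by (simp add: compact_imp_closed compact_inner_cube)
    then show "\<sigma>h x \<alpha> = 0" by (simp add: \<sigma>h_def pd_ms_def)
  qed
  have half: "\<epsilon> / 2 < \<epsilon>" using \<epsilon> by simp
  show "\<exists>F (\<sigma>h :: ('m, 'n) jet_section).
     isotopy F \<and> holonomic r \<sigma>h \<and>
     (\<exists>V. open V \<and> F 1 ` cube_k e k \<subseteq> V \<and>
        (\<exists>\<delta><\<epsilon>. \<forall>x\<in>V \<inter> cube. \<forall>\<alpha>. size \<alpha> \<le> r \<longrightarrow> norm (\<sigma>h x \<alpha> - \<sigma> x \<alpha>) \<le> \<delta>)) \<and>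
     (\<exists>\<delta><\<epsilon>. \<forall>x\<in>cube. perp_bound_at r \<tau> \<sigma>h x \<delta>) \<and>
     (\<exists>\<delta><\<epsilon>. \<forall>t\<in>{0..1}. \<forall>x\<in>cube. dist (F t x) x \<le> \<delta>) \<and>
     (\<exists>W. open W \<and> frontier cube \<subseteq> W \<and>
        (\<forall>t\<in>{0..1}. \<forall>x\<in>W \<inter> cube. F t x = x) \<and>
        (\<forall>x\<in>W \<inter> cube. \<forall>\<alpha>. size \<alpha> \<le> r \<longrightarrow> \<sigma>h x \<alpha> = 0))"
  proof (intro exI[of _ F] exI[of _ \<sigma>h] conjI iso(1) holo bdry)
    show "\<exists>V. open V \<and> F 1 ` cube_k e k \<subseteq> V \<and>
        (\<exists>\<delta><\<epsilon>. \<forall>x\<in>V \<inter> cube. \<forall>\<alpha>. size \<alpha> \<le> r \<longrightarrow> norm (\<sigma>h x \<alpha> - \<sigma> x \<alpha>) \<le> \<delta>)"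
      using openV FV approx half by blast
    show "\<exists>\<delta><\<epsilon>. \<forall>x\<in>cube. perp_bound_at r \<tau> \<sigma>h x \<delta>"
      using perp half by blast
    show "\<exists>\<delta><\<epsilon>. \<forall>t\<in>{0..1}. \<forall>x\<in>cube. dist (F t x) x \<le> \<delta>"
      using close half by blast
  qed
qed

end
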